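(* Let $\mathbb{H}$ be a family of graphs with $\gamma_{\mathbb{H}}\geq 1$. Then there exists $n_0$ such that for every integer $n\geq n_0$, every graph in ${\rm SPEX}(n,\mathbb{H}_{\rm sub})$ contains a spanning subgraph isomorphic to the generalized book $B_{\gamma_{\mathbb{H}},\,n-\gamma_{\mathbb{H}}}=K_{\gamma_{\mathbb{H}}}\vee (n-\gamma_{\mathbb{H}})K_1$.
   Context: All graphs are finite and simple. A subdivision of a graph $H$ is a graph obtained by replacing some edges of $H$ by internally vertex-disjoint paths. A graph $G$ is $\mathbb{H}$-subdivision-free if it contains no subdivision of any $H\in\mathbb{H}$ as a subgraph. The spectral radius $\rho(G)$ is the largest eigenvalue of the adjacency matrix of $G$. ${\rm SPEX}(n,\mathbb{H}_{\rm sub})$ denotes the set of $n$-vertex $\mathbb{H}$-subdivision-free graphs with maximum spectral radius among all $n$-vertex $\mathbb{H}$-subdivision-free graphs. For a graph $H$, $\alpha_H$ is its independence number, $\gamma_H:=|H|-\alpha_H-1$, and $\gamma_{\mathbb{H}}:=\min_{H\in\mathbb{H}}\gamma_H$. The generalized book $B_{s,t}:=K_s\vee(tK_1)$ is obtained by joining every vertex of an $s$-clique to every vertex of an independent set of $t$ vertices.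
   Formalization: The family of graphs is assumed finite and nonempty; for infinite families the claim can fail (a family containing K_{2,8} and infinitely many joins K_1 ∨ Q has γ = 1, but for infinitely many n no extremal graph has a spanning star). *)

theory Defs
  imports
    "Graph_Theory.Graph_Theory"
    "Jordan_Normal_Form.Spectral_Radius"
begin

text \<open>
  A finite simple graph is a \<open>pair_graph\<close>: a finite, loop-free, symmetric digraph without
  parallel arcs, so that an edge \<open>uv\<close> is the pair of arcs \<open>(u,v)\<close>, \<open>(v,u)\<close>. All graphs
  have vertices of type \<^typ>\<open>nat\<close>; every finite graph has an isomorphic copy of this kind,
  and there is always room for the new vertices of a subdivision.
\<close>

definition independent_set :: "nat pair_pre_digraph \<Rightarrow> nat set \<Rightarrow> bool" where
  "independent_set H S \<longleftrightarrow> S \<subseteq> pverts H \<and> (\<forall>u\<in>S. \<forall>v\<in>S. (u, v) \<notin> parcs H)"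

definition independence_number :: "nat pair_pre_digraph \<Rightarrow> nat" where
  "independence_number H = Max (card ` {S. independent_set H S})"

text \<open>Integer-valued: \<open>\<gamma> = - 1\<close> for graphs without edges.\<close>

definition graph_gamma :: "nat pair_pre_digraph \<Rightarrow> int" where
  "graph_gamma H = int (card (pverts H)) - int (independence_number H) - 1"

text \<open>Only meaningful for finite nonempty families.\<close>

definition family_gamma :: "nat pair_pre_digraph set \<Rightarrow> int" where
  "family_gamma \<H> = Min (graph_gamma ` \<H>)"

text \<open>
  \<^term>\<open>subdivision_pair H S\<close> says that \<open>S\<close> arises from \<open>H\<close> by repeatedly subdividing an
  edge with one new vertex (possibly never), i.e. by replacing some edges by internally
  vertex-disjoint paths. It keeps the names of the vertices of \<open>H\<close>, so the copy of \<open>S\<close> in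
  \<open>G\<close> is taken up to isomorphism.
\<close>

definition contains_subdivision :: "nat pair_pre_digraph \<Rightarrow> nat pair_pre_digraph \<Rightarrow> bool" where
  "contains_subdivision G H \<longleftrightarrow>
    (\<exists>S K :: nat pair_pre_digraph. subdivision_pair H S \<and> subgraph (with_proj K) (with_proj G) \<and>
      digraph_iso (with_proj S) (with_proj K))"

definition subdivision_free :: "nat pair_pre_digraph set \<Rightarrow> nat pair_pre_digraph \<Rightarrow> bool" where
  "subdivision_free \<H> G \<longleftrightarrow> (\<forall>H\<in>\<H>. \<not> contains_subdivision G H)"

text \<open>Rows and columns follow the increasing enumeration of the vertices.\<close>

definition adjacency_matrix :: "nat pair_pre_digraph \<Rightarrow> real mat" where
  "adjacency_matrix G =
    (let vs = sorted_list_of_set (pverts G); n = card (pverts G)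
     in Matrix.mat n n (\<lambda>(i, j). if (vs ! i, vs ! j) \<in> parcs G then 1 else 0))"

text \<open>
  The largest eigenvalue over the reals; the matrix is real symmetric, so the maximum is over
  a finite set which is nonempty if \<open>G\<close> has a vertex.
\<close>

definition graph_spectral_radius :: "nat pair_pre_digraph \<Rightarrow> real" where
  "graph_spectral_radius G = Max (spectrum (adjacency_matrix G))"

definition subdivision_free_graphs :: "nat \<Rightarrow> nat pair_pre_digraph set \<Rightarrow> nat pair_pre_digraph set" where
  "subdivision_free_graphs n \<H> = {G. pair_graph G \<and> card (pverts G) = n \<and> subdivision_free \<H> G}"

definition SPEX_sub :: "nat \<Rightarrow> nat pair_pre_digraph set \<Rightarrow> nat pair_pre_digraph set" where
  "SPEX_sub n \<H> =
    {G \<in> subdivision_free_graphs n \<H>.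
      \<forall>G' \<in> subdivision_free_graphs n \<H>. graph_spectral_radius G' \<le> graph_spectral_radius G}"

text \<open>The vertices below \<open>s\<close> form the clique, the remaining \<open>t\<close> vertices the independent set.\<close>

definition generalized_book :: "nat \<Rightarrow> nat \<Rightarrow> nat pair_pre_digraph" where
  "generalized_book s t =
    \<lparr> pverts = {..<s + t},
      parcs = {(u, v). u < s + t \<and> v < s + t \<and> u \<noteq> v \<and> (u < s \<or> v < s)} \<rparr>"

end

theory Submission
  imports Defs "HOL-Analysis.Function_Topology"
begin

text \<open>
  Let \<open>g\<close> be the \<open>\<gamma>\<close> of the family, attained at \<open>H\<close>. Then \<open>H\<close> has a vertex cover with \<open>g + 1\<close>
  vertices, while no graph of the family has a vertex cover with \<open>g\<close> vertices. Passing to a subdivision does not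
  decrease the vertex cover number, so the book on \<open>n\<close> vertices is admissible, and an extremal \<open>G\<close>
  has spectral radius \<open>r\<close> with \<open>r\<^sup>2 \<ge> g (n - g)\<close>.

  Since \<open>G\<close> contains no subdivision of \<open>H\<close>, every subgraph of \<open>G\<close> has linearly many edges (Mader),
  \<open>G\<close> contains no \<open>K\<^bsub>g+1,t\<^esub>\<close>, and only \<open>O(|L|)\<close> vertices outside a vertex set \<open>L\<close> have more than \<open>g\<close>
  neighbours in \<open>L\<close>. Counting walks of length two with weights from the eigenvector \<open>x\<close>, whose maximum
  is normalised to \<open>1\<close>, yields a set \<open>L\<close> of exactly \<open>g\<close> vertices with entries close to \<open>1\<close> that
  are all adjacent to almost all vertices; the entries outside \<open>L\<close> are small.

  If \<open>L\<close> is not completely joined to the rest and within itself, choose a vertex \<open>v\<close> outside \<open>L\<close> and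
  boundedly many common neighbours \<open>B\<close> of \<open>L\<close>. Make \<open>L\<close> a clique and give \<open>v\<close> and the
  vertices of \<open>B\<close> the neighbourhood \<open>L\<close>. Merely joining \<open>v\<close> to \<open>L\<close> could create a spanning
  subdivision of a forbidden graph; the twins \<open>B\<close> rule this out, because a subdivision uses boundedly
  many of them and thus can avoid \<open>v\<close>. The gain of the new edges exceeds the loss at \<open>B\<close>, so
  the spectral radius increases, which contradicts extremality.
\<close>

section \<open>Subdivisions and topological minors\<close>

lemma pair_graph_iff:
  "pair_graph G \<longleftrightarrow> finite (pverts G) \<and> parcs G \<subseteq> pverts G \<times> pverts G \<and> sym (parcs G) \<and> irrefl (parcs G)"
  (is "?L \<longleftrightarrow> ?R")
proof
  assume ?L
  then interpret pair_graph G .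
  show ?R
    using pair_finite_verts arcs_symmetric no_loops'
    by (auto simp: sym_def irrefl_def dest: in_arcsD1 in_arcsD2)
next
  assume R: ?R
  then have "finite (parcs G)" by (meson finite_SigmaI finite_subset)
  with R show ?L
    by unfold_locales (auto simp: sym_def irrefl_def symmetric_def)
qed

lemma pair_graph_subdivision:
  assumes "pair_graph H" "subdivision_pair H S"
  shows "pair_graph S"
  using assms(2)
proof (induction rule: subdivision_pair_induct)
  case base
  then show ?case using assms(1) by simp
next
  case (divide e w H)
  then show ?case by (intro pair_graph.pair_graph_subdivide)
qed

lemma pair_graph_bidirected: "pair_graph G \<Longrightarrow> pair_bidirected_digraph G"
  by (simp add: pair_graph_def pair_bidirected_digraph_def pair_digraph_def pair_pseudo_graph_def)

lemma subdivision_pair_refl: "pair_graph G \<Longrightarrow> subdivision_pair G G"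
  by (intro subdivision_pair_base pair_graph_bidirected)

lemma subdivision_pverts_subset:
  assumes "subdivision_pair H S"
  shows "pverts H \<subseteq> pverts S"
  using subdivision_verts_subset[OF assms] by auto

text \<open>The host is given by \<open>V\<close> and \<open>E\<close> separately, and
  \<open>E\<close> may have arcs outside \<open>V\<close>: passing to a smaller vertex set then
  needs no restriction of the arcs.\<close>

definition topological_minor :: "nat pair_pre_digraph \<Rightarrow> nat set \<Rightarrow> (nat \<times> nat) set \<Rightarrow> bool" where
  "topological_minor H V E \<longleftrightarrow>
    (\<exists>S f. subdivision_pair H S \<and> inj_on f (pverts S) \<and> f ` pverts S \<subseteq> V \<and>
      (\<forall>u v. (u, v) \<in> parcs S \<longrightarrow> (f u, f v) \<in> E))"

lemma topological_minorI:
  assumes "subdivision_pair H S" "inj_on f (pverts S)" "f ` pverts S \<subseteq> V"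
    "\<And>u v. (u, v) \<in> parcs S \<Longrightarrow> (f u, f v) \<in> E"
  shows "topological_minor H V E"
  using assms unfolding topological_minor_def by blast

lemma topological_minor_mono:
  assumes "topological_minor H V E" "V \<subseteq> V'" "E \<subseteq> E'"
  shows "topological_minor H V' E'"
  using assms unfolding topological_minor_def by (meson subset_iff subset_trans)

text \<open>Tail and head are \<open>fst\<close> and \<open>snd\<close> on both sides, so the arc
  map of an isomorphism is forced by its vertex map. Conversely, the image of an injective
  arc-preserving vertex map is the required subgraph.\<close>

lemma contains_subdivision_iff:
  assumes "pair_graph G" "pair_graph H"
  shows "contains_subdivision G H \<longleftrightarrow> topological_minor H (pverts G) (parcs G)"
proof
  assume "contains_subdivision G H"
  then obtain S K where S: "subdivision_pair H S" and K: "subgraph (with_proj K) (with_proj G)"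
    and iso: "digraph_iso (with_proj S) (with_proj K)"
    unfolding contains_subdivision_def by blast
  from iso obtain f where f: "pre_digraph.digraph_isomorphism (with_proj S) f"
    and Kf: "with_proj K = app_iso f (with_proj S)" unfolding digraph_iso_def by blast
  have pv: "pverts K = iso_verts f ` pverts S" and pa: "parcs K = iso_arcs f ` parcs S"
    and tl: "fst = iso_tail f" and hd: "snd = iso_head f"
    using arg_cong[OF Kf, of verts] arg_cong[OF Kf, of arcs]
      arg_cong[OF Kf, of tail] arg_cong[OF Kf, of head] by simp_all
  show "topological_minor H (pverts G) (parcs G)"
  proof (rule topological_minorI[OF S, of "iso_verts f"])
    show "inj_on (iso_verts f) (pverts S)"
      using f by (simp add: pre_digraph.digraph_isomorphism_def)
    show "iso_verts f ` pverts S \<subseteq> pverts G"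
      using K pv by (simp add: subgraph_def)
    fix u v assume uv: "(u, v) \<in> parcs S"
    have "fst (iso_arcs f (u, v)) = iso_verts f u" "snd (iso_arcs f (u, v)) = iso_verts f v"
      using f uv unfolding pre_digraph.digraph_isomorphism_def tl hd by force+
    then have "(iso_verts f u, iso_verts f v) = iso_arcs f (u, v)" by (metis prod.collapse)
    then show "(iso_verts f u, iso_verts f v) \<in> parcs G"
      using K pa uv by (auto simp: subgraph_def)
  qed
next
  assume "topological_minor H (pverts G) (parcs G)"
  then obtain S f where S: "subdivision_pair H S" and inj: "inj_on f (pverts S)"
    and fV: "f ` pverts S \<subseteq> pverts G" and fE: "\<And>u v. (u, v) \<in> parcs S \<Longrightarrow> (f u, f v) \<in> parcs G"
    unfolding topological_minor_def by blast
  have pgS: "pair_graph S" using pair_graph_subdivision[OF assms(2) S] .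
  interpret S: pair_graph S by fact
  interpret G: pair_graph G by fact
  define K where "K = \<lparr>pverts = f ` pverts S, parcs = map_prod f f ` parcs S\<rparr>"
  define h where "h = \<lparr>iso_verts = f, iso_arcs = map_prod f f, iso_head = snd, iso_tail = fst\<rparr>"
  have "subgraph (with_proj K) (with_proj G)"
    unfolding subgraph_def
  proof (intro conjI)
    show "wf_digraph (with_proj G)" by unfold_locales
    show "wf_digraph (with_proj K)"
      by unfold_locales (auto simp: K_def dest: S.in_arcsD1 S.in_arcsD2)
    show "compatible (with_proj G) (with_proj K)" by (rule compatibleI_with_proj)
  qed (use fV fE in \<open>auto simp: K_def\<close>)
  moreover have "digraph_iso (with_proj S) (with_proj K)"
    unfolding digraph_iso_def
  proof (intro exI conjI)
    have "inj_on (map_prod f f) (parcs S)"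
      by (rule inj_on_subset[OF map_prod_inj_on[OF inj inj]]) (use pgS in \<open>simp add: pair_graph_iff\<close>)
    then show "pre_digraph.digraph_isomorphism (with_proj S) h"
      using inj S.wf_digraph_axioms
      by (auto simp: pre_digraph.digraph_isomorphism_def h_def)
    show "with_proj K = app_iso h (with_proj S)"
      by (simp add: app_iso_def h_def K_def with_proj_def)
  qed
  ultimately show "contains_subdivision G H"
    unfolding contains_subdivision_def using S by blast
qed

section \<open>Vertex covers of subdivisions\<close>

definition vertex_cover :: "nat set \<Rightarrow> (nat \<times> nat) set \<Rightarrow> bool" where
  "vertex_cover C E \<longleftrightarrow> finite C \<and> (\<forall>u v. (u, v) \<in> E \<longrightarrow> u \<in> C \<or> v \<in> C)"

text \<open>One subdivision step is undone at a time: a new vertex in the cover is exchanged for an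
  end of the divided edge; if it is not in the cover, both ends are, because of the two new
  edges.\<close>

lemma vertex_cover_subdivision:
  assumes "subdivision_pair H S" "vertex_cover C (parcs S)"
  shows "\<exists>C'. card C' \<le> card C \<and> vertex_cover C' (parcs H)"
  using assms
proof (induction arbitrary: C rule: subdivision_pair_induct)
  case base
  then show ?case by blast
next
  case (divide e w S)
  obtain u v where e: "e = (u, v)" by (cases e)
  interpret pair_bidirected_digraph S
    using bidirected_digraphI_subdivision[OF divide(3)] .
  have w: "w \<noteq> x" "w \<noteq> y" if "(x, y) \<in> parcs S" for x y
    using that divide(2) by (auto dest: in_arcsD1 in_arcsD2)
  define C1 where "C1 = (if w \<in> C then insert u (C - {w}) else C)"
  have fC: "finite C" using divide by (simp add: vertex_cover_def)
  have "card (insert u (C - {w})) \<le> card C" if "w \<in> C"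
    using card_insert_le_m1[of "card C" "C - {w}" u] fC that
    by (metis card.remove card_Suc_Diff1 card_insert_if finite_Diff le_SucI order_refl)
  then have "card C1 \<le> card C" by (simp add: C1_def)
  have cov: "x \<in> C \<or> y \<in> C" if "(x, y) \<in> parcs (subdivide S e w)" for x y
    using divide(5) that unfolding vertex_cover_def by blast
  note cov = cov[unfolded e arcs_subdivide]
  have "vertex_cover C1 (parcs S)"
    unfolding vertex_cover_def
  proof (intro conjI allI impI)
    fix x y assume xy: "(x, y) \<in> parcs S"
    show "x \<in> C1 \<or> y \<in> C1"
    proof (cases "{x, y} = {u, v}")
      case True
      then show ?thesis using cov[of u w] cov[of v w] w[OF xy] by (auto simp: C1_def doubleton_eq_iff)
    next
      case False
      then have "(x, y) \<noteq> (u, v)" "(x, y) \<noteq> (v, u)" by auto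
      then show ?thesis using cov[of x y] w[OF xy] xy by (auto simp: C1_def)
    qed
  qed (use fC in \<open>auto simp: C1_def\<close>)
  from divide.IH[OF this] \<open>card C1 \<le> card C\<close> show ?case by (meson order_trans)
qed

lemma vertex_cover_topological_minor:
  assumes "topological_minor H V E" "pair_graph H" "vertex_cover C E"
  shows "\<exists>C'. card C' \<le> card C \<and> vertex_cover C' (parcs H)"
proof -
  from assms(1) obtain S f where S: "subdivision_pair H S" and inj: "inj_on f (pverts S)"
    and fE: "\<And>u v. (u, v) \<in> parcs S \<Longrightarrow> (f u, f v) \<in> E"
    unfolding topological_minor_def by blast
  interpret S: pair_graph S using pair_graph_subdivision[OF assms(2) S] .
  define D where "D = {u \<in> pverts S. f u \<in> C}"
  have "card D \<le> card C"
    using assms(3) inj by (intro card_inj_on_le[of f]) (auto simp: D_def vertex_cover_def inj_on_def)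
  moreover have "vertex_cover D (parcs S)"
    using assms(3) fE S.pair_finite_verts
    by (auto simp: vertex_cover_def D_def dest: S.in_arcsD1 S.in_arcsD2)
  ultimately show ?thesis
    using vertex_cover_subdivision[OF S] order_trans by blast
qed

section \<open>Realising missing edges by paths\<close>

definition add_edge :: "nat pair_pre_digraph \<Rightarrow> nat \<Rightarrow> nat \<Rightarrow> nat pair_pre_digraph" where
  "add_edge G a b = \<lparr>pverts = pverts G, parcs = parcs G \<union> {(a, b), (b, a)}\<rparr>"

lemma add_edge_simps [simp]:
  "pverts (add_edge G a b) = pverts G"
  "parcs (add_edge G a b) = parcs G \<union> {(a, b), (b, a)}"
  by (simp_all add: add_edge_def)

lemma pair_graph_add_edge:
  "pair_graph G \<Longrightarrow> a \<in> pverts G \<Longrightarrow> b \<in> pverts G \<Longrightarrow> a \<noteq> b \<Longrightarrow> pair_graph (add_edge G a b)"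
  by (auto simp: pair_graph_iff sym_def irrefl_def)

text \<open>The added edge is never divided. That neither of its arcs lies in \<open>S\<close> is
  carried through the induction, so that the edge divided next differs from it.\<close>

lemma subdivision_add_edge:
  assumes "subdivision_pair H S" "pair_graph H"
    and "a \<in> pverts H" "b \<in> pverts H" "a \<noteq> b" "(a, b) \<notin> parcs H"
  shows "subdivision_pair (add_edge H a b) (add_edge S a b) \<and> (a, b) \<notin> parcs S \<and> (b, a) \<notin> parcs S"
  using assms(1)
proof (induction rule: subdivision_pair_induct)
  case base
  have "subdivision_pair (add_edge H a b) (add_edge H a b)"
    by (intro subdivision_pair_refl pair_graph_add_edge assms)
  then show ?case
    using assms(2,6) by (auto simp: pair_graph_iff sym_def)
next
  case (divide e w S)
  obtain u v where e: "e = (u, v)" by (cases e)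
  have ab: "w \<noteq> a" "w \<noteq> b"
    using divide assms(3,4) subdivision_pverts_subset[OF divide(3)] by auto
  have "subdivision_pair (add_edge H a b) (subdivide (add_edge S a b) e w)"
    using divide by (intro subdivision_pair_divide) auto
  also have "subdivide (add_edge S a b) e w = add_edge (subdivide S e w) a b"
    using divide e by (auto simp: add_edge_def subdivide.simps)
  finally show ?case using divide e ab by auto
qed

text \<open>All edges of \<open>S\<close> except \<open>ab\<close> are realised, and
  \<open>ps\<close> is the interior of a path for \<open>ab\<close>. Dividing \<open>ab\<close> by a
  vertex \<open>w\<close> sent to the first entry of \<open>ps\<close> leaves only \<open>wb\<close>
  open, with a shorter path; hence the induction varies \<open>S\<close>, \<open>a\<close> and
  \<open>f\<close>.\<close>

lemma topological_minor_route:
  assumes "pair_graph H" "sym E"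
    and "subdivision_pair H S" "(a, b) \<in> parcs S"
    and "inj_on f (pverts S)" "f ` pverts S \<subseteq> V"
    and "\<And>u v. (u, v) \<in> parcs S \<Longrightarrow> {u, v} \<noteq> {a, b} \<Longrightarrow> (f u, f v) \<in> E"
    and "successively (\<lambda>x y. (x, y) \<in> E) (f a # ps @ [f b])" "distinct ps"
    and "set ps \<subseteq> V - f ` pverts S"
  shows "topological_minor H V E"
  using assms(3-)
proof (induction ps arbitrary: S a f)
  case Nil
  have "(f a, f b) \<in> E" "(f b, f a) \<in> E" using Nil \<open>sym E\<close> by (auto dest: symD)
  then show ?case
    using Nil by (intro topological_minorI[of H S f]) (auto simp: doubleton_eq_iff)
next
  case (Cons p ps)
  have "pair_graph S" using pair_graph_subdivision[OF assms(1) Cons(2)] .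
  then interpret S: pair_graph S .
  obtain w where w: "w \<notin> pverts S" using S.pair_finite_verts ex_new_if_finite infinite_UNIV_nat by blast
  define T where "T = subdivide S (a, b) w"
  define g where "g = f(w := p)"
  have ab: "a \<in> pverts S" "b \<in> pverts S" "a \<noteq> b"
    using Cons(3) S.no_loops' by (auto dest: S.in_arcsD1 S.in_arcsD2)
  have pT: "pverts T = insert w (pverts S)" by (simp add: T_def)
  have gf: "g x = f x" if "x \<in> pverts S" for x using that w by (auto simp: g_def)
  then have im: "g ` pverts S = f ` pverts S" by (intro image_cong) auto
  have gw: "g w = p" by (simp add: g_def)
  have fap: "(f a, p) \<in> E" "(p, f a) \<in> E" using Cons.prems(6) \<open>sym E\<close> by (auto dest: symD)
  show ?case
  proof (rule Cons.IH[of T w g])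
    show "subdivision_pair H T" unfolding T_def using Cons w by (intro subdivision_pair_divide)
    show "(w, b) \<in> parcs T" by (simp add: T_def)
    have "inj_on g (pverts S)" using Cons.prems(3) gf by (auto simp: inj_on_def)
    then show "inj_on g (pverts T)"
      using Cons.prems(8) w by (auto simp: pT im gw)
    show "g ` pverts T \<subseteq> V" using Cons.prems(4,8) by (auto simp: pT im gw)
    show "successively (\<lambda>x y. (x, y) \<in> E) (g w # ps @ [g b])"
      using Cons.prems(6) gf ab by (cases ps) (auto simp: gw)
    show "distinct ps" using Cons.prems(7) by simp
    show "set ps \<subseteq> V - g ` pverts T" using Cons.prems(7,8) by (auto simp: pT im gw)
    fix u v assume uv: "(u, v) \<in> parcs T" "{u, v} \<noteq> {w, b}"
    then have "(u, v) \<in> parcs S \<and> (u, v) \<noteq> (a, b) \<and> (u, v) \<noteq> (b, a) \<or> u = a \<and> v = w \<or> u = w \<and> v = a"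
      unfolding T_def arcs_subdivide by blast
    then consider "(u, v) \<in> parcs S" "{u, v} \<noteq> {a, b}" | "u = a" "v = w" | "u = w" "v = a"
      by (auto simp: doubleton_eq_iff)
    then show "(g u, g v) \<in> E"
    proof cases
      case 1
      then have "g u = f u" "g v = f v" using gf by (auto dest: S.in_arcsD1 S.in_arcsD2)
      then show ?thesis using Cons.prems(5)[OF 1] by simp
    qed (use fap gf[OF ab(1)] gw in simp_all)
  qed
qed

text \<open>Unordered pairs, so that the two arcs of an edge count once and share one
  midpoint.\<close>

definition unrealised :: "nat pair_pre_digraph \<Rightarrow> (nat \<Rightarrow> nat) \<Rightarrow> (nat \<times> nat) set \<Rightarrow> nat set set" where
  "unrealised S f E = {{u, v} |u v. (u, v) \<in> parcs S \<and> (f u, f v) \<notin> E}"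

text \<open>Each unrealised edge is divided once and the new vertex is sent to a midpoint of its
  own, given by \<open>m\<close>; every division lowers the number of unrealised edges by
  one.\<close>

lemma topological_minor_two_paths:
  assumes "pair_graph H" "sym E"
    and "subdivision_pair H S"
    and "inj_on f (pverts S)" "f ` pverts S \<subseteq> V"
    and "inj_on m (unrealised S f E)" "m ` unrealised S f E \<subseteq> V - f ` pverts S"
    and "\<And>u v. (u, v) \<in> parcs S \<Longrightarrow> (f u, f v) \<notin> E \<Longrightarrow> (f u, m {u, v}) \<in> E"
  shows "topological_minor H V E"
  using assms(3-)
proof (induction "card (unrealised S f E)" arbitrary: S f)
  case 0
  have "pair_graph S" using pair_graph_subdivision[OF assms(1) 0(2)] .
  then interpret S: pair_graph S .
  have "unrealised S f E \<subseteq> (\<lambda>(u, v). {u, v}) ` parcs S" by (auto simp: unrealised_def)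
  then have "finite (unrealised S f E)" using S.pair_finite_arcs finite_surj by blast
  then have "unrealised S f E = {}" using 0 by simp
  then show ?case
    using 0 by (intro topological_minorI[of H S f]) (auto simp: unrealised_def)
next
  case (Suc k)
  have "pair_graph S" using pair_graph_subdivision[OF assms(1) Suc(3)] .
  then interpret S: pair_graph S .
  obtain a b where ab: "(a, b) \<in> parcs S" "(f a, f b) \<notin> E"
  proof -
    have "unrealised S f E \<noteq> {}" using Suc(2) by auto
    then show ?thesis using that by (auto simp: unrealised_def)
  qed
  then have ba: "(b, a) \<in> parcs S" "(f b, f a) \<notin> E"
    using S.arcs_symmetric \<open>sym E\<close> by (auto dest: symD)
  have abS: "a \<in> pverts S" "b \<in> pverts S" "a \<noteq> b"
    using ab S.no_loops' by (auto dest: S.in_arcsD1 S.in_arcsD2)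
  obtain w where w: "w \<notin> pverts S" using S.pair_finite_verts ex_new_if_finite infinite_UNIV_nat by blast
  define T where "T = subdivide S (a, b) w"
  define g where "g = f(w := m {a, b})"
  have pT: "pverts T = insert w (pverts S)" by (simp add: T_def)
  have gf: "g x = f x" if "x \<in> pverts S" for x using that w by (auto simp: g_def)
  then have im: "g ` pverts S = f ` pverts S" by (intro image_cong) auto
  have gw: "g w = m {a, b}" by (simp add: g_def)
  have E4: "(f a, m {a, b}) \<in> E" "(f b, m {a, b}) \<in> E" "(m {a, b}, f a) \<in> E" "(m {a, b}, f b) \<in> E"
    using Suc.prems(6)[OF ab] Suc.prems(6)[OF ba] \<open>sym E\<close> by (auto simp: insert_commute dest: symD)
  have abU: "{a, b} \<in> unrealised S f E" using ab by (auto simp: unrealised_def)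
  \<comment> \<open>Both halves of the divided edge are realised through the midpoint, so an
    unrealised arc of \<open>T\<close> is an old one.\<close>
  have T_bad: "(u, v) \<in> parcs S \<and> (f u, f v) \<notin> E \<and> {u, v} \<noteq> {a, b} \<and> g u = f u \<and> g v = f v"
    if "(u, v) \<in> parcs T" "(g u, g v) \<notin> E" for u v
  proof -
    from that(1) have "(u, v) \<in> parcs S \<and> (u, v) \<noteq> (a, b) \<and> (u, v) \<noteq> (b, a) \<or>
        u \<in> {a, b} \<and> v = w \<or> u = w \<and> v \<in> {a, b}"
      unfolding T_def arcs_subdivide by blast
    then consider "(u, v) \<in> parcs S" "{u, v} \<noteq> {a, b}"
      | "u \<in> {a, b}" "v = w" | "u = w" "v \<in> {a, b}"
      by (auto simp: doubleton_eq_iff)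
    then show ?thesis
    proof cases
      case 1
      then have "g u = f u" "g v = f v" using gf by (auto dest: S.in_arcsD1 S.in_arcsD2)
      then show ?thesis using 1 that(2) by auto
    next
      case 2
      then show ?thesis using E4 gf[OF abS(1)] gf[OF abS(2)] gw that(2) by (elim insertE) simp_all
    next
      case 3
      then show ?thesis using E4 gf[OF abS(1)] gf[OF abS(2)] gw that(2) by (elim insertE) simp_all
    qed
  qed
  have U: "unrealised T g E = unrealised S f E - {{a, b}}"
  proof
    show "unrealised T g E \<subseteq> unrealised S f E - {{a, b}}"
    proof
      fix z assume "z \<in> unrealised T g E"
      then obtain u v where "z = {u, v}" "(u, v) \<in> parcs T" "(g u, g v) \<notin> E"
        by (auto simp: unrealised_def)
      then show "z \<in> unrealised S f E - {{a, b}}" using T_bad[of u v] by (auto simp: unrealised_def)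
    qed
    show "unrealised S f E - {{a, b}} \<subseteq> unrealised T g E"
    proof
      fix z assume z: "z \<in> unrealised S f E - {{a, b}}"
      then obtain u v where uv: "z = {u, v}" "(u, v) \<in> parcs S" "(f u, f v) \<notin> E"
        by (auto simp: unrealised_def)
      then have "(u, v) \<in> parcs T" using z by (auto simp: T_def)
      moreover have "g u = f u" "g v = f v" using uv gf by (auto dest: S.in_arcsD1 S.in_arcsD2)
      ultimately show "z \<in> unrealised T g E"
        using uv unfolding unrealised_def mem_Collect_eq by (intro exI[of _ u] exI[of _ v]) simp
    qed
  qed
  show ?case
  proof (rule Suc.hyps(1)[of T g])
    show "k = card (unrealised T g E)" using Suc(2) abU U by simp
    show "subdivision_pair H T" unfolding T_def using Suc.prems(1) w ab by (intro subdivision_pair_divide)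
    have "inj_on g (pverts S)" using Suc.prems(2) gf by (auto simp: inj_on_def)
    then show "inj_on g (pverts T)"
      using Suc.prems(5) w abU by (auto simp: pT im gw)
    show "g ` pverts T \<subseteq> V" using Suc.prems(3,5) abU by (auto simp: pT im gw)
    show "inj_on m (unrealised T g E)" using Suc.prems(4) unfolding U by (rule inj_on_diff)
    show "m ` unrealised T g E \<subseteq> V - g ` pverts T"
      using Suc.prems(4,5) abU unfolding U pT by (auto simp: im gw dest: inj_onD)
    fix u v assume "(u, v) \<in> parcs T" "(g u, g v) \<notin> E"
    then show "(g u, m {u, v}) \<in> E" using T_bad[of u v] Suc.prems(6) by auto
  qed
qed

section \<open>Density conditions forcing a topological minor\<close>

definition linked :: "(nat \<times> nat) set \<Rightarrow> nat set \<Rightarrow> bool" where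
  "linked E U \<longleftrightarrow> (\<forall>p\<in>U. \<forall>q\<in>U. \<exists>ps. ps \<noteq> [] \<and> hd ps = p \<and> last ps = q \<and> distinct ps \<and>
     set ps \<subseteq> U \<and> successively (\<lambda>x y. (x, y) \<in> E) ps)"

lemma linkedE:
  assumes "linked E U" "p \<in> U" "q \<in> U"
  obtains ps where "ps \<noteq> []" "hd ps = p" "last ps = q" "distinct ps" "set ps \<subseteq> U"
    "successively (\<lambda>x y. (x, y) \<in> E) ps"
  using assms unfolding linked_def by blast

lemma linked_singleton: "linked E {v}"
  unfolding linked_def by (auto intro!: exI[of _ "[v]"])

lemma linked_insert:
  assumes "linked E U" "sym E" "u \<in> U" "v \<notin> U" "(u, v) \<in> E"
  shows "linked E (insert v U)"
  unfolding linked_def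
proof (intro ballI)
  fix p q assume pq: "p \<in> insert v U" "q \<in> insert v U"
  have vu: "(v, u) \<in> E" using assms by (auto dest: symD)
  consider "p = v" "q = v" | "p = v" "q \<in> U" | "p \<in> U" "q = v" | "p \<in> U" "q \<in> U" using pq by blast
  then show "\<exists>ps. ps \<noteq> [] \<and> hd ps = p \<and> last ps = q \<and> distinct ps \<and>
     set ps \<subseteq> insert v U \<and> successively (\<lambda>x y. (x, y) \<in> E) ps"
  proof cases
    case 1
    then show ?thesis by (intro exI[of _ "[v]"]) auto
  next
    case 2
    obtain ps where "ps \<noteq> []" "hd ps = u" "last ps = q" "distinct ps" "set ps \<subseteq> U"
      "successively (\<lambda>x y. (x, y) \<in> E) ps" by (rule linkedE[OF assms(1,3) 2(2)])
    then show ?thesis using 2 vu assms(4)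
      by (intro exI[of _ "v # ps"]) (auto simp: successively_Cons)
  next
    case 3
    obtain ps where "ps \<noteq> []" "hd ps = p" "last ps = u" "distinct ps" "set ps \<subseteq> U"
      "successively (\<lambda>x y. (x, y) \<in> E) ps" by (rule linkedE[OF assms(1) 3(1) assms(3)])
    then show ?thesis using 3 assms(4,5)
      by (intro exI[of _ "ps @ [v]"]) (auto simp: successively_append_iff)
  next
    case 4
    obtain ps where "ps \<noteq> []" "hd ps = p" "last ps = q" "distinct ps" "set ps \<subseteq> U"
      "successively (\<lambda>x y. (x, y) \<in> E) ps" by (rule linkedE[OF assms(1) 4])
    then show ?thesis by (intro exI[of _ "ps"]) auto
  qed
qed

definition nbr :: "(nat \<times> nat) set \<Rightarrow> nat \<Rightarrow> nat set" where
  "nbr E v = {w. (v, w) \<in> E}"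

lemma mem_nbr [simp]: "w \<in> nbr E v \<longleftrightarrow> (v, w) \<in> E"
  by (simp add: nbr_def)

lemma card_arcs_eq_sum_degree:
  assumes "finite A" "finite B"
  shows "card (E \<inter> A \<times> B) = (\<Sum>v\<in>A. card (nbr E v \<inter> B))"
proof -
  have "E \<inter> A \<times> B = Sigma A (\<lambda>v. nbr E v \<inter> B)" by auto
  then show ?thesis using assms by (simp add: card_SigmaI)
qed

lemma card_arcs_delete_vertex:
  assumes "finite A" "v \<in> A" "sym E" "irrefl E"
  shows "card (E \<inter> A \<times> A) = card (E \<inter> (A - {v}) \<times> (A - {v})) + 2 * card (nbr E v \<inter> A)"
proof -
  let ?X = "E \<inter> (A - {v}) \<times> (A - {v})" and ?Y = "Pair v ` (nbr E v \<inter> A)"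
    and ?Z = "(\<lambda>w. (w, v)) ` (nbr E v \<inter> A)"
  have "E \<inter> A \<times> A = ?X \<union> (?Y \<union> ?Z)"
    using assms by (auto simp: sym_def)
  moreover have "?X \<inter> (?Y \<union> ?Z) = {}" "?Y \<inter> ?Z = {}"
    using assms by (auto simp: irrefl_def)
  moreover have "finite ?X" "finite ?Y" "finite ?Z" using assms by auto
  ultimately have "card (E \<inter> A \<times> A) = card ?X + (card ?Y + card ?Z)"
    by (simp add: card_Un_disjoint)
  also have "card ?Y = card (nbr E v \<inter> A)" by (intro card_image) (auto simp: inj_on_def)
  also have "card ?Z = card (nbr E v \<inter> A)" by (intro card_image) (auto simp: inj_on_def)
  finally show ?thesis by simp
qed

lemma injection_exists:
  assumes "finite X" "finite Y" "card X \<le> card Y"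
  obtains f where "inj_on f X" "f ` X \<subseteq> Y"
  using assms inj_on_iff_card_le by metis

text \<open>
  Contracting a connected set \<open>U\<close> of \<open>V\<close> leaves a graph with
  \<open>card (E \<inter> (V - U) \<times> (V - U)) + 2 * card N\<close> arcs, where \<open>N\<close> is the neighbourhood of \<open>U\<close>.
  If \<open>U\<close> is a largest connected set whose contraction is still dense, contracting one more vertex
  of \<open>N\<close> loses many arcs, so \<open>N\<close> induces a graph of large minimum degree.
\<close>

lemma dense_neighbourhood:
  fixes c :: nat
  assumes "finite V" "V \<noteq> {}" "sym E" "irrefl E" "(2 * c + 2) * card V \<le> card (E \<inter> V \<times> V)"
  shows "\<exists>U N. linked E U \<and> U \<subseteq> V \<and> N \<subseteq> V - U \<and> N \<noteq> {} \<and> (\<forall>v\<in>N. \<exists>u\<in>U. (u, v) \<in> E) \<and>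
    c * card N \<le> card (E \<inter> N \<times> N)"
proof -
  define D where "D = 2 * c + 2"
  \<comment> \<open>Minimality of \<open>A\<close> serves to show that \<open>N U\<close> is
    nonempty: otherwise the proper subset \<open>A - U\<close> would be dense as well.\<close>
  obtain A where A: "A \<subseteq> V" "A \<noteq> {}" "D * card A \<le> card (E \<inter> A \<times> A)"
    and Amin: "\<And>B. B \<subseteq> V \<Longrightarrow> B \<noteq> {} \<Longrightarrow> D * card B \<le> card (E \<inter> B \<times> B) \<Longrightarrow> card A \<le> card B"
    using ex_has_least_nat[of "\<lambda>A. A \<subseteq> V \<and> A \<noteq> {} \<and> D * card A \<le> card (E \<inter> A \<times> A)" V card] assms
    unfolding D_def by blast
  have fA: "finite A" using A assms finite_subset by blast
  define N where "N U = {v \<in> A - U. \<exists>u\<in>U. (u, v) \<in> E}" for U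
  \<comment> \<open>The summand \<open>1\<close> stands for the vertex to which \<open>U\<close> is
    contracted, and \<open>N U\<close> for its neighbours.\<close>
  define good where "good U \<longleftrightarrow> linked E U \<and> U \<noteq> {} \<and> U \<subseteq> A \<and>
     D * (card (A - U) + 1) \<le> card (E \<inter> (A - U) \<times> (A - U)) + 2 * card (N U)" for U
  obtain v where v: "v \<in> A" using A by blast
  have "N {v} = nbr E v \<inter> A" using assms by (auto simp: N_def irrefl_def)
  moreover have "card (A - {v}) + 1 = card A" using v fA by (metis Suc_eq_plus1 card.remove)
  ultimately have "good {v}"
    using A(3) v card_arcs_delete_vertex[OF fA v assms(3,4)] by (simp add: good_def linked_singleton)
  moreover have "card U < Suc (card A)" if "good U" for U
    using that fA by (auto simp: good_def card_mono less_Suc_eq_le)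
  ultimately obtain U where U: "good U" and Umax: "\<And>U'. good U' \<Longrightarrow> card U' \<le> card U"
    using ex_has_greatest_nat[of good "{v}" card "Suc (card A)"] by blast
  have lU: "linked E U" "U \<noteq> {}" "U \<subseteq> A" using U by (auto simp: good_def)
  have fU: "finite U" using lU fA finite_subset by blast
  have fN: "finite (N U)" using fA by (simp add: N_def)
  have NE: "N U \<noteq> {}"
  proof
    assume e: "N U = {}"
    then have d: "D * (card (A - U) + 1) \<le> card (E \<inter> (A - U) \<times> (A - U))" using U by (simp add: good_def)
    show False
    proof (cases "A - U = {}")
      case True
      show False using d unfolding True by (simp add: D_def)
    next
      case False
      have "card A \<le> card (A - U)" using d A(1) False by (intro Amin) auto
      moreover have "card (A - U) < card A" using lU fA by (intro psubset_card_mono) auto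
      ultimately show False by simp
    qed
  qed
  have deg: "c \<le> card (nbr E v \<inter> N U)" if v: "v \<in> N U" for v
  proof -
    have vA: "v \<in> A" "v \<notin> U" using v by (auto simp: N_def)
    obtain u where u: "u \<in> U" "(u, v) \<in> E" using v by (auto simp: N_def)
    let ?U = "insert v U"
    have "linked E ?U" by (rule linked_insert[OF lU(1) assms(3) u(1) vA(2) u(2)])
    moreover have "card ?U > card U" using fU vA by simp
    ultimately have nb: "\<not> D * (card (A - ?U) + 1) \<le> card (E \<inter> (A - ?U) \<times> (A - ?U)) + 2 * card (N ?U)"
      using Umax[of ?U] vA lU(3) by (auto simp: good_def)
    have AU: "A - ?U = (A - U) - {v}" by auto
    have c1: "card (A - U) = card (A - ?U) + 1"
      unfolding AU using vA fA by (metis DiffI Suc_eq_plus1 card.remove finite_Diff)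
    have c2: "card (E \<inter> (A - U) \<times> (A - U)) = card (E \<inter> (A - ?U) \<times> (A - ?U)) + 2 * card (nbr E v \<inter> (A - U))"
      unfolding AU using vA fA assms by (intro card_arcs_delete_vertex) auto
    have n1: "N ?U = (N U - {v}) \<union> (nbr E v \<inter> (A - U) - N U)"
      using assms(4) vA by (auto simp: N_def irrefl_def)
    have "card (N ?U) = card (N U - {v}) + card (nbr E v \<inter> (A - U) - N U)"
      unfolding n1 using fA by (intro card_Un_disjoint) (auto simp: N_def)
    moreover have "card (N U) = card (N U - {v}) + 1" using v fN by (metis Suc_eq_plus1 card.remove)
    moreover have "nbr E v \<inter> (A - U) = (nbr E v \<inter> (A - U) - N U) \<union> (nbr E v \<inter> N U)"
      by (auto simp: N_def)
    then have "card (nbr E v \<inter> (A - U)) = card (nbr E v \<inter> (A - U) - N U) + card (nbr E v \<inter> N U)"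
      using fA by (metis card_Un_disjoint finite_Diff finite_Int inf_commute Diff_disjoint fN inf_left_commute inf_bot_right)
    moreover have "D * (card (A - U) + 1) \<le> card (E \<inter> (A - U) \<times> (A - U)) + 2 * card (N U)"
      using U by (simp add: good_def)
    \<comment> \<open>Contracting \<open>v\<close> too removes one vertex and lowers the arc count
      in \<open>good\<close> by twice the number of neighbours of \<open>v\<close> in
      \<open>N U\<close> plus \<open>2\<close>. As \<open>insert v U\<close> is not good, this drop
      bounds \<open>D\<close>, whence the choice \<open>D = 2 * c + 2\<close>.\<close>
    ultimately have "D < 2 * card (nbr E v \<inter> N U) + 3"
      using nb c1 c2 by simp
    then show ?thesis by (simp add: D_def)
  qed
  have "c * card (N U) \<le> (\<Sum>v\<in>N U. card (nbr E v \<inter> N U))"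
    using sum_mono[of "N U" "\<lambda>_. c"] deg by (simp add: mult.commute)
  also have "\<dots> = card (E \<inter> N U \<times> N U)" using fN by (simp add: card_arcs_eq_sum_degree)
  finally show ?thesis
    using lU A(1) NE by (intro exI[of _ U] exI[of _ "N U"]) (auto simp: N_def)
qed

text \<open>Mader's theorem, by induction on the arcs of \<open>H\<close>. With one edge
  \<open>ab\<close> deleted, a subdivision is found inside the dense neighbourhood \<open>N\<close>
  of a connected set \<open>U\<close>; the images of \<open>a\<close> and \<open>b\<close> are then
  joined by a path through \<open>U\<close>.\<close>

lemma topological_minor_of_dense:
  assumes "pair_graph H"
  shows "\<exists>c::nat. \<forall>V E. finite V \<longrightarrow> V \<noteq> {} \<longrightarrow> sym E \<longrightarrow> irrefl E \<longrightarrow>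
    c * card V \<le> card (E \<inter> V \<times> V) \<longrightarrow> topological_minor H V E"
  using assms
proof (induction "card (parcs H)" arbitrary: H rule: less_induct)
  case less
  interpret H: pair_graph H by fact
  show ?case
  proof (cases "parcs H = {}")
    case True
    \<comment> \<open>Without edges only enough vertices are needed; they follow from
      \<open>card (E \<inter> V \<times> V) \<le> card V * card V\<close>.\<close>
    show ?thesis
    proof (intro exI[of _ "card (pverts H)"] allI impI)
      fix V :: "nat set" and E :: "(nat \<times> nat) set"
      assume V: "finite V" "V \<noteq> {}" "card (pverts H) * card V \<le> card (E \<inter> V \<times> V)"
      note V(3)
      also have "card (E \<inter> V \<times> V) \<le> card (V \<times> V)" using V by (intro card_mono) auto
      also have "\<dots> = card V * card V" by (rule card_cartesian_product)
      finally have "card (pverts H) * card V \<le> card V * card V" .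
      moreover have "card V > 0" using V by (simp add: card_gt_0_iff)
      ultimately have "card (pverts H) \<le> card V" by simp
      then obtain f where "inj_on f (pverts H)" "f ` pverts H \<subseteq> V"
        using injection_exists[OF H.pair_finite_verts V(1)] by blast
      then show "topological_minor H V E"
        using True by (intro topological_minorI[OF subdivision_pair_refl[OF less(2)]]) auto
    qed
  next
    case False
    then obtain a b where ab: "(a, b) \<in> parcs H" by auto
    then have ab': "a \<in> pverts H" "b \<in> pverts H" "a \<noteq> b" "(b, a) \<in> parcs H"
      using H.no_loops' H.arcs_symmetric by (auto dest: H.in_arcsD1 H.in_arcsD2)
    define H1 where "H1 = \<lparr>pverts = pverts H, parcs = parcs H - {(a, b), (b, a)}\<rparr>"
    have g1: "pair_graph H1" using less(2) by (auto simp: H1_def pair_graph_iff sym_def irrefl_def)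
    have H: "H = add_edge H1 a b"
      using ab ab' by (intro pair_pre_digraph.equality) (auto simp: H1_def)
    have "card (parcs H1) < card (parcs H)"
      using ab H.pair_finite_arcs by (intro psubset_card_mono) (auto simp: H1_def)
    from less(1)[OF this g1] obtain c where
      c: "\<And>V E. finite V \<Longrightarrow> V \<noteq> {} \<Longrightarrow> sym E \<Longrightarrow> irrefl E \<Longrightarrow>
        c * card V \<le> card (E \<inter> V \<times> V) \<Longrightarrow> topological_minor H1 V E" by blast
    show ?thesis
    proof (intro exI[of _ "2 * c + 2"] allI impI)
      fix V :: "nat set" and E :: "(nat \<times> nat) set"
      assume V: "finite V" "V \<noteq> {}" and E: "sym E" "irrefl E"
        and d: "(2 * c + 2) * card V \<le> card (E \<inter> V \<times> V)"
      from dense_neighbourhood[OF V E d] obtain U N where UN: "linked E U" "U \<subseteq> V" "N \<subseteq> V - U" "N \<noteq> {}"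
        "\<And>v. v \<in> N \<Longrightarrow> \<exists>u\<in>U. (u, v) \<in> E" "c * card N \<le> card (E \<inter> N \<times> N)" by blast
      have "finite N" using UN V by (meson finite_Diff finite_subset)
      from c[OF this UN(4) E UN(6)] obtain S f where S: "subdivision_pair H1 S" "inj_on f (pverts S)"
        "f ` pverts S \<subseteq> N" "\<And>u v. (u, v) \<in> parcs S \<Longrightarrow> (f u, f v) \<in> E"
        unfolding topological_minor_def by blast
      have abS: "a \<in> pverts S" "b \<in> pverts S"
        using subdivision_pverts_subset[OF S(1)] ab' by (auto simp: H1_def)
      obtain p where p: "p \<in> U" "(p, f a) \<in> E" using UN(5)[of "f a"] S(3) abS by blast
      obtain q where q: "q \<in> U" "(q, f b) \<in> E" using UN(5)[of "f b"] S(3) abS by blast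
      obtain ps where ps: "ps \<noteq> []" "hd ps = p" "last ps = q" "distinct ps" "set ps \<subseteq> U"
        "successively (\<lambda>x y. (x, y) \<in> E) ps" by (rule linkedE[OF UN(1) p(1) q(1)])
      show "topological_minor H V E"
      proof (rule topological_minor_route[OF less(2) E(1), of "add_edge S a b" a b f V ps])
        show "subdivision_pair H (add_edge S a b)"
          using subdivision_add_edge[OF S(1) g1] ab' unfolding H by (auto simp: H1_def)
        show "successively (\<lambda>x y. (x, y) \<in> E) (f a # ps @ [f b])"
          using ps p q E(1) by (auto simp: successively_Cons successively_append_iff dest: symD)
        have "f ` pverts S \<inter> U = {}" using S(3) UN(3) by blast
        then show "set ps \<subseteq> V - f ` pverts (add_edge S a b)" using ps(5) UN(2) by (simp, blast)
        show "f ` pverts (add_edge S a b) \<subseteq> V" using S(3) UN(3) by (simp, blast)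
      qed (use S(2,4) ps(4) in auto)
    qed
  qed
qed

text \<open>Every vertex of \<open>B\<close> is adjacent to all ends of unrealised edges, so any
  injection of these edges into \<open>B\<close> provides midpoints.\<close>

lemma topological_minor_supply:
  assumes "pair_graph H" "sym E" "subdivision_pair H S"
    and "inj_on f (pverts S)" "f ` pverts S \<subseteq> V"
    and "finite B" "B \<subseteq> V - f ` pverts S" "card (unrealised S f E) \<le> card B"
    and "\<And>u v b. (u, v) \<in> parcs S \<Longrightarrow> (f u, f v) \<notin> E \<Longrightarrow> b \<in> B \<Longrightarrow> (f u, b) \<in> E"
  shows "topological_minor H V E"
proof -
  interpret S: pair_graph S using pair_graph_subdivision[OF assms(1,3)] .
  have "unrealised S f E \<subseteq> (\<lambda>(u, v). {u, v}) ` parcs S" by (auto simp: unrealised_def)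
  then have "finite (unrealised S f E)" using S.pair_finite_arcs finite_surj by blast
  then obtain m where m: "inj_on m (unrealised S f E)" "m ` unrealised S f E \<subseteq> B"
    using injection_exists assms(6,8) by blast
  show ?thesis
  proof (rule topological_minor_two_paths[OF assms(1-5) m(1)])
    show "m ` unrealised S f E \<subseteq> V - f ` pverts S" using m(2) assms(7) by blast
    fix u v assume uv: "(u, v) \<in> parcs S" "(f u, f v) \<notin> E"
    then have "{u, v} \<in> unrealised S f E" by (auto simp: unrealised_def)
    then show "(f u, m {u, v}) \<in> E" using assms(9)[OF uv] m(2) by blast
  qed
qed

lemma topological_minor_complete_bipartite:
  assumes "pair_graph H" "sym E"
    and C: "vertex_cover C (parcs H)" "C \<subseteq> pverts H" "card C \<le> card A"
    and "finite A" "finite T" "A \<subseteq> V" "T \<subseteq> V" "A \<inter> T = {}"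
    and AT: "\<And>a t. a \<in> A \<Longrightarrow> t \<in> T \<Longrightarrow> (a, t) \<in> E"
    and "card (pverts H) + card C * card C \<le> card T"
  shows "topological_minor H V E"
proof -
  interpret H: pair_graph H by fact
  have fC: "finite C" using C by (simp add: vertex_cover_def)
  obtain f1 where f1: "inj_on f1 C" "f1 ` C \<subseteq> A" using injection_exists fC assms(6) C(3) by blast
  have "card (pverts H - C) \<le> card (pverts H)" using H.pair_finite_verts by (intro card_mono) auto
  then obtain f2 where f2: "inj_on f2 (pverts H - C)" "f2 ` (pverts H - C) \<subseteq> T"
    using injection_exists[of "pverts H - C" T] H.pair_finite_verts assms(7,12) by auto
  define f where "f x = (if x \<in> C then f1 x else f2 x)" for x
  have fim: "f ` pverts H = f1 ` C \<union> f2 ` (pverts H - C)" using C(2) by (auto simp: f_def)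
  define B where "B = T - f2 ` (pverts H - C)"
  have "card (f2 ` (pverts H - C)) \<le> card (pverts H)"
    by (meson \<open>card (pverts H - C) \<le> card (pverts H)\<close> H.pair_finite_verts card_image_le finite_Diff order_trans)
  moreover have "card B = card T - card (f2 ` (pverts H - C))"
    unfolding B_def using f2(2) H.pair_finite_verts by (intro card_Diff_subset) auto
  ultimately have cB: "card C * card C \<le> card B" using assms(12) by simp
  have cross: "(f u, f v) \<in> E" "(f v, f u) \<in> E" if "u \<in> C" "v \<in> pverts H - C" for u v
  proof -
    have "f u \<in> A" "f v \<in> T" using that f1(2) f2(2) by (auto simp: f_def)
    then show "(f u, f v) \<in> E" by (rule AT)
    then show "(f v, f u) \<in> E" using \<open>sym E\<close> by (auto dest: symD)
  qed
  have bad: "u \<in> C \<and> v \<in> C" if "(u, v) \<in> parcs H" "(f u, f v) \<notin> E" for u v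
  proof -
    have "u \<in> C \<or> v \<in> C" using C(1) that(1) by (auto simp: vertex_cover_def)
    moreover have "u \<in> pverts H" "v \<in> pverts H" using that(1) by (auto dest: H.in_arcsD1 H.in_arcsD2)
    ultimately show ?thesis using that(2) cross[of u v] cross[of v u] by blast
  qed
  show ?thesis
  proof (rule topological_minor_supply[OF assms(1,2) subdivision_pair_refl[OF assms(1)], of f V B])
    show "inj_on f (pverts H)"
    proof -
      have "inj_on f C" using f1(1) by (simp add: f_def inj_on_def)
      moreover have "inj_on f (pverts H - C)" using f2(1) by (simp add: f_def inj_on_def)
      moreover have "f ` C = f1 ` C" "f ` (pverts H - C) = f2 ` (pverts H - C)"
        by (auto simp: f_def)
      then have "f ` C \<inter> f ` (pverts H - C) = {}" using f1(2) f2(2) assms(10) by blast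
      moreover have "C - (pverts H - C) = C" "pverts H - C - C = pverts H - C" by blast+
      ultimately have "inj_on f (C \<union> (pverts H - C))" unfolding inj_on_Un by simp
      moreover have "C \<union> (pverts H - C) = pverts H" using C(2) by blast
      ultimately show ?thesis by simp
    qed
    show "f ` pverts H \<subseteq> V" using fim f1 f2 assms(8,9) by auto
    show "finite B" using assms(7) by (simp add: B_def)
    show "B \<subseteq> V - f ` pverts H" using fim f1 f2 assms(9,10) by (auto simp: B_def)
    have "unrealised H f E \<subseteq> (\<lambda>(u, v). {u, v}) ` (C \<times> C)" using bad by (auto simp: unrealised_def)
    then have "card (unrealised H f E) \<le> card (C \<times> C)" using fC by (intro surj_card_le) auto
    then show "card (unrealised H f E) \<le> card B" using cB by (simp add: card_cartesian_product)
    fix u v b assume "(u, v) \<in> parcs H" "(f u, f v) \<notin> E" "b \<in> B"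
    with bad[of u v] have "u \<in> C" "b \<in> T" by (auto simp: B_def)
    then show "(f u, b) \<in> E" using f1(2) by (intro AT) (auto simp: f_def)
  qed
qed

text \<open>The empty set is excluded so that a bound linear in \<open>card A\<close> also holds for
  \<open>A = {}\<close>.\<close>

definition cliques :: "(nat \<times> nat) set \<Rightarrow> nat set \<Rightarrow> nat set set" where
  "cliques F A = {Q. Q \<subseteq> A \<and> Q \<noteq> {} \<and> (\<forall>u\<in>Q. \<forall>v\<in>Q. u \<noteq> v \<longrightarrow> (u, v) \<in> F)}"

lemma low_degree_vertex:
  assumes "finite A" "A \<noteq> {}" "card (F \<inter> A \<times> A) \<le> c * card A"
  obtains v where "v \<in> A" "card (nbr F v \<inter> A) \<le> c"
proof (rule ccontr)
  assume "\<not> thesis"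
  then have "\<And>v. v \<in> A \<Longrightarrow> c < card (nbr F v \<inter> A)" using that by force
  then have "(\<Sum>v\<in>A. c) < (\<Sum>v\<in>A. card (nbr F v \<inter> A))" using assms by (intro sum_strict_mono) auto
  then show False using assms by (simp add: card_arcs_eq_sum_degree mult.commute)
qed

text \<open>A vertex \<open>v\<close> of degree at most \<open>c\<close> lies in at most
  \<open>2 ^ c\<close> cliques, since such a clique is determined by its other members, all
  neighbours of \<open>v\<close>. Deleting \<open>v\<close> and repeating gives the bound.\<close>

lemma card_cliques_le:
  assumes "finite A" "\<And>X. X \<subseteq> A \<Longrightarrow> card (F \<inter> X \<times> X) \<le> c * card X"
  shows "card (cliques F A) \<le> 2 ^ c * card A"
  using assms
proof (induction "card A" arbitrary: A)
  case 0
  then show ?case by (auto simp: cliques_def)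
next
  case (Suc n)
  then have "A \<noteq> {}" by auto
  obtain v where v: "v \<in> A" "card (nbr F v \<inter> A) \<le> c"
    using low_degree_vertex[OF Suc(3) \<open>A \<noteq> {}\<close>] Suc(4) by blast
  define P where "P = {Q \<in> cliques F A. v \<in> Q}"
  have "cliques F A = cliques F (A - {v}) \<union> P" by (auto simp: cliques_def P_def)
  then have "card (cliques F A) \<le> card (cliques F (A - {v})) + card P" by (simp add: card_Un_le)
  also have "card (cliques F (A - {v})) \<le> 2 ^ c * card (A - {v})"
    using Suc v by (intro Suc.hyps(1)) auto
  also have "card P \<le> card (Pow (nbr F v \<inter> A))"
  proof (rule card_inj_on_le[of "\<lambda>Q. Q - {v}"])
    show "inj_on (\<lambda>Q. Q - {v}) P" by (rule inj_onI) (auto simp: P_def)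
    show "(\<lambda>Q. Q - {v}) ` P \<subseteq> Pow (nbr F v \<inter> A)" by (auto simp: P_def cliques_def)
  qed (use Suc in auto)
  also have "\<dots> \<le> 2 ^ c" using v(2) Suc(3) by (subst card_Pow) auto
  finally have "card (cliques F A) \<le> 2 ^ c * (card (A - {v}) + 1)" by simp
  moreover have "card (A - {v}) + 1 = card A" using v(1) Suc(3) by (metis Suc_eq_plus1 card.remove)
  ultimately show ?case by metis
qed

text \<open>
  Vertices outside \<open>L\<close> are used one after the other to join pairs of \<open>L\<close> that are not yet joined.
  The graph \<open>F\<close> of joined pairs is sparse. When no vertex can be used any more, the neighbours in
  \<open>L\<close> of each unused vertex form a clique of \<open>F\<close>, and \<open>F\<close> has few cliques.
\<close>

lemma card_vertices_with_many_neighbours: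
  fixes c :: nat
  assumes H: "pair_graph H" "vertex_cover C (parcs H)" "C \<subseteq> pverts H" "C \<noteq> {}"
    and c: "\<And>V E. finite V \<Longrightarrow> V \<noteq> {} \<Longrightarrow> sym E \<Longrightarrow> irrefl E \<Longrightarrow>
      c * card V \<le> card (E \<inter> V \<times> V) \<Longrightarrow> topological_minor H V E"
    and V: "finite V" "L \<subseteq> V" "W \<subseteq> V - L" and E: "sym E"
    and W: "\<And>w. w \<in> W \<Longrightarrow> card C \<le> card (nbr E w \<inter> L)"
    and free: "\<not> topological_minor H V E"
  shows "card W \<le> (c + (card (pverts H) + card C * card C) * 2 ^ c) * card L"
proof -
  \<comment> \<open>An entry \<open>(p, w)\<close> means that \<open>w\<close> joins the pair
    \<open>p\<close>; the two injectivity conditions give each pair one joining vertex and let each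
    vertex join one pair.\<close>
  define matching where "matching M \<longleftrightarrow> M \<subseteq> Pow L \<times> W \<and> inj_on fst M \<and> inj_on snd M \<and>
    (\<forall>(p, w)\<in>M. \<exists>u v. p = {u, v} \<and> u \<noteq> v \<and> (u, w) \<in> E \<and> (v, w) \<in> E)" for M
  have fL: "finite L" by (rule finite_subset[OF V(2,1)])
  have fW: "finite W" by (rule finite_subset[OF V(3)]) (use V(1) in simp)
  have fM: "finite M" if "matching M" for M
    by (rule finite_subset[of _ "Pow L \<times> W"]) (use that fL fW in \<open>simp_all add: matching_def\<close>)
  have "matching {}" by (simp add: matching_def)
  moreover have "card M < Suc (card (Pow L \<times> W))" if "matching M" for M
    unfolding less_Suc_eq_le using that fL fW by (intro card_mono) (simp_all add: matching_def)
  ultimately obtain M where M: "matching M" and Mmax: "\<And>M'. matching M' \<Longrightarrow> card M' \<le> card M"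
    using ex_has_greatest_nat[of matching "{}" card "Suc (card (Pow L \<times> W))"] by blast
  have Mpair: "\<exists>u v. p = {u, v} \<and> u \<noteq> v \<and> u \<in> L \<and> v \<in> L \<and> w \<in> W \<and> (u, w) \<in> E \<and> (v, w) \<in> E"
    if "(p, w) \<in> M" for p w
  proof -
    have "(p, w) \<in> Pow L \<times> W" using M that unfolding matching_def by (elim conjE) (rule subsetD)
    then have "p \<subseteq> L" "w \<in> W" by simp_all
    moreover have "\<forall>(p, w)\<in>M. \<exists>u v. p = {u, v} \<and> u \<noteq> v \<and> (u, w) \<in> E \<and> (v, w) \<in> E"
      using M unfolding matching_def by (elim conjE)
    from bspec[OF this that] obtain u v where "p = {u, v}" "u \<noteq> v" "(u, w) \<in> E" "(v, w) \<in> E" by auto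
    ultimately show ?thesis by (intro exI[of _ u] exI[of _ v]) simp
  qed
  define F where "F = {(u, v). u \<noteq> v \<and> {u, v} \<in> fst ` M}"
  have F: "sym F" "irrefl F"
  proof -
    show "irrefl F" by (simp add: irrefl_def F_def)
    show "sym F"
    proof (rule symI)
      fix u v assume "(u, v) \<in> F"
      moreover have "{v, u} = {u, v}" by blast
      ultimately show "(v, u) \<in> F" by (simp only: F_def mem_Collect_eq prod.case) auto
    qed
  qed
  have FL: "F \<subseteq> L \<times> L"
  proof clarify
    fix u v assume "(u, v) \<in> F"
    then obtain w where "({u, v}, w) \<in> M" by (auto simp: F_def)
    from Mpair[OF this] show "u \<in> L \<and> v \<in> L" by (auto simp: doubleton_eq_iff)
  qed
  define partner where "partner p = (SOME w. (p, w) \<in> M)" for p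
  have partner: "(p, partner p) \<in> M" if p: "p \<in> fst ` M" for p
  proof -
    obtain w where "(p, w) \<in> M" using p by auto
    then show ?thesis unfolding partner_def by (rule someI)
  qed
  have partner_inj: "inj_on partner (fst ` M)"
  proof (rule inj_onI)
    fix p q assume pq: "p \<in> fst ` M" "q \<in> fst ` M" "partner p = partner q"
    have "inj_on snd M" using M by (simp add: matching_def)
    from inj_onD[OF this _ partner[OF pq(1)] partner[OF pq(2)]] pq(3) show "p = q" by simp
  qed
  \<comment> \<open>A subdivision of \<open>H\<close> in \<open>F\<close> would become one in
    \<open>E\<close>: each missing edge is replaced by the path through its partner, and partners
    lie outside \<open>L\<close>.\<close>
  have "\<not> topological_minor H L F"
  proof
    assume "topological_minor H L F"
    then obtain S f where S: "subdivision_pair H S" and inj: "inj_on f (pverts S)" and fL: "f ` pverts S \<subseteq> L"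
      and fF: "\<And>u v. (u, v) \<in> parcs S \<Longrightarrow> (f u, f v) \<in> F"
      unfolding topological_minor_def by blast
    interpret S: pair_graph S using pair_graph_subdivision[OF H(1) S] .
    have U1: "f ` p \<in> fst ` M" "p \<subseteq> pverts S" if "p \<in> unrealised S f E" for p
      using that fF by (auto simp: unrealised_def F_def dest: S.in_arcsD1 S.in_arcsD2)
    have "topological_minor H V E"
    proof (rule topological_minor_two_paths[OF H(1) E S inj, of V "\<lambda>p. partner (f ` p)"])
      show "f ` pverts S \<subseteq> V" using fL V by blast
      show "inj_on (\<lambda>p. partner (f ` p)) (unrealised S f E)"
      proof (rule inj_onI)
        fix p q assume pq: "p \<in> unrealised S f E" "q \<in> unrealised S f E"
          "partner (f ` p) = partner (f ` q)"
        then have "f ` p = f ` q" using partner_inj U1 by (meson inj_onD)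
        then show "p = q" using inj_on_image_eq_iff[OF inj U1(2)[OF pq(1)] U1(2)[OF pq(2)]] by simp
      qed
      show "(\<lambda>p. partner (f ` p)) ` unrealised S f E \<subseteq> V - f ` pverts S"
      proof (rule image_subsetI)
        fix p assume "p \<in> unrealised S f E"
        from Mpair[OF partner[OF U1(1)[OF this]]] have "partner (f ` p) \<in> W" by (elim exE conjE)
        with V(3) have "partner (f ` p) \<in> V - L" by (rule subsetD)
        then show "partner (f ` p) \<in> V - f ` pverts S" using fL by blast
      qed
      fix u v assume uv: "(u, v) \<in> parcs S" "(f u, f v) \<notin> E"
      then have "f ` {u, v} \<in> fst ` M" by (intro U1) (auto simp: unrealised_def)
      from Mpair[OF partner[OF this]] show "(f u, partner (f ` {u, v})) \<in> E"
        by (auto simp: doubleton_eq_iff)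
    qed
    then show False using free by contradiction
  qed
  then have sparse: "card (F \<inter> X \<times> X) \<le> c * card X" if "X \<subseteq> L" for X
  proof (cases "X = {}")
    case False
    have "\<not> topological_minor H X F"
      using \<open>\<not> topological_minor H L F\<close> that topological_minor_mono by blast
    then show ?thesis
      using c[OF _ False F] that fL finite_subset by fastforce
  qed simp
  have "fst ` M \<subseteq> (\<lambda>(u, v). {u, v}) ` F"
  proof
    fix p assume p: "p \<in> fst ` M"
    then obtain w where "(p, w) \<in> M" by auto
    from Mpair[OF this] p show "p \<in> (\<lambda>(u, v). {u, v}) ` F" by (auto simp: F_def)
  qed
  moreover have "finite F" using FL fL by (meson finite_SigmaI finite_subset)
  ultimately have "card (fst ` M) \<le> card F" by (intro surj_card_le)
  moreover have "card (fst ` M) = card M" using M by (auto simp: matching_def intro: card_image)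
  moreover have "card F \<le> c * card L" using sparse[of L] FL by (simp add: Int_absorb2)
  ultimately have cM: "card (snd ` M) \<le> c * card L"
    using card_image_le[OF fM[OF M], of snd] by linarith
  define W1 where "W1 = W - snd ` M"
  \<comment> \<open>Otherwise \<open>w\<close> could join the missing pair and enlarge the maximal
    \<open>M\<close>.\<close>
  have clique: "(u, v) \<in> F" if "w \<in> W1" "u \<in> nbr E w \<inter> L" "v \<in> nbr E w \<inter> L" "u \<noteq> v" for u v w
  proof (rule ccontr)
    assume nF: "(u, v) \<notin> F"
    have new: "{u, v} \<notin> fst ` M" "w \<notin> snd ` M" using nF that by (auto simp: F_def W1_def)
    have nM: "({u, v}, w) \<notin> M"
    proof
      assume "({u, v}, w) \<in> M"
      then have "snd ({u, v}, w) \<in> snd ` M" by (rule imageI)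
      then show False using new(2) by simp
    qed
    have "\<exists>x y. {u, v} = {x, y} \<and> x \<noteq> y \<and> (x, w) \<in> E \<and> (y, w) \<in> E"
      using that E by (auto dest: symD)
    then have "matching (insert ({u, v}, w) M)"
      using M that new nM by (simp add: matching_def W1_def)
    then have "card (insert ({u, v}, w) M) \<le> card M" by (rule Mmax)
    then show False using card_insert_disjoint[OF fM[OF M] nM] by linarith
  qed
  have "\<forall>w\<in>W1. \<exists>Q. Q \<subseteq> nbr E w \<inter> L \<and> card Q = card C"
  proof
    fix w assume "w \<in> W1"
    then have "card C \<le> card (nbr E w \<inter> L)" using W by (simp add: W1_def)
    then obtain T where "T \<subseteq> nbr E w \<inter> L" "card T = card C" "finite T"
      by (rule obtain_subset_with_card_n)
    then show "\<exists>Q. Q \<subseteq> nbr E w \<inter> L \<and> card Q = card C" by blast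
  qed
  then obtain Q where Q: "\<And>w. w \<in> W1 \<Longrightarrow> Q w \<subseteq> nbr E w \<inter> L" "\<And>w. w \<in> W1 \<Longrightarrow> card (Q w) = card C"
    by metis
  have cC: "card C > 0" using H by (simp add: vertex_cover_def card_gt_0_iff)
  have QC: "Q w \<in> cliques F L" if "w \<in> W1" for w
    using Q(1)[OF that] Q(2)[OF that] clique[OF that] cC unfolding cliques_def
    by (auto simp: subset_iff)
  define t where "t = card (pverts H) + card C * card C"
  \<comment> \<open>Vertices with the same chosen clique \<open>P\<close> form a complete bipartite
    graph with it; more than \<open>t\<close> of them would yield a subdivision of
    \<open>H\<close>.\<close>
  have fiber: "card {w \<in> W1. Q w = P} \<le> t" if P: "P \<in> cliques F L" for P
  proof (rule ccontr)
    assume "\<not> ?thesis"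
    then have big: "t < card {w \<in> W1. Q w = P}" by simp
    then obtain w where w: "w \<in> W1" "Q w = P"
      by (metis (mono_tags, lifting) Collect_empty_eq card.empty not_less_zero)
    have "topological_minor H V E"
    proof (rule topological_minor_complete_bipartite[OF H(1) E H(2,3), of P "{w \<in> W1. Q w = P}"])
      show "card C \<le> card P" using Q(2) w by auto
      show "finite P" using P fL by (auto simp: cliques_def intro: finite_subset)
      show "finite {w \<in> W1. Q w = P}" using fW by (simp add: W1_def)
      show "P \<subseteq> V" using P V by (auto simp: cliques_def)
      show "{w \<in> W1. Q w = P} \<subseteq> V" using V by (auto simp: W1_def)
      show "P \<inter> {w \<in> W1. Q w = P} = {}" using P V by (auto simp: cliques_def W1_def)
      show "card (pverts H) + card C * card C \<le> card {w \<in> W1. Q w = P}" using big by (simp add: t_def)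
      fix a x assume "a \<in> P" "x \<in> {w \<in> W1. Q w = P}"
      then have "(x, a) \<in> E" using Q(1)[of x] by auto
      then show "(a, x) \<in> E" using E by (auto dest: symD)
    qed
    then show False using free by contradiction
  qed
  have fcl: "finite (cliques F L)" using fL by (auto simp: cliques_def)
  have "W1 \<subseteq> (\<Union>P\<in>cliques F L. {w \<in> W1. Q w = P})" using QC by auto
  then have "card W1 \<le> card (\<Union>P\<in>cliques F L. {w \<in> W1. Q w = P})"
    using fcl fW by (intro card_mono) (auto simp: W1_def)
  also have "\<dots> \<le> (\<Sum>P\<in>cliques F L. card {w \<in> W1. Q w = P})" by (rule card_UN_le[OF fcl])
  also have "\<dots> \<le> (\<Sum>P\<in>cliques F L. t)" by (intro sum_mono fiber)
  also have "\<dots> \<le> t * (2 ^ c * card L)"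
    using card_cliques_le[OF fL sparse] by (simp add: mult.commute)
  finally have "card W1 \<le> t * 2 ^ c * card L" by simp
  moreover have "W \<subseteq> W1 \<union> snd ` M" by (auto simp: W1_def)
  then have "card W \<le> card (W1 \<union> snd ` M)" using fW fM[OF M] by (intro card_mono) (auto simp: W1_def)
  then have "card W \<le> card W1 + card (snd ` M)" by (meson card_Un_le order_trans)
  ultimately show ?thesis using cM by (simp add: t_def algebra_simps)
qed

section \<open>The spectral radius\<close>

text \<open>For the arc set of a graph this is the bilinear form of the adjacency matrix;
  \<open>bil E y y\<close> counts every edge in both directions.\<close>

definition bil :: "(nat \<times> nat) set \<Rightarrow> (nat \<Rightarrow> real) \<Rightarrow> (nat \<Rightarrow> real) \<Rightarrow> real" where
  "bil E x y = (\<Sum>(v, w)\<in>E. x v * y w)"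

lemma bil_eq_sum_nbr:
  assumes "finite V" "E \<subseteq> V \<times> V"
  shows "bil E x y = (\<Sum>v\<in>V. x v * (\<Sum>w\<in>nbr E v. y w))"
proof -
  have "E = Sigma V (nbr E)" using assms by auto
  moreover have "finite (nbr E v)" for v
    using assms by (intro finite_subset[of "nbr E v" V]) auto
  ultimately show ?thesis
    unfolding bil_def using assms(1)
    by (metis (mono_tags, lifting) sum.Sigma sum.cong sum_distrib_left)
qed

lemma bil_commute:
  assumes "sym E"
  shows "bil E x y = bil E y x"
proof -
  have "E = prod.swap ` E" using assms by (force simp: sym_def)
  then have "bil E x y = (\<Sum>p\<in>prod.swap ` E. case p of (v, w) \<Rightarrow> x v * y w)"
    by (simp add: bil_def)
  also have "\<dots> = bil E y x"
    by (subst sum.reindex) (auto simp: bil_def inj_on_def intro!: sum.cong)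
  finally show ?thesis .
qed

lemma bil_add_scale:
  assumes "sym E"
  shows "bil E (\<lambda>v. x v + t * z v) (\<lambda>v. x v + t * z v) = bil E x x + 2 * t * bil E x z + t\<^sup>2 * bil E z z"
proof -
  have "bil E (\<lambda>v. x v + t * z v) (\<lambda>v. x v + t * z v)
      = bil E x x + t * bil E x z + t * bil E z x + t\<^sup>2 * bil E z z"
    unfolding bil_def
    by (simp add: algebra_simps sum.distrib sum_distrib_left power2_eq_square split_def)
  then show ?thesis using bil_commute[OF assms, of z x] by simp
qed

text \<open>This is the first-order condition at a maximum; the test value \<open>t = a / B\<close>
  with \<open>0 < B\<close> and \<open>b \<le> B\<close> forces \<open>a = 0\<close>.\<close>

lemma zero_of_quadratic_bound:
  fixes a b :: real
  assumes "\<And>t. 2 * t * a \<le> t\<^sup>2 * b"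
  shows "a = 0"
proof (rule ccontr)
  assume a: "a \<noteq> 0"
  define B where "B = \<bar>b\<bar> + 1"
  have B: "B > 0" "b \<le> B" by (auto simp: B_def)
  have "2 * (a / B) * a \<le> (a / B)\<^sup>2 * b" by (rule assms)
  also have "\<dots> \<le> (a / B)\<^sup>2 * B" using B by (intro mult_left_mono) auto
  finally have "2 * a\<^sup>2 / B \<le> a\<^sup>2 / B" using B by (simp add: power2_eq_square)
  then show False using a B by (simp add: divide_le_cancel)
qed

text \<open>\<open>x\<close> maximises the quadratic form over the nonnegative unit vectors, a
  compact set. Taking absolute values extends the bound to all vectors, and varying one coordinate
  of \<open>x\<close> at a time gives the eigenvalue equation.\<close>

lemma perron_eigenvector:
  assumes V: "finite V" "V \<noteq> {}" and E: "E \<subseteq> V \<times> V" "sym E"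
  obtains x :: "nat \<Rightarrow> real" and r :: real where "\<And>v. 0 \<le> x v" "\<exists>v\<in>V. 0 < x v"
    "\<And>v. v \<in> V \<Longrightarrow> (\<Sum>w\<in>nbr E v. x w) = r * x v"
    "\<And>y. bil E y y \<le> r * (\<Sum>v\<in>V. (y v)\<^sup>2)"
proof -
  \<comment> \<open>Vectors are functions on all of \<open>nat\<close>; the interval
    \<open>{0..1}\<close> on \<open>V\<close> and the value \<open>0\<close> elsewhere make the
    product compact.\<close>
  define S :: "nat \<Rightarrow> real set" where "S v = (if v \<in> V then {0..1} else {0})" for v
  define N where "N x = (\<Sum>v\<in>V. (x v)\<^sup>2)" for x :: "nat \<Rightarrow> real"
  define K where "K = PiE UNIV S \<inter> {x. N x = 1}"
  have nS: "compact (S v)" for v by (simp add: S_def)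
  have "compactin (product_topology (\<lambda>_. euclidean) UNIV) (PiE UNIV S)"
    unfolding compactin_PiE using nS by simp
  then have "compact (PiE UNIV S)" by (simp add: euclidean_product_topology)
  moreover have "continuous_on UNIV N" unfolding N_def
    by (intro continuous_intros continuous_on_product_coordinates)
  then have "closed {x. N x = 1}" by (intro closed_Collect_eq continuous_on_const)
  ultimately have "compact K" unfolding K_def by (rule compact_Int_closed)
  moreover have "K \<noteq> {}"
  proof -
    obtain v where "v \<in> V" using V by blast
    let ?e = "\<lambda>w. if w = v then 1 else 0 :: real"
    have "?e \<in> PiE UNIV S" using \<open>v \<in> V\<close> by (auto simp: PiE_UNIV_domain S_def split: if_splits)
    moreover have "N ?e = 1"
      using V \<open>v \<in> V\<close> by (simp add: N_def if_distrib[of "\<lambda>x. x\<^sup>2"] cong: if_cong)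
    ultimately have "?e \<in> K" by (simp add: K_def)
    then show ?thesis by blast
  qed
  moreover have "continuous_on K (\<lambda>x. bil E x x)" unfolding bil_def split_def
    by (intro continuous_intros continuous_on_subset[OF continuous_on_product_coordinates]) auto
  ultimately obtain x where x: "x \<in> K" and xmax: "\<And>y. y \<in> K \<Longrightarrow> bil E y y \<le> bil E x x"
    using continuous_attains_sup[of K "\<lambda>x. bil E x x"] by blast
  define r where "r = bil E x x"
  have Nx: "N x = 1" using x by (simp add: K_def)
  have xpos: "0 \<le> x v" for v
  proof -
    have "x v \<in> S v" using x by (auto simp: K_def)
    then show ?thesis by (auto simp: S_def split: if_splits)
  qed
  have bound: "bil E y y \<le> r * N y" for y
  proof (cases "N y = 0")
    case True
    then have y0: "y v = 0" if "v \<in> V" for v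
      using that V by (simp add: N_def sum_nonneg_eq_0_iff)
    have "bil E y y = 0" unfolding bil_def by (rule sum.neutral) (use E y0 in auto)
    then show ?thesis using True by simp
  next
    case False
    moreover have "N y \<ge> 0" unfolding N_def by (intro sum_nonneg) simp
    ultimately have Ny: "N y > 0" by simp
    define s where "s = sqrt (N y)"
    have s: "s > 0" "s\<^sup>2 = N y" using Ny by (simp_all add: s_def)
    define z where "z v = (if v \<in> V then \<bar>y v\<bar> / s else 0)" for v
    have "N z = N y / s\<^sup>2" unfolding N_def sum_divide_distrib
      by (intro sum.cong) (auto simp: z_def power_divide)
    then have Nz: "N z = 1" using s Ny by simp
    have "z v \<in> S v" for v
    proof (cases "v \<in> V")
      case True
      have "(z v)\<^sup>2 \<le> N z" unfolding N_def using V True by (intro member_le_sum) auto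
      then have "z v \<le> 1" using Nz abs_le_square_iff[of "z v" 1] by simp
      moreover have "0 \<le> z v" using s by (simp add: z_def)
      ultimately show ?thesis using True by (simp add: S_def)
    qed (simp add: z_def S_def)
    then have "z \<in> K" using Nz by (auto simp: K_def)
    then have "bil E z z \<le> r" using xmax by (simp add: r_def)
    have "bil E y y \<le> (\<Sum>(v, w)\<in>E. s\<^sup>2 * (z v * z w))"
      unfolding bil_def
    proof (rule sum_mono, clarify)
      fix v w assume "(v, w) \<in> E"
      then have "v \<in> V" "w \<in> V" using E by auto
      then have "s\<^sup>2 * (z v * z w) = \<bar>y v * y w\<bar>" using s(1)
        by (simp add: z_def abs_mult power2_eq_square)
      then show "y v * y w \<le> s\<^sup>2 * (z v * z w)" by simp
    qed
    also have "\<dots> = s\<^sup>2 * bil E z z" by (simp add: bil_def sum_distrib_left split_def)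
    also have "\<dots> \<le> s\<^sup>2 * r" using \<open>bil E z z \<le> r\<close> by (intro mult_left_mono) auto
    finally show ?thesis using s by (simp add: mult.commute)
  qed
  have eig: "(\<Sum>w\<in>nbr E u. x w) = r * x u" if u: "u \<in> V" for u
  proof -
    define z :: "nat \<Rightarrow> real" where "z v = (if v = u then 1 else 0)" for v
    have "bil E z x = (\<Sum>v\<in>V. if v = u then \<Sum>w\<in>nbr E v. x w else 0)"
      unfolding bil_eq_sum_nbr[OF V(1) E(1)] by (intro sum.cong) (auto simp: z_def)
    then have bz: "bil E x z = (\<Sum>w\<in>nbr E u. x w)"
      using V(1) u bil_commute[OF E(2), of x z] by simp
    have zz: "(\<Sum>v\<in>V. x v * z v) = x u" "N z = 1"
      using V(1) u by (simp_all add: N_def z_def if_distrib[of "\<lambda>x. x\<^sup>2"] if_distrib[of "\<lambda>y. _ * y"] cong: if_cong)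
    have Nadd: "N (\<lambda>v. x v + t * z v) = N x + 2 * t * x u + t\<^sup>2" for t
    proof -
      have "N (\<lambda>v. x v + t * z v) = N x + 2 * t * (\<Sum>v\<in>V. x v * z v) + t\<^sup>2 * N z"
        unfolding N_def by (simp add: power2_eq_square algebra_simps sum.distrib sum_distrib_left)
      then show ?thesis by (simp add: zz)
    qed
    have "2 * t * (bil E x z - r * x u) \<le> t\<^sup>2 * (r - bil E z z)" for t
      using bound[of "\<lambda>v. x v + t * z v"] Nx
      unfolding Nadd bil_add_scale[OF E(2)] by (simp add: algebra_simps r_def)
    then have "bil E x z - r * x u = 0" by (rule zero_of_quadratic_bound)
    then show ?thesis using bz by simp
  qed
  have "\<exists>v\<in>V. 0 < x v"
  proof (rule ccontr)
    assume "\<not> ?thesis"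
    then have "x v = 0" if "v \<in> V" for v using xpos[of v] that by force
    then have "N x = 0" by (simp add: N_def)
    then show False using Nx by simp
  qed
  then show thesis using that[of x r] xpos eig bound unfolding N_def by blast
qed

text \<open>The increasing enumeration \<open>vs\<close> identifies matrix indices with vertices,
  which turns eigenvectors into functions on the vertex set.\<close>

lemma eigenvalue_adjacency_matrix:
  assumes "pair_graph G"
  shows "eigenvalue (adjacency_matrix G) r \<longleftrightarrow>
    (\<exists>y. (\<exists>v\<in>pverts G. y v \<noteq> 0) \<and> (\<forall>v\<in>pverts G. (\<Sum>w\<in>nbr (parcs G) v. y w) = r * y v))"
proof -
  interpret pair_graph G by fact
  define n where "n = card (pverts G)"
  define vs where "vs = sorted_list_of_set (pverts G)"
  define A where "A = adjacency_matrix G"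
  have A: "A = Matrix.mat n n (\<lambda>(i, j). if (vs ! i, vs ! j) \<in> parcs G then 1 else 0)"
    by (simp add: A_def adjacency_matrix_def vs_def n_def Let_def)
  have vs: "set vs = pverts G" "distinct vs" "length vs = n"
    using pair_finite_verts by (simp_all add: vs_def n_def)
  then have bij: "bij_betw ((!) vs) {..<n} (pverts G)" by (intro bij_betw_nth) auto
  have row: "(A *\<^sub>v Matrix.vec n (\<lambda>i. y (vs ! i))) $ i = (\<Sum>w\<in>nbr (parcs G) (vs ! i). y w)"
    if i: "i < n" for i and y :: "nat \<Rightarrow> real"
  proof -
    have "(A *\<^sub>v Matrix.vec n (\<lambda>i. y (vs ! i))) $ i
        = (\<Sum>j<n. if (vs ! i, vs ! j) \<in> parcs G then y (vs ! j) else 0)"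
      using i by (auto simp: A scalar_prod_def lessThan_atLeast0 intro!: sum.cong)
    also have "\<dots> = (\<Sum>w\<in>pverts G. if (vs ! i, w) \<in> parcs G then y w else 0)"
      by (rule sum.reindex_bij_betw[OF bij])
    also have "\<dots> = (\<Sum>w\<in>pverts G \<inter> nbr (parcs G) (vs ! i). y w)"
      using pair_finite_verts by (simp add: sum.inter_restrict)
    also have "pverts G \<inter> nbr (parcs G) (vs ! i) = nbr (parcs G) (vs ! i)"
      using in_arcsD2 by auto
    finally show ?thesis .
  qed
  have dimA: "dim_row A = n" "dim_col A = n" by (simp_all add: A)
  have ev: "eigenvector A (Matrix.vec n (\<lambda>i. y (vs ! i))) r \<longleftrightarrow>
    (\<exists>v\<in>pverts G. y v \<noteq> 0) \<and> (\<forall>v\<in>pverts G. (\<Sum>w\<in>nbr (parcs G) v. y w) = r * y v)" for y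
  proof -
    have all: "(\<forall>v\<in>pverts G. P v) \<longleftrightarrow> (\<forall>i<n. P (vs ! i))" for P
      using vs by (metis all_set_conv_all_nth)
    have "Matrix.vec n (\<lambda>i. y (vs ! i)) \<noteq> 0\<^sub>v n \<longleftrightarrow> \<not> (\<forall>v\<in>pverts G. y v = 0)"
      unfolding all by (auto simp: vec_eq_iff)
    moreover have "A *\<^sub>v Matrix.vec n (\<lambda>i. y (vs ! i)) = r \<cdot>\<^sub>v Matrix.vec n (\<lambda>i. y (vs ! i)) \<longleftrightarrow>
      (\<forall>v\<in>pverts G. (\<Sum>w\<in>nbr (parcs G) v. y w) = r * y v)"
      unfolding all using row by (auto simp: Matrix.vec_eq_iff dimA simp del: index_mult_mat_vec)
    ultimately show ?thesis by (simp add: eigenvector_def dimA)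
  qed
  show ?thesis
  proof
    assume "eigenvalue (adjacency_matrix G) r"
    then obtain v where v: "eigenvector A v r" by (auto simp: eigenvalue_def A_def)
    define y where "y = (\<lambda>u. v $ (the_inv_into {..<n} ((!) vs) u))"
    have "v = Matrix.vec n (\<lambda>i. y (vs ! i))"
      using v bij by (auto simp: Matrix.vec_eq_iff eigenvector_def dimA y_def bij_betw_def the_inv_into_f_f)
    then show "\<exists>y. (\<exists>v\<in>pverts G. y v \<noteq> 0) \<and> (\<forall>v\<in>pverts G. (\<Sum>w\<in>nbr (parcs G) v. y w) = r * y v)"
      using v ev by metis
  next
    assume "\<exists>y. (\<exists>v\<in>pverts G. y v \<noteq> 0) \<and> (\<forall>v\<in>pverts G. (\<Sum>w\<in>nbr (parcs G) v. y w) = r * y v)"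
    then show "eigenvalue (adjacency_matrix G) r" using ev by (auto simp: eigenvalue_def A_def)
  qed
qed

text \<open>The maximum of the quadratic form is an eigenvalue, and it bounds every eigenvalue
  \<open>m\<close>, because \<open>m\<close> times the squared norm of an eigenvector is a value of
  the form. Dividing by the largest entry normalises the vector.\<close>

lemma spectral_radius_eigenvector:
  assumes "pair_graph G" "pverts G \<noteq> {}"
  obtains x :: "nat \<Rightarrow> real" where "\<And>v. v \<in> pverts G \<Longrightarrow> 0 \<le> x v" "\<And>v. v \<in> pverts G \<Longrightarrow> x v \<le> 1"
    "\<exists>v\<in>pverts G. x v = 1"
    "\<And>v. v \<in> pverts G \<Longrightarrow> (\<Sum>w\<in>nbr (parcs G) v. x w) = graph_spectral_radius G * x v"
    "\<And>y. bil (parcs G) y y \<le> graph_spectral_radius G * (\<Sum>v\<in>pverts G. (y v)\<^sup>2)"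
proof -
  interpret pair_graph G by fact
  let ?V = "pverts G" and ?E = "parcs G"
  have E: "?E \<subseteq> ?V \<times> ?V" "sym ?E" using assms(1) by (simp_all add: pair_graph_iff)
  obtain x r where x: "\<And>v. 0 \<le> x v" "\<exists>v\<in>?V. 0 < x v"
    "\<And>v. v \<in> ?V \<Longrightarrow> (\<Sum>w\<in>nbr ?E v. x w) = r * x v"
    "\<And>y. bil ?E y y \<le> r * (\<Sum>v\<in>?V. (y v)\<^sup>2)"
    by (rule perron_eigenvector[OF pair_finite_verts assms(2) E]) (rule that)
  have "r = graph_spectral_radius G"
    unfolding graph_spectral_radius_def
  proof (rule Max_eqI[symmetric])
    have "adjacency_matrix G \<in> carrier_mat (card ?V) (card ?V)"
      by (simp add: adjacency_matrix_def Let_def)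
    then show "finite (spectrum (adjacency_matrix G))" by (rule card_finite_spectrum)
    show "r \<in> spectrum (adjacency_matrix G)"
      unfolding spectrum_def mem_Collect_eq eigenvalue_adjacency_matrix[OF assms(1)]
      using x(2,3) by (intro exI[of _ x]) force
    fix m assume "m \<in> spectrum (adjacency_matrix G)"
    then have "eigenvalue (adjacency_matrix G) m" by (simp add: spectrum_def)
    then obtain y where y: "\<exists>v\<in>?V. y v \<noteq> 0" "\<And>v. v \<in> ?V \<Longrightarrow> (\<Sum>w\<in>nbr ?E v. y w) = m * y v"
      unfolding eigenvalue_adjacency_matrix[OF assms(1)] by blast
    have "m * (\<Sum>v\<in>?V. (y v)\<^sup>2) = bil ?E y y"
      unfolding bil_eq_sum_nbr[OF pair_finite_verts E(1)] sum_distrib_left[of m]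
      by (intro sum.cong) (auto simp: y power2_eq_square)
    also have "\<dots> \<le> r * (\<Sum>v\<in>?V. (y v)\<^sup>2)" by (rule x)
    finally have "m * (\<Sum>v\<in>?V. (y v)\<^sup>2) \<le> r * (\<Sum>v\<in>?V. (y v)\<^sup>2)" .
    moreover have "(\<Sum>v\<in>?V. (y v)\<^sup>2) > 0"
      using y(1) pair_finite_verts by (auto intro: sum_pos2)
    ultimately show "m \<le> r" by simp
  qed
  define m where "m = Max (x ` ?V)"
  have xm: "x v \<le> m" if "v \<in> ?V" for v using that pair_finite_verts by (simp add: m_def)
  have mpos: "m > 0" using x(2) xm by force
  have "m \<in> x ` ?V" unfolding m_def using pair_finite_verts assms(2) by (intro Max_in) auto
  then obtain v0 where v0: "v0 \<in> ?V" "x v0 = m" by auto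
  show thesis
  proof (rule that[of "\<lambda>v. x v / m"])
    show "\<exists>v\<in>?V. x v / m = 1" using v0 mpos by (intro bexI[of _ v0]) auto
    show "(\<Sum>w\<in>nbr ?E v. x w / m) = graph_spectral_radius G * (x v / m)" if "v \<in> ?V" for v
      using x(3)[OF that] \<open>r = _\<close> by (simp flip: sum_divide_distrib)
    show "bil ?E y y \<le> graph_spectral_radius G * (\<Sum>v\<in>?V. (y v)\<^sup>2)" for y
      using x(4) \<open>r = _\<close> by simp
  qed (use x(1) xm mpos in auto)
qed

section \<open>The vertices with large eigenvector entries\<close>

lemma sum_const_bound_real:
  fixes f :: "nat \<Rightarrow> real"
  assumes "\<And>i. i \<in> A \<Longrightarrow> f i \<le> b" 
  shows "sum f A \<le> real (card A) * b"
  using sum_bounded_above[of A f b] assms by simp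

text \<open>\<open>sparse\<close>, \<open>few\<close> and \<open>no_bipartite\<close> express the
  absence of a subdivision of \<open>H\<close>; the lower bound on \<open>r\<close> comes from
  comparison with the book.\<close>

locale sparse_eigenvector =
  fixes V :: "nat set" and E :: "(nat \<times> nat) set" and x :: "nat \<Rightarrow> real" and r :: real
    and c K t g :: nat
  assumes V: "finite V" and E: "E \<subseteq> V \<times> V" "sym E" "irrefl E"
    and sparse: "\<And>A. A \<subseteq> V \<Longrightarrow> card (E \<inter> A \<times> A) \<le> c * card A"
    and few: "\<And>L. L \<subseteq> V \<Longrightarrow> card {w \<in> V - L. g < card (nbr E w \<inter> L)} \<le> K * card L"
    and no_bipartite: "\<And>A T. A \<subseteq> V \<Longrightarrow> T \<subseteq> V \<Longrightarrow> A \<inter> T = {} \<Longrightarrow> card A = Suc g \<Longrightarrow>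
      (\<And>a b. a \<in> A \<Longrightarrow> b \<in> T \<Longrightarrow> (a, b) \<in> E) \<Longrightarrow> card T < t"
    and x: "\<And>v. v \<in> V \<Longrightarrow> 0 \<le> x v" "\<And>v. v \<in> V \<Longrightarrow> x v \<le> 1" "\<exists>v\<in>V. x v = 1"
    and eigen: "\<And>v. v \<in> V \<Longrightarrow> (\<Sum>w\<in>nbr E v. x w) = r * x v"
    and r: "real g * (real (card V) - real g) \<le> r\<^sup>2" "0 < r"
    and g: "1 \<le> g"
begin

abbreviation "n \<equiv> real (card V)"

lemma nbr_V: "nbr E v \<subseteq> V"
  using E(1) by auto

lemma finite_nbr: "finite (nbr E v)"
  using finite_subset[OF nbr_V V] .

lemma x_nbr: "w \<in> nbr E v \<Longrightarrow> 0 \<le> x w" "w \<in> nbr E v \<Longrightarrow> x w \<le> 1"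
  using x nbr_V by blast+

lemma sum_degree_le: "A \<subseteq> V \<Longrightarrow> (\<Sum>v\<in>A. card (nbr E v \<inter> A)) \<le> c * card A"
  using sparse[of A] V by (simp add: card_arcs_eq_sum_degree finite_subset)

lemma eigen2:
  assumes "u \<in> V"
  shows "(\<Sum>v\<in>nbr E u. \<Sum>w\<in>nbr E v. x w) = r\<^sup>2 * x u"
proof -
  have "(\<Sum>v\<in>nbr E u. \<Sum>w\<in>nbr E v. x w) = (\<Sum>v\<in>nbr E u. r * x v)"
    using nbr_V by (intro sum.cong refl eigen) blast
  also have "\<dots> = r * (r * x u)" using eigen[OF assms] by (simp flip: sum_distrib_left)
  finally show ?thesis by (simp add: power2_eq_square)
qed

lemma sum_nbr_le_card:
  assumes "B \<subseteq> nbr E v"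
  shows "(\<Sum>w\<in>B. x w) \<le> real (card B)"
proof -
  have "x i \<le> 1" if "i \<in> B" for i using x_nbr(2)[of i v] that assms by auto
  then show ?thesis using sum_const_bound_real[of B x 1] by simp
qed

lemma r_ge:
  assumes "n \<ge> 2 * real g"
  shows "n / 2 \<le> r\<^sup>2"
proof -
  have "n / 2 \<le> n - real g" using assms by simp
  also have "\<dots> = 1 * (n - real g)" by simp
  also have "\<dots> \<le> real g * (n - real g)"
    using g assms by (intro mult_right_mono) auto
  finally show ?thesis using r(1) by simp
qed

text \<open>The eigenvalue equation is summed over \<open>V\<close>: as entries are at most
  \<open>1\<close>, \<open>r\<close> times the sum of all entries is at most the number of
  arcs.\<close>

lemma card_large_entries:
  "real (card {v \<in> V. e \<le> x v}) * (e * r) \<le> real c * n"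
proof -
  let ?L = "{v \<in> V. e \<le> x v}"
  have "real (card ?L) * (e * r) = (\<Sum>v\<in>?L. e * r)" by simp
  also have "\<dots> \<le> (\<Sum>v\<in>?L. r * x v)" using r by (intro sum_mono) (simp add: mult.commute)
  also have "\<dots> \<le> (\<Sum>v\<in>V. r * x v)" using V x r by (intro sum_mono2) auto
  also have "\<dots> = (\<Sum>v\<in>V. \<Sum>w\<in>nbr E v. x w)" by (intro sum.cong refl) (simp add: eigen)
  also have "\<dots> \<le> (\<Sum>v\<in>V. real (card (nbr E v)))" by (intro sum_mono sum_nbr_le_card) auto
  also have "\<dots> = real (\<Sum>v\<in>V. card (nbr E v \<inter> V))"
    using nbr_V by (simp add: Int_absorb2)
  also have "\<dots> \<le> real (c * card V)" using sum_degree_le[of V] by (intro of_nat_mono) auto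
  finally show ?thesis by simp
qed

text \<open>The common neighbours of \<open>L\<close> that are adjacent to \<open>w\<close> form a
  complete bipartite graph with the \<open>g + 1\<close> vertices of
  \<open>insert w L\<close>.\<close>

lemma card_common_nbr:
  assumes L: "L \<subseteq> V" "card L = g" and w: "w \<in> V - L"
  shows "card (nbr E w \<inter> {v \<in> V - L. L \<subseteq> nbr E v}) \<le> t"
proof -
  let ?R = "{v \<in> V - L. L \<subseteq> nbr E v}"
  have fL: "finite L" by (rule finite_subset[OF L(1) V])
  have "card (nbr E w \<inter> ?R) < t"
  proof (rule no_bipartite[of "insert w L"])
    show "insert w L \<subseteq> V" using w L by auto
    show "nbr E w \<inter> ?R \<subseteq> V" by auto
    show "insert w L \<inter> (nbr E w \<inter> ?R) = {}" using E(3) by (auto simp: irrefl_def)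
    show "card (insert w L) = Suc g" using w L fL by simp
    fix a b assume "a \<in> insert w L" "b \<in> nbr E w \<inter> ?R"
    then have "(a, b) \<in> E \<or> (b, a) \<in> E" by (auto simp: subset_iff)
    then show "(a, b) \<in> E" using E(2) by (auto dest: symD)
  qed
  then show ?thesis by simp
qed

text \<open>\<open>e\<close> is the threshold from which an entry counts as large,
  \<open>\<theta>\<close> the tolerance of the estimates; \<open>r_large\<close> makes the
  exceptional set \<open>Bd\<close> small.\<close>

context
  fixes e \<theta> :: real
  assumes e: "0 < e" "e * (real c + 1) \<le> \<theta> / 4" and \<theta>: "\<theta> < 1"
    and n_large: "2 * real g \<le> n" "(real g)\<^sup>2 \<le> \<theta> / 4 * n"
    and r_large: "(1 + real K) * (real c + 1) * real c \<le> e\<^sup>2 * r"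
begin

definition "L0 = {v \<in> V. e \<le> x v}"
text \<open>The exceptional vertices: any other vertex has at most \<open>g\<close> neighbours with
  a large entry.\<close>

definition "Bd = L0 \<union> {w \<in> V - L0. g < card (nbr E w \<inter> L0)}"

lemma n_pos: "n > 0"
  using n_large(1) g by linarith

lemma theta_pos: "\<theta> > 0"
proof -
  have "0 < e * (real c + 1)" using e by simp
  then show ?thesis using e by linarith
qed

lemma L0_subset: "L0 \<subseteq> V" "L0 \<subseteq> Bd" "Bd \<subseteq> V" "finite L0" "finite Bd"
  using V by (auto simp: L0_def Bd_def)

text \<open>By \<open>few\<close>, \<open>Bd\<close> is at most \<open>1 + K\<close> times as large
  as \<open>L0\<close>, and \<open>card_large_entries\<close> bounds the size of \<open>L0\<close>
  by \<open>c * n / (e * r)\<close>.\<close>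

lemma card_Bd: "(real c + 1) * real (card Bd) \<le> e * n"
proof -
  have "card Bd \<le> card L0 + card {w \<in> V - L0. g < card (nbr E w \<inter> L0)}"
    unfolding Bd_def by (rule card_Un_le)
  also have "\<dots> \<le> card L0 + K * card L0" using few[OF L0_subset(1)] by simp
  finally have "card Bd \<le> (1 + K) * card L0" by simp
  then have "real (card Bd) \<le> real ((1 + K) * card L0)" by (rule of_nat_mono)
  then have Bd: "real (card Bd) \<le> (1 + real K) * real (card L0)" by (simp add: algebra_simps)
  have er: "0 < e * r" using e r by simp
  have "(real c + 1) * real (card Bd) * (e * r) \<le> (real c + 1) * ((1 + real K) * real (card L0)) * (e * r)"
    using Bd er by (intro mult_right_mono mult_left_mono) auto
  also have "\<dots> = ((1 + real K) * (real c + 1)) * (real (card L0) * (e * r))" by (simp add: algebra_simps)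
  also have "\<dots> \<le> ((1 + real K) * (real c + 1)) * (real c * n)"
    using card_large_entries[of e] unfolding L0_def by (intro mult_left_mono) auto
  also have "\<dots> = ((1 + real K) * (real c + 1) * real c) * n" by simp
  also have "\<dots> \<le> (e\<^sup>2 * r) * n" using r_large by (intro mult_right_mono) auto
  also have "\<dots> = (e * n) * (e * r)" by (simp add: power2_eq_square)
  finally show ?thesis using er by (rule mult_right_le_imp_le)
qed

definition "s v = (\<Sum>w\<in>nbr E v \<inter> L0. x w)"

lemma s_le: "v \<in> V \<Longrightarrow> s v \<le> real (card (nbr E v \<inter> L0))"
  unfolding s_def by (intro sum_nbr_le_card) auto

lemma s_nonneg: "0 \<le> s v"
  unfolding s_def by (intro sum_nonneg) (auto intro: x_nbr)

lemma card_nbr_L0: "v \<in> V - Bd \<Longrightarrow> card (nbr E v \<inter> L0) \<le> g"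
  by (auto simp: Bd_def)

lemma s_le_g: "v \<in> V - Bd \<Longrightarrow> s v \<le> real g"
  using s_le[of v] card_nbr_L0[of v] by (meson DiffD1 of_nat_mono order_trans)

text \<open>\<open>r\<^sup>2 * x u\<close> weighs the walks of length two from \<open>u\<close> by
  the entry at their end. Walks ending outside \<open>L0\<close> contribute at most
  \<open>e * c * n\<close>, those with middle vertex in \<open>Bd\<close> and end in
  \<open>L0\<close> at most \<open>e * n\<close>.\<close>

lemma two_step:
  assumes u: "u \<in> V"
  shows "r\<^sup>2 * x u \<le> (\<Sum>v\<in>nbr E u - Bd. s v) + \<theta> / 4 * n"
proof -
  have split: "(\<Sum>w\<in>nbr E v. x w) = s v + (\<Sum>w\<in>nbr E v - L0. x w)" for v
    unfolding s_def using finite_nbr by (subst sum.Int_Diff[of _ _ L0]) auto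
  have "r\<^sup>2 * x u = (\<Sum>v\<in>nbr E u. s v) + (\<Sum>v\<in>nbr E u. \<Sum>w\<in>nbr E v - L0. x w)"
    unfolding eigen2[OF u, symmetric] split sum.distrib by simp
  also have "(\<Sum>v\<in>nbr E u. \<Sum>w\<in>nbr E v - L0. x w) \<le> (\<Sum>v\<in>nbr E u. e * real (card (nbr E v)))"
  proof (rule sum_mono)
    fix v
    have "x w \<le> e" if "w \<in> nbr E v - L0" for w using that E(1) by (auto simp: L0_def)
    then have "(\<Sum>w\<in>nbr E v - L0. x w) \<le> real (card (nbr E v - L0)) * e"
      by (intro sum_const_bound_real)
    also have "\<dots> \<le> real (card (nbr E v)) * e"
      using e finite_nbr by (intro mult_right_mono of_nat_mono card_mono) auto
    finally show "(\<Sum>w\<in>nbr E v - L0. x w) \<le> e * real (card (nbr E v))" by (simp add: mult.commute)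
  qed
  also have "\<dots> \<le> (\<Sum>v\<in>V. e * real (card (nbr E v)))"
    using V nbr_V e by (intro sum_mono2) auto
  also have "\<dots> = e * real (\<Sum>v\<in>V. card (nbr E v \<inter> V))"
    using nbr_V by (simp add: Int_absorb2 sum_distrib_left)
  also have "\<dots> \<le> e * real (c * card V)"
    using sum_degree_le[of V] e by (intro mult_left_mono of_nat_mono) auto
  also have "(\<Sum>v\<in>nbr E u. s v) \<le> (\<Sum>v\<in>nbr E u - Bd. s v) + e * n"
  proof -
    have "(\<Sum>v\<in>nbr E u. s v) = (\<Sum>v\<in>nbr E u \<inter> Bd. s v) + (\<Sum>v\<in>nbr E u - Bd. s v)"
      using finite_nbr by (rule sum.Int_Diff)
    also have "(\<Sum>v\<in>nbr E u \<inter> Bd. s v) \<le> (\<Sum>v\<in>Bd. s v)"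
      using L0_subset s_nonneg by (intro sum_mono2) auto
    \<comment> \<open>Since \<open>L0 \<subseteq> Bd\<close>, the arcs from \<open>Bd\<close> to
      \<open>L0\<close> lie inside \<open>Bd\<close>, and \<open>sparse\<close> bounds their
      number.\<close>
    also have "\<dots> \<le> (\<Sum>v\<in>Bd. real (card (nbr E v \<inter> Bd)))"
    proof (rule sum_mono)
      fix v assume "v \<in> Bd"
      then have "s v \<le> real (card (nbr E v \<inter> L0))" using L0_subset by (intro s_le) auto
      also have "\<dots> \<le> real (card (nbr E v \<inter> Bd))"
        using L0_subset by (intro of_nat_mono card_mono) auto
      finally show "s v \<le> real (card (nbr E v \<inter> Bd))" .
    qed
    also have "\<dots> = real (\<Sum>v\<in>Bd. card (nbr E v \<inter> Bd))" by simp
    also have "\<dots> \<le> real (c * card Bd)" by (intro of_nat_mono sum_degree_le L0_subset)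
    also have "\<dots> \<le> (real c + 1) * real (card Bd)" by (simp add: algebra_simps)
    also have "\<dots> \<le> e * n" by (rule card_Bd)
    finally show ?thesis by simp
  qed
  finally have "r\<^sup>2 * x u \<le> (\<Sum>v\<in>nbr E u - Bd. s v) + (e * (real c + 1)) * n" by (simp add: algebra_simps)
  also have "(e * (real c + 1)) * n \<le> \<theta> / 4 * n" using e by (intro mult_right_mono) auto
  finally show ?thesis by simp
qed

text \<open>Otherwise \<open>two_step\<close> at a vertex with entry \<open>1\<close> gives \<open>g
  * (n - g) \<le> card (V - Bd) * (g - \<theta>) + \<theta> / 4 * n\<close>, which is impossible
  because \<open>V - Bd\<close> contains more than half of the vertices.\<close>

lemma good_vertex: "\<exists>v\<in>V - Bd. real g - \<theta> \<le> s v"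
proof (rule ccontr)
  assume "\<not> ?thesis"
  then have bad: "s v \<le> real g - \<theta>" if "v \<in> V - Bd" for v using that by force
  obtain u where u: "u \<in> V" "x u = 1" using x(3) by blast
  have cB: "real (card (V - Bd)) = n - real (card Bd)"
    using L0_subset V by (simp add: card_Diff_subset card_mono of_nat_diff)
  have "1 * real (card Bd) \<le> (real c + 1) * real (card Bd)" by (intro mult_right_mono) auto
  then have "real (card Bd) \<le> e * n" using card_Bd by simp
  also have "e * 1 \<le> e * (real c + 1)" using e by (intro mult_left_mono) auto
  then have "e \<le> \<theta> / 4" using e(2) by linarith
  then have "e * n \<le> \<theta> / 4 * n" by (intro mult_right_mono) auto
  also have "\<theta> / 4 * n \<le> 1 / 4 * n" using \<theta> by (intro mult_right_mono) auto
  finally have cB2: "n / 2 < real (card (V - Bd))" using cB n_pos by simp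
  have "real g * (n - real g) \<le> r\<^sup>2 * x u" using r u by simp
  also have "\<dots> \<le> (\<Sum>v\<in>nbr E u - Bd. s v) + \<theta> / 4 * n" by (rule two_step[OF u(1)])
  also have "(\<Sum>v\<in>nbr E u - Bd. s v) \<le> (\<Sum>v\<in>V - Bd. s v)"
    using V nbr_V s_nonneg by (intro sum_mono2) auto
  also have "\<dots> \<le> real (card (V - Bd)) * (real g - \<theta>)" by (intro sum_const_bound_real bad)
  also have "\<dots> = real (card (V - Bd)) * real g - real (card (V - Bd)) * \<theta>" by (simp add: algebra_simps)
  also have "real (card (V - Bd)) * real g \<le> n * real g"
    using V by (intro mult_right_mono of_nat_mono card_mono) auto
  finally have "real (card (V - Bd)) * \<theta> \<le> (real g)\<^sup>2 + \<theta> / 4 * n"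
    by (simp add: algebra_simps power2_eq_square)
  also have "\<dots> \<le> \<theta> / 4 * n + \<theta> / 4 * n" using n_large by simp
  finally have "real (card (V - Bd)) * \<theta> \<le> n / 2 * \<theta>" by (simp add: algebra_simps)
  then show False using cB2 theta_pos by (simp add: mult_le_cancel_right)
qed

text \<open>\<open>L\<close> consists of the neighbours in \<open>L0\<close> of a good vertex: at
  most \<open>g\<close> entries, each at most \<open>1\<close>, with sum at least
  \<open>g - \<theta>\<close>. So there are exactly \<open>g\<close>, and none is below
  \<open>1 - \<theta>\<close>.\<close>

lemma core_exists:
  obtains L where "L \<subseteq> V" "card L = g" "\<And>l. l \<in> L \<Longrightarrow> 1 - \<theta> \<le> x l"
proof -
  obtain v where v: "v \<in> V - Bd" "real g - \<theta> \<le> s v" using good_vertex by blast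
  define L where "L = nbr E v \<inter> L0"
  have LV: "L \<subseteq> V" "finite L" using L0_subset by (auto simp: L_def)
  have cL: "card L \<le> g" using card_nbr_L0[OF v(1)] by (simp add: L_def)
  have "real g - \<theta> \<le> real (card L)" using v s_le[of v] by (auto simp: L_def)
  then have "real g < real (card L) + 1" using \<theta> by simp
  then have "card L = g" using cL by linarith
  moreover have "1 - \<theta> \<le> x l" if l: "l \<in> L" for l
  proof -
    have "s v = x l + (\<Sum>w\<in>L - {l}. x w)"
      unfolding s_def L_def[symmetric] using LV l by (simp add: sum.remove)
    also have "(\<Sum>w\<in>L - {l}. x w) \<le> real (card (L - {l}))"
      unfolding L_def by (rule sum_nbr_le_card) auto
    also have "card (L - {l}) = g - 1" using \<open>card L = g\<close> l LV by simp
    finally show ?thesis using v(2) g by simp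
  qed
  ultimately show thesis using LV that by blast
qed

text \<open>In \<open>two_step\<close> at \<open>l\<close> each neighbour outside \<open>Bd\<close>
  contributes at most \<open>g\<close>, so a total of about \<open>g * n\<close> is reached only if
  \<open>l\<close> is adjacent to almost all vertices.\<close>

lemma card_non_nbr:
  assumes l: "l \<in> V" "1 - \<theta> \<le> x l"
  shows "real (card (V - nbr E l)) \<le> 2 * \<theta> * n"
proof -
  have "(1 - \<theta>) * (real g * (n - real g)) \<le> x l * r\<^sup>2"
    using l r \<theta> n_large g by (intro mult_mono) auto
  also have "\<dots> = r\<^sup>2 * x l" by simp
  also have "\<dots> \<le> (\<Sum>v\<in>nbr E l - Bd. s v) + \<theta> / 4 * n" by (rule two_step[OF l(1)])
  also have "(\<Sum>v\<in>nbr E l - Bd. s v) \<le> real (card (nbr E l - Bd)) * real g"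
    using E(1) by (intro sum_const_bound_real s_le_g) auto
  also have "\<dots> \<le> real (card (nbr E l)) * real g"
    using finite_nbr by (intro mult_right_mono of_nat_mono card_mono) auto
  \<comment> \<open>The error term is enlarged by the factor \<open>g\<close>, so that
    \<open>g\<close> cancels from the inequality.\<close>
  also have "\<theta> / 4 * n = (\<theta> / 4 * n) * 1" by simp
  also have "(\<theta> / 4 * n) * 1 \<le> (\<theta> / 4 * n) * real g"
    using g theta_pos by (intro mult_left_mono) auto
  finally have "((1 - \<theta>) * (n - real g)) * real g \<le> (real (card (nbr E l)) + \<theta> / 4 * n) * real g"
    by (simp add: algebra_simps)
  then have "(1 - \<theta>) * (n - real g) \<le> real (card (nbr E l)) + \<theta> / 4 * n"
    using g by (simp add: mult_le_cancel_right)
  moreover have "real (card (V - nbr E l)) = n - real (card (nbr E l))"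
    using nbr_V V finite_nbr by (simp add: card_Diff_subset card_mono of_nat_diff)
  moreover have "real g \<le> \<theta> / 4 * n"
  proof -
    have "real g * 1 \<le> real g * real g" using g by (intro mult_left_mono) auto
    then show ?thesis using n_large(2) by (simp add: power2_eq_square)
  qed
  moreover have "(1 - \<theta>) * (n - real g) = n - \<theta> * n - real g + \<theta> * real g" by (simp add: algebra_simps)
  moreover have "0 \<le> \<theta> * real g" "0 \<le> \<theta> * n" using theta_pos by simp_all
  ultimately show ?thesis by linarith
qed

text \<open>\<open>R\<close> is the set of common neighbours of \<open>L\<close>, and
  \<open>Z\<close> the few remaining vertices outside \<open>L\<close>. A vertex outside
  \<open>L\<close> has at most \<open>g\<close> neighbours in \<open>L\<close> and at most
  \<open>t\<close> in \<open>R\<close>, so its entry is small once the total of the entries on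
  \<open>Z\<close> is controlled. That total is bounded by summing the eigenvalue equation over the
  sparse set \<open>Z\<close>.\<close>

lemma core_structure:
  assumes r2: "2 * (real g + real t) \<le> \<epsilon> * r"
    and \<epsilon>: "\<epsilon> > 0" and \<theta>\<epsilon>: "8 * real g * (real g + real t + real c) * \<theta> \<le> \<epsilon>"
  obtains L where "L \<subseteq> V" "card L = g" "\<And>l. l \<in> L \<Longrightarrow> 1 - \<epsilon> \<le> x l"
    "\<And>w. w \<in> V - L \<Longrightarrow> x w \<le> \<epsilon>" "real (card (V - {v \<in> V - L. L \<subseteq> nbr E v})) \<le> \<epsilon> * n"
proof -
  obtain L where L: "L \<subseteq> V" "card L = g" "\<And>l. l \<in> L \<Longrightarrow> 1 - \<theta> \<le> x l"
    by (rule core_exists) (rule that)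
  have fL: "finite L" by (rule finite_subset[OF L(1) V])
  define R where "R = {v \<in> V - L. L \<subseteq> nbr E v}"
  define Z where "Z = V - L - R"
  define a where "a = real g + real t + real c"
  have a1: "a \<ge> 1" using g by (simp add: a_def)
  have ga: "1 \<le> real g * a" using mult_mono[of 1 "real g" 1 a] a1 g by simp
  have "V - R \<subseteq> (\<Union>l\<in>L. V - nbr E l)"
  proof
    fix v assume v: "v \<in> V - R"
    show "v \<in> (\<Union>l\<in>L. V - nbr E l)"
    proof (cases "v \<in> L")
      case True
      then show ?thesis using v E(3) by (auto simp: irrefl_def)
    next
      case False
      then have "\<not> L \<subseteq> nbr E v" using v by (simp add: R_def)
      then obtain l where "l \<in> L" "(v, l) \<notin> E" unfolding subset_iff mem_nbr by blast
      then have "(l, v) \<notin> E" using E(2) by (auto dest: symD)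
      then show ?thesis using v \<open>l \<in> L\<close> by auto
    qed
  qed
  then have "card (V - R) \<le> card (\<Union>l\<in>L. V - nbr E l)" using fL V by (intro card_mono) auto
  also have "\<dots> \<le> (\<Sum>l\<in>L. card (V - nbr E l))" by (rule card_UN_le[OF fL])
  finally have "real (card (V - R)) \<le> (\<Sum>l\<in>L. real (card (V - nbr E l)))"
    unfolding of_nat_sum[symmetric] by (rule of_nat_mono)
  also have "\<dots> \<le> real (card L) * (2 * \<theta> * n)"
    using L by (intro sum_const_bound_real card_non_nbr) auto
  finally have VR: "real (card (V - R)) \<le> real g * (2 * \<theta> * n)" by (simp add: L(2))
  have \<theta>1: "8 * \<theta> \<le> \<epsilon>" "2 * real g * \<theta> \<le> \<epsilon>"
  proof -
    have "8 * \<theta> * 1 \<le> 8 * \<theta> * (real g * a)" using ga theta_pos by (intro mult_left_mono) auto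
    then show "8 * \<theta> \<le> \<epsilon>" using \<theta>\<epsilon> by (simp add: a_def algebra_simps)
    have "2 * real g * \<theta> * 1 \<le> 8 * real g * \<theta> * a" using a1 theta_pos by (intro mult_mono) auto
    then show "2 * real g * \<theta> \<le> \<epsilon>" using \<theta>\<epsilon> by (simp add: a_def algebra_simps)
  qed
  have nbr_R: "card (nbr E w \<inter> R) \<le> t" if w: "w \<in> V - L" for w
    unfolding R_def by (rule card_common_nbr[OF L(1,2) w])
  have parts: "card (nbr E w) \<le> g + t + card (nbr E w \<inter> Z)" if w: "w \<in> V - L" for w
  proof -
    have "nbr E w = (nbr E w \<inter> L) \<union> (nbr E w \<inter> R) \<union> (nbr E w \<inter> Z)"
      using E(1) by (auto simp: Z_def)
    then have "card (nbr E w) \<le> card (nbr E w \<inter> L) + card (nbr E w \<inter> R) + card (nbr E w \<inter> Z)"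
      by (metis card_Un_le add_le_mono1 order_trans)
    moreover have "card (nbr E w \<inter> L) \<le> g" using L(2) fL by (metis card_mono inf_le2)
    ultimately show ?thesis using nbr_R[OF w] by simp
  qed
  have ZV: "Z \<subseteq> V" "finite Z" using V by (auto simp: Z_def)
  have "card Z \<le> card (V - R)" using V by (intro card_mono) (auto simp: Z_def)
  then have cZ: "real (card Z) \<le> real g * (2 * \<theta> * n)" using VR by linarith
  have "r * (\<Sum>v\<in>Z. x v) = (\<Sum>v\<in>Z. \<Sum>w\<in>nbr E v. x w)"
    unfolding sum_distrib_left using ZV by (intro sum.cong) (auto simp: eigen)
  also have "\<dots> \<le> (\<Sum>v\<in>Z. real (g + t + card (nbr E v \<inter> Z)))"
  proof (rule sum_mono)
    fix v assume "v \<in> Z"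
    then have "card (nbr E v) \<le> g + t + card (nbr E v \<inter> Z)" by (intro parts) (auto simp: Z_def)
    then have "real (card (nbr E v)) \<le> real (g + t + card (nbr E v \<inter> Z))" by (rule of_nat_mono)
    then show "(\<Sum>w\<in>nbr E v. x w) \<le> real (g + t + card (nbr E v \<inter> Z))"
      using sum_nbr_le_card[of "nbr E v" v] by simp
  qed
  also have "\<dots> = real ((g + t) * card Z + (\<Sum>v\<in>Z. card (nbr E v \<inter> Z)))"
    by (simp add: sum.distrib algebra_simps)
  also have "\<dots> \<le> real ((g + t) * card Z + c * card Z)"
    using sum_degree_le[OF ZV(1)] by (intro of_nat_mono) auto
  also have "\<dots> = a * real (card Z)" by (simp add: a_def algebra_simps)
  also have "\<dots> \<le> a * (real g * (2 * \<theta> * n))" using cZ a1 by (intro mult_left_mono) auto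
  finally have sumZ: "r * (\<Sum>v\<in>Z. x v) \<le> a * (real g * (2 * \<theta> * n))" .
  show thesis
  proof (rule that[OF L(1,2)])
    show "1 - \<epsilon> \<le> x l" if "l \<in> L" for l using L(3)[OF that] \<theta>1(1) theta_pos by linarith
    have "real g * (2 * \<theta> * n) \<le> \<epsilon> * n"
      using mult_right_mono[OF \<theta>1(2), of n] n_pos by (simp add: algebra_simps)
    then show "real (card (V - {v \<in> V - L. L \<subseteq> nbr E v})) \<le> \<epsilon> * n"
      using VR unfolding R_def by linarith
    fix w assume w: "w \<in> V - L"
    have "r * x w = (\<Sum>v\<in>nbr E w. x v)" using eigen w by simp
    also have "nbr E w = (nbr E w \<inter> L) \<union> ((nbr E w \<inter> R) \<union> (nbr E w \<inter> Z))"
      using E(1) by (auto simp: Z_def)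
    also have "(\<Sum>v\<in>\<dots>. x v) = (\<Sum>v\<in>nbr E w \<inter> L. x v) + ((\<Sum>v\<in>nbr E w \<inter> R. x v) + (\<Sum>v\<in>nbr E w \<inter> Z. x v))"
      using finite_nbr by (subst sum.union_disjoint, simp, simp, force simp: R_def Z_def,
        subst sum.union_disjoint) (auto simp: Z_def)
    also have "(\<Sum>v\<in>nbr E w \<inter> L. x v) \<le> real g"
    proof -
      have "(\<Sum>v\<in>nbr E w \<inter> L. x v) \<le> real (card (nbr E w \<inter> L))" by (rule sum_nbr_le_card) auto
      moreover have "card (nbr E w \<inter> L) \<le> g" using L(2) fL by (metis card_mono inf_le2)
      ultimately show ?thesis by (meson of_nat_mono order_trans)
    qed
    also have "(\<Sum>v\<in>nbr E w \<inter> R. x v) \<le> real t"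
    proof -
      have "(\<Sum>v\<in>nbr E w \<inter> R. x v) \<le> real (card (nbr E w \<inter> R))" by (rule sum_nbr_le_card) auto
      then show ?thesis using nbr_R[OF w] by (meson of_nat_mono order_trans)
    qed
    also have "(\<Sum>v\<in>nbr E w \<inter> Z. x v) \<le> (\<Sum>v\<in>Z. x v)"
      using ZV x by (intro sum_mono2) auto
    finally have 1: "r * x w \<le> real g + real t + (\<Sum>v\<in>Z. x v)" by simp
    \<comment> \<open>The second factor \<open>r\<close> makes \<open>sumZ\<close> applicable, and
      \<open>n / 2 \<le> r\<^sup>2\<close> absorbs the resulting multiple of
      \<open>n\<close>.\<close>
    have "r\<^sup>2 * x w = r * (r * x w)" by (simp add: power2_eq_square)
    also have "\<dots> \<le> r * (real g + real t + (\<Sum>v\<in>Z. x v))" using 1 r by (intro mult_left_mono) auto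
    also have "\<dots> = r * (real g + real t) + r * (\<Sum>v\<in>Z. x v)" by (simp add: algebra_simps)
    also have "r * (real g + real t) \<le> r * (\<epsilon> * r / 2)" using r2 r by (intro mult_left_mono) auto
    also have "r * (\<Sum>v\<in>Z. x v) \<le> a * (real g * (2 * \<theta> * n))" by (rule sumZ)
    also have "a * (real g * (2 * \<theta> * n)) \<le> \<epsilon> * (n / 2) / 2"
    proof -
      have "(8 * real g * a * \<theta>) * n \<le> \<epsilon> * n" using \<theta>\<epsilon> unfolding a_def by (intro mult_right_mono) auto
      then show ?thesis by (simp add: algebra_simps)
    qed
    also have "\<epsilon> * (n / 2) / 2 \<le> \<epsilon> * r\<^sup>2 / 2"
      using r_ge[OF n_large(1)] \<epsilon> by (intro divide_right_mono mult_left_mono) auto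
    finally have "r\<^sup>2 * x w \<le> r\<^sup>2 * \<epsilon>" by (simp add: power2_eq_square algebra_simps)
    then show "x w \<le> \<epsilon>" using r(2) by (simp add: mult_le_cancel_left)
  qed
qed

end

end

section \<open>Switching to a complete join\<close>

text \<open>Dividing an edge exchanges one neighbour at each of its ends and adds a vertex of degree
  two; the bound simply adds the two cases. Bounded degrees, and a neighbour for each new vertex,
  limit how many twins a subdivision can use.\<close>

lemma subdivision_degree:
  assumes "subdivision_pair H S" "pair_graph H"
  shows "card (nbr (parcs S) y) \<le> card (pverts H) + 2 \<and>
    (y \<in> pverts S - pverts H \<longrightarrow> nbr (parcs S) y \<noteq> {})"
  using assms(1)
proof (induction arbitrary: y rule: subdivision_pair_induct)
  case base
  interpret pair_graph H by fact
  have "nbr (parcs H) y \<subseteq> pverts H" by (auto dest: in_arcsD2)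
  then have "card (nbr (parcs H) y) \<le> card (pverts H)" using pair_finite_verts by (rule card_mono[rotated])
  then show ?case by simp
next
  case (divide e w S)
  obtain u v where e: "e = (u, v)" by (cases e)
  interpret pair_graph S using pair_graph_subdivision[OF assms(2) divide(3)] .
  have uv: "(u, v) \<in> parcs S" "(v, u) \<in> parcs S" "u \<noteq> v"
    using divide(1) arcs_symmetric no_loops' by (auto simp: e)
  have w: "(w, a) \<notin> parcs S" "(a, w) \<notin> parcs S" for a
    using divide(2) by (auto dest: in_arcsD1 in_arcsD2)
  have uw: "u \<noteq> w" "v \<noteq> w" using uv w by auto
  have fin: "finite (nbr (parcs S) y)" for y
    by (rule finite_subset[OF _ pair_finite_verts]) (auto dest: in_arcsD2)
  let ?N = "nbr (parcs (subdivide S e w))"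
  have mem: "(y, a) \<in> parcs (subdivide S e w) \<longleftrightarrow> (y, a) \<in> parcs S \<and> (y, a) \<noteq> (u, v) \<and> (y, a) \<noteq> (v, u) \<or>
      (y, a) \<in> {(u,w), (w,u), (w, v), (v, w)}" for y a
    unfolding e arcs_subdivide by blast
  have replace: "card (?N y) = card (nbr (parcs S) y) \<and> ?N y \<noteq> {}"
    if y: "y = u \<and> b = v \<or> y = v \<and> b = u" for y b
  proof -
    have "?N y = insert w (nbr (parcs S) y - {b})"
      using y uv uw w unfolding set_eq_iff mem_nbr mem insert_iff Diff_iff by auto
    moreover have "w \<notin> nbr (parcs S) y - {b}" "b \<in> nbr (parcs S) y" using w y uv by auto
    ultimately show ?thesis
      using card_insert_disjoint[of "nbr (parcs S) y - {b}" w] card_Suc_Diff1[OF fin] fin[of y] by auto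
  qed
  consider "y = w" | "y = u" | "y = v" | "y \<noteq> w" "y \<noteq> u" "y \<noteq> v" by blast
  then show ?case
  proof cases
    case 1
    have "?N y = {u, v}" using 1 w unfolding set_eq_iff mem_nbr mem by auto
    then show ?thesis using uv by simp
  next
    case 2
    then show ?thesis using replace[of u v] divide.IH[of u] by simp
  next
    case 3
    then show ?thesis using replace[of v u] divide.IH[of v] by simp
  next
    case 4
    have "?N y = nbr (parcs S) y" using 4 unfolding set_eq_iff mem_nbr mem by auto
    then show ?thesis using divide.IH[of y] 4 by simp
  qed
qed

definition switch :: "nat set \<Rightarrow> (nat \<times> nat) set \<Rightarrow> nat set \<Rightarrow> nat set \<Rightarrow> (nat \<times> nat) set" where
  "switch V E L X = {(u, w). u \<in> V \<and> w \<in> V \<and> u \<noteq> w \<and>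
    (u \<in> L \<and> w \<in> L \<union> X \<or> w \<in> L \<and> u \<in> L \<union> X \<or> (u, w) \<in> E \<and> u \<notin> X \<and> w \<notin> X)}"

text \<open>
  In the switched graph the vertices of \<open>insert v B\<close> are twins, and a subdivision of \<open>H\<close> uses only
  boundedly many of them. So it can be moved off \<open>v\<close>, and the edges inside \<open>L\<close> can be
  replaced by paths of length two through unused vertices of \<open>B\<close>.
\<close>

lemma topological_minor_switch:
  assumes H: "pair_graph H" and E: "sym E" and fin: "finite V" and L: "L \<subseteq> V"
    and B: "B \<subseteq> V - L" "\<And>b l. b \<in> B \<Longrightarrow> l \<in> L \<Longrightarrow> (b, l) \<in> E"
    and v: "v \<notin> L"
    and card_B: "card (pverts H) + card L * (card (pverts H) + 2) + card L * card L \<le> card B"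
    and minor: "topological_minor H V (switch V E L (insert v B))"
  shows "topological_minor H V E"
proof -
  define X where "X = insert v B"
  obtain S f where S: "subdivision_pair H S" and inj: "inj_on f (pverts S)"
    and fV: "f ` pverts S \<subseteq> V" and fE: "\<And>y z. (y, z) \<in> parcs S \<Longrightarrow> (f y, f z) \<in> switch V E L X"
    using minor unfolding topological_minor_def X_def by blast
  interpret S: pair_graph S using pair_graph_subdivision[OF H S] .
  interpret H: pair_graph H by fact
  have XL: "X \<inter> L = {}" using B v by (auto simp: X_def)
  have finL: "finite L" by (rule finite_subset[OF L fin])
  have finB: "finite B" by (rule finite_subset[OF B(1)]) (use fin in simp)
  \<comment> \<open>\<open>Y\<close> is the part of the subdivision placed on the twins and
    \<open>P\<close> the part placed on \<open>L\<close>; all neighbours of \<open>Y\<close> lie in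
    \<open>P\<close>.\<close>
  define Y where "Y = {z \<in> pverts S. f z \<in> X}"
  define P where "P = {z \<in> pverts S. f z \<in> L}"
  have finP: "finite P" using S.pair_finite_verts by (simp add: P_def)
  have cP: "card P \<le> card L"
    using inj finL by (intro card_inj_on_le[of f]) (auto simp: P_def inj_on_def)
  have YP: "y \<in> P" if "(y, z) \<in> parcs S" "z \<in> Y" for y z
    using fE[OF that(1)] that XL by (auto simp: switch_def Y_def P_def dest: S.in_arcsD1)
  \<comment> \<open>A vertex of \<open>Y\<close> belongs to \<open>H\<close> or, being a dividing
    vertex, has a neighbour in \<open>P\<close>; bounded degrees then bound
    \<open>Y\<close>.\<close>
  have "Y \<subseteq> pverts H \<union> (\<Union>y\<in>P. nbr (parcs S) y)"
  proof
    fix z assume z: "z \<in> Y"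
    show "z \<in> pverts H \<union> (\<Union>y\<in>P. nbr (parcs S) y)"
    proof (cases "z \<in> pverts H")
      case False
      then have "nbr (parcs S) z \<noteq> {}" using subdivision_degree[OF S H, of z] z by (simp add: Y_def)
      then obtain y where "(z, y) \<in> parcs S" by auto
      then have "(y, z) \<in> parcs S" using S.arcs_symmetric by simp
      then show ?thesis using YP[OF _ z] by auto
    qed simp
  qed
  moreover have finN: "finite (nbr (parcs S) y)" for y
    by (rule finite_subset[OF _ S.pair_finite_verts]) (auto dest: S.in_arcsD2)
  ultimately have "card Y \<le> card (pverts H \<union> (\<Union>y\<in>P. nbr (parcs S) y))"
    using finP H.pair_finite_verts by (intro card_mono) auto
  also have "\<dots> \<le> card (pverts H) + card (\<Union>y\<in>P. nbr (parcs S) y)" by (rule card_Un_le)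
  also have "card (\<Union>y\<in>P. nbr (parcs S) y) \<le> (\<Sum>y\<in>P. card (nbr (parcs S) y))"
    by (rule card_UN_le[OF finP])
  also have "\<dots> \<le> (\<Sum>y\<in>P. card (pverts H) + 2)"
    using subdivision_degree[OF S H] by (intro sum_mono) blast
  also have "\<dots> \<le> card L * (card (pverts H) + 2)"
    unfolding sum_constant of_nat_id using cP by (rule mult_le_mono1)
  finally have cY: "card Y + card L * card L \<le> card B" using card_B by linarith
  have finY: "finite Y" using S.pair_finite_verts by (simp add: Y_def)
  have "card Y \<le> card B" using cY by linarith
  then obtain h where h: "inj_on h Y" "h ` Y \<subseteq> B" by (rule injection_exists[OF finY finB])
  \<comment> \<open>All of \<open>Y\<close> is moved into \<open>B\<close>, whose vertices are
    joined to \<open>L\<close> already in \<open>E\<close>.\<close>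
  define k where "k z = (if z \<in> Y then h z else f z)" for z
  have kY: "k z \<in> B" if "z \<in> Y" for z using that h(2) by (auto simp: k_def)
  have kN: "k z = f z" "f z \<notin> B" if "z \<in> pverts S" "z \<notin> Y" for z
    using that by (auto simp: k_def Y_def X_def)
  have kP: "k z = f z" "f z \<in> L" if "z \<in> P" for z
    using that XL by (auto simp: k_def Y_def P_def)
  have edge: "(k y, k z) \<in> E \<or> y \<in> P \<and> z \<in> P" if yz: "(y, z) \<in> parcs S" for y z
  proof -
    have zy: "(z, y) \<in> parcs S" using yz S.arcs_symmetric by simp
    have mem: "y \<in> pverts S" "z \<in> pverts S" using yz by (auto dest: S.in_arcsD1 S.in_arcsD2)
    consider "z \<in> Y" | "y \<in> Y" | "y \<notin> Y" "z \<notin> Y" by blast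
    then show ?thesis
    proof cases
      case 1
      then have "y \<in> P" using YP yz by blast
      then have "(k z, k y) \<in> E" using kY[OF 1] kP[of y] B(2) by simp
      then show ?thesis using E by (auto dest: symD)
    next
      case 2
      then have "z \<in> P" using YP zy by blast
      then have "(k y, k z) \<in> E" using kY[OF 2] kP[of z] B(2) by simp
      then show ?thesis by simp
    next
      case 3
      then have "f y \<notin> X" "f z \<notin> X" using mem by (auto simp: Y_def)
      then have "(f y, f z) \<in> E \<or> f y \<in> L \<and> f z \<in> L" using fE[OF yz] by (auto simp: switch_def)
      then show ?thesis using 3 kN mem by (simp add: P_def)
    qed
  qed
  show ?thesis
  proof (rule topological_minor_supply[OF H E S, of k V "B - h ` Y"])
    show "inj_on k (pverts S)"
    proof (rule inj_onI)
      fix y z assume yz: "y \<in> pverts S" "z \<in> pverts S" "k y = k z"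
      show "y = z"
      proof (cases "y \<in> Y"; cases "z \<in> Y")
        assume "y \<in> Y" "z \<in> Y"
        then show ?thesis using yz h(1) by (simp add: k_def inj_onD)
      next
        assume "y \<in> Y" "z \<notin> Y"
        then show ?thesis using kY[of y] kN[of z] yz by simp
      next
        assume "y \<notin> Y" "z \<in> Y"
        then show ?thesis using kY[of z] kN[of y] yz by simp
      next
        assume "y \<notin> Y" "z \<notin> Y"
        then show ?thesis using yz inj by (simp add: k_def inj_onD)
      qed
    qed
    show "k ` pverts S \<subseteq> V"
    proof (rule image_subsetI)
      fix z assume "z \<in> pverts S"
      then show "k z \<in> V" using kY[of z] kN[of z] fV B(1) by (cases "z \<in> Y") auto
    qed
    show "finite (B - h ` Y)" using finB by simp
    show "B - h ` Y \<subseteq> V - k ` pverts S"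
    proof
      fix b assume b: "b \<in> B - h ` Y"
      have "b \<noteq> k z" if "z \<in> pverts S" for z
        using b kN[of z] that by (cases "z \<in> Y") (auto simp: k_def)
      then show "b \<in> V - k ` pverts S" using b B(1) by auto
    qed
    have "unrealised S k E \<subseteq> (\<lambda>(y, z). {y, z}) ` (P \<times> P)"
      using edge by (auto simp: unrealised_def)
    then have "card (unrealised S k E) \<le> card (P \<times> P)" using finP by (intro surj_card_le) auto
    also have "\<dots> = card P * card P" by (rule card_cartesian_product)
    also have "\<dots> \<le> card L * card L" using cP by (intro mult_mono) auto
    also have "\<dots> \<le> card B - card (h ` Y)" using cY card_image[OF h(1)] by simp
    also have "\<dots> = card (B - h ` Y)" using finY h(2) by (simp add: card_Diff_subset)
    finally show "card (unrealised S k E) \<le> card (B - h ` Y)" .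
    fix y z b assume "(y, z) \<in> parcs S" "(k y, k z) \<notin> E" "b \<in> B - h ` Y"
    then have "y \<in> P" "b \<in> B" using edge by auto
    then have "(b, k y) \<in> E" using kP[of y] B(2) by simp
    then show "(k y, b) \<in> E" using E by (auto dest: symD)
  qed
qed

lemma sum_Un_le_real:
  fixes f :: "'a \<Rightarrow> real"
  assumes "finite A" "finite B" "\<And>i. i \<in> A \<inter> B \<Longrightarrow> 0 \<le> f i"
  shows "sum f (A \<union> B) \<le> sum f A + sum f B"
proof -
  have "sum f (A \<union> B) + sum f (A \<inter> B) = sum f A + sum f B"
    using assms by (intro sum.union_inter)
  moreover have "0 \<le> sum f (A \<inter> B)" using assms by (intro sum_nonneg) auto
  ultimately show ?thesis by simp
qed

text \<open>
  The test vector for the switched graph agrees with the eigenvector \<open>x\<close> except at \<open>v\<close>, where it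
  takes the optimal value \<open>(\<Sum>l\<in>L. x l) / r\<close>; \<open>x v\<close> itself may be zero.
\<close>

lemma switch_inequality:
  fixes x :: "nat \<Rightarrow> real"
  assumes V: "finite V" and E: "E \<subseteq> V \<times> V" "sym E" "irrefl E"
    and L: "L \<subseteq> V" and B: "B \<subseteq> V - L" and v: "v \<in> V - L" "v \<notin> B"
    and x: "\<And>u. u \<in> V \<Longrightarrow> 0 \<le> x u"
    and eigen: "\<And>u. u \<in> V \<Longrightarrow> (\<Sum>w\<in>nbr E u. x w) = r * x u" and r: "0 < r"
    and rayleigh: "\<And>y. bil (switch V E L (insert v B)) y y \<le> r * (\<Sum>u\<in>V. (y u)\<^sup>2)"
    and A: "A \<subseteq> L \<times> L - E" "irrefl A"
  shows "(\<Sum>l\<in>L. x l)\<^sup>2 + r * bil A x x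
    \<le> (r * x v)\<^sup>2 + r * (2 * (\<Sum>b\<in>B. x b * (\<Sum>w\<in>nbr E b - L. x w)))"
proof -
  define \<sigma> where "\<sigma> = (\<Sum>l\<in>L. x l)"
  define y where "y = x(v := \<sigma> / r)"
  define E2 where "E2 = switch V E L (insert v B)"
  define wt where "wt = (\<lambda>(u, w). x u * x w)"
  define V1 where "V1 = V - {v}"
  define P where "P = E2 \<inter> V1 \<times> V1"
  define Q where "Q = E \<inter> V1 \<times> V1"
  define R1 where "R1 = Sigma B (\<lambda>b. nbr E b - L)"
  have fin: "finite L" "finite B" "finite (V \<times> V)" "finite E"
    using V L B E(1) by (auto intro: finite_subset[of B V] finite_subset[of L V] finite_subset[of E "V \<times> V"])
  have nbr: "finite (nbr E u)" "nbr E u \<subseteq> V" for u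
  proof -
    show "nbr E u \<subseteq> V" using E(1) by auto
    then show "finite (nbr E u)" using V by (rule finite_subset)
  qed
  have wt: "0 \<le> wt p" if "p \<in> V \<times> V" for p using that x by (auto simp: wt_def)
  have sum_row: "(\<Sum>p\<in>Pair u ` N. case p of (a, b) \<Rightarrow> z a * z b) = z u * sum z N"
    "(\<Sum>p\<in>(\<lambda>w. (w, u)) ` N. case p of (a, b) \<Rightarrow> z a * z b) = z u * sum z N"
    for u N and z :: "nat \<Rightarrow> real"
    by (subst sum.reindex; simp add: inj_on_def sum_distrib_left mult.commute)+
  \<comment> \<open>This separates the arcs avoiding \<open>v\<close>, on which \<open>x\<close> and
    \<open>y\<close> give the same weights, from the arcs at \<open>v\<close>.\<close>
  have split_arcs: "bil F z z = (\<Sum>p\<in>F \<inter> V1 \<times> V1. case p of (a, b) \<Rightarrow> z a * z b) + 2 * (z v * sum z (nbr F v))"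
    if F: "F \<subseteq> V \<times> V" "sym F" "irrefl F" for F and z :: "nat \<Rightarrow> real"
  proof -
    let ?Y = "Pair v ` nbr F v" and ?Z = "(\<lambda>w. (w, v)) ` nbr F v"
    have "finite F" by (rule finite_subset[OF F(1) fin(3)])
    moreover have "nbr F v \<subseteq> V" using F(1) by auto
    then have "finite (nbr F v)" using V by (rule finite_subset)
    moreover have "F = (F \<inter> V1 \<times> V1) \<union> (?Y \<union> ?Z)"
      using F by (auto simp: V1_def sym_def)
    moreover have "(F \<inter> V1 \<times> V1) \<inter> (?Y \<union> ?Z) = {}" "?Y \<inter> ?Z = {}"
      using F by (auto simp: V1_def irrefl_def)
    ultimately have "bil F z z = (\<Sum>p\<in>F \<inter> V1 \<times> V1. case p of (a, b) \<Rightarrow> z a * z b)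
      + ((\<Sum>p\<in>?Y. case p of (a, b) \<Rightarrow> z a * z b) + (\<Sum>p\<in>?Z. case p of (a, b) \<Rightarrow> z a * z b))"
      unfolding bil_def by (metis (no_types, lifting) finite_Int finite_Un finite_imageI sum.union_disjoint)
    then show ?thesis unfolding sum_row by simp
  qed
  have E2: "E2 \<subseteq> V \<times> V" "sym E2" "irrefl E2"
    using E by (auto simp: E2_def switch_def sym_def irrefl_def)
  have nbr2: "nbr E2 v = L" using v L by (auto simp: E2_def switch_def)
  have y1: "y u = x u" if "u \<in> V1" for u using that by (simp add: y_def V1_def)
  have yL: "sum y L = \<sigma>" unfolding \<sigma>_def using v by (intro sum.cong) (auto simp: y_def)
  have "bil E2 y y = sum wt P + 2 * (\<sigma> / r * \<sigma>)"
    unfolding split_arcs[OF E2] nbr2 yL P_def wt_def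
    by (intro arg_cong2[of _ _ _ _ "(+)"] sum.cong) (auto simp: y1, simp add: y_def)
  moreover have "bil E2 y y \<le> r * (\<Sum>u\<in>V. (y u)\<^sup>2)" unfolding E2_def by (rule rayleigh)
  moreover have "(\<Sum>u\<in>V. (y u)\<^sup>2) = (\<sigma> / r)\<^sup>2 + (\<Sum>u\<in>V1. (x u)\<^sup>2)"
    unfolding V1_def using V v by (subst sum.remove[of V v]) (auto simp: y_def intro!: sum.cong)
  ultimately have 1: "sum wt P + 2 * (\<sigma> / r * \<sigma>) \<le> r * ((\<sigma> / r)\<^sup>2 + (\<Sum>u\<in>V1. (x u)\<^sup>2))" by simp
  have "bil E x x = (\<Sum>u\<in>V. r * (x u)\<^sup>2)"
    unfolding bil_eq_sum_nbr[OF V E(1)] by (intro sum.cong) (auto simp: eigen power2_eq_square)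
  also have "\<dots> = r * ((x v)\<^sup>2 + (\<Sum>u\<in>V1. (x u)\<^sup>2))"
    unfolding V1_def sum_distrib_left[symmetric] using V v by (subst sum.remove[of V v]) auto
  finally have 2: "sum wt Q + 2 * (x v * (r * x v)) = r * ((x v)\<^sup>2 + (\<Sum>u\<in>V1. (x u)\<^sup>2))"
    unfolding split_arcs[OF E] Q_def wt_def using eigen[of v] v by simp
  have AP: "A \<subseteq> P" using A L v by (auto simp: P_def E2_def switch_def V1_def irrefl_def)
  have PV: "P \<subseteq> V \<times> V" using E2 by (auto simp: P_def)
  have fP: "finite P" by (rule finite_subset[OF PV fin(3)])
  \<comment> \<open>An old arc avoiding \<open>v\<close> either survives the switch, and is not in
    \<open>A\<close>, or is lost at \<open>B\<close>; the lost arcs are those of \<open>R1\<close>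
    and their reversals.\<close>
  have QS: "Q \<subseteq> (P - A) \<union> (R1 \<union> prod.swap ` R1)"
  proof
    fix p assume p: "p \<in> Q"
    obtain u w where uw: "p = (u, w)" by (cases p)
    have E': "(u, w) \<in> E" "(w, u) \<in> E" "u \<noteq> w" "u \<in> V1" "w \<in> V1" "u \<in> V" "w \<in> V"
      using p E by (auto simp: uw Q_def sym_def irrefl_def V1_def)
    consider "u \<in> B" "w \<notin> L" | "w \<in> B" "u \<notin> L" | "u \<in> B" "w \<in> L" | "w \<in> B" "u \<in> L" | "u \<notin> B" "w \<notin> B"
      by blast
    then show "p \<in> (P - A) \<union> (R1 \<union> prod.swap ` R1)"
    proof cases
      case 1
      then show ?thesis using E' by (auto simp: uw R1_def)
    next
      case 2
      then have "(w, u) \<in> R1" using E' by (auto simp: R1_def)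
      then show ?thesis unfolding uw by (metis UnI2 imageI swap_simp)
    next
      case 3
      then show ?thesis using E' A B by (auto simp: uw P_def E2_def switch_def)
    next
      case 4
      then show ?thesis using E' A B by (auto simp: uw P_def E2_def switch_def)
    next
      case 5
      moreover have "u \<noteq> v" "w \<noteq> v" using E' by (auto simp: V1_def)
      ultimately show ?thesis using E' A by (auto simp: uw P_def E2_def switch_def)
    qed
  qed
  have R1V: "R1 \<subseteq> V \<times> V" "prod.swap ` R1 \<subseteq> V \<times> V" using B E(1) by (auto simp: R1_def)
  have fR: "finite R1" "finite (prod.swap ` R1)" using finite_subset[OF R1V(1) fin(3)] by auto
  have "sum wt Q \<le> sum wt ((P - A) \<union> (R1 \<union> prod.swap ` R1))"
  proof (rule sum_mono2[OF _ QS])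
    show "finite ((P - A) \<union> (R1 \<union> prod.swap ` R1))" using fP fR by simp
    have S: "(P - A) \<union> (R1 \<union> prod.swap ` R1) \<subseteq> V \<times> V" using PV R1V by blast
    show "0 \<le> wt p" if "p \<in> (P - A) \<union> (R1 \<union> prod.swap ` R1) - Q" for p
      by (rule wt) (rule subsetD[OF S], use that in simp)
  qed
  also have "\<dots> \<le> sum wt (P - A) + sum wt (R1 \<union> prod.swap ` R1)"
    using fP fR wt subsetD[OF PV] by (intro sum_Un_le_real) (simp_all del: split_paired_All)
  also have "sum wt (R1 \<union> prod.swap ` R1) \<le> sum wt R1 + sum wt (prod.swap ` R1)"
    using fR wt subsetD[OF R1V(1)] by (intro sum_Un_le_real) (simp_all del: split_paired_All)
  also have "sum wt (prod.swap ` R1) = sum wt R1"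
    by (subst sum.reindex) (auto simp: wt_def inj_on_def intro!: sum.cong)
  also have "sum wt R1 = (\<Sum>b\<in>B. x b * (\<Sum>w\<in>nbr E b - L. x w))"
    unfolding R1_def wt_def sum_distrib_left using fin(2) nbr(1) by (subst sum.Sigma) auto
  also have "sum wt (P - A) = sum wt P - bil A x x"
    unfolding bil_def wt_def[symmetric] using fP AP by (rule sum_diff)
  finally have 3: "sum wt Q \<le> sum wt P - bil A x x + 2 * (\<Sum>b\<in>B. x b * (\<Sum>w\<in>nbr E b - L. x w))" by simp
  define cost where "cost = (\<Sum>b\<in>B. x b * (\<Sum>w\<in>nbr E b - L. x w))"
  have "r * ((\<sigma> / r)\<^sup>2) = \<sigma> / r * \<sigma>" using r by (simp add: power2_eq_square)
  \<comment> \<open>The term \<open>r * (\<Sum>u\<in>V1. (x u)\<^sup>2)\<close> cancels between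
    \<open>1\<close> and \<open>2\<close>, and \<open>3\<close> compares the remaining sums over
    \<open>Q\<close> and \<open>P\<close>.\<close>
  then have "\<sigma> / r * \<sigma> + bil A x x \<le> r * (x v)\<^sup>2 + 2 * cost"
    using 1 2 3 mult.left_commute[of r "x v" "x v"]
    unfolding cost_def[symmetric] distrib_left power2_eq_square by linarith
  then have "r * (\<sigma> / r * \<sigma> + bil A x x) \<le> r * (r * (x v)\<^sup>2 + 2 * cost)"
    using r by (intro mult_left_mono) auto
  moreover have "r * (\<sigma> / r * \<sigma> + bil A x x) = \<sigma>\<^sup>2 + r * bil A x x"
    using r by (simp add: algebra_simps power2_eq_square)
  moreover have "r * (r * (x v)\<^sup>2 + 2 * cost) = (r * x v)\<^sup>2 + r * (2 * cost)"
    by (simp add: algebra_simps power2_eq_square)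
  ultimately show ?thesis unfolding \<sigma>_def cost_def by simp
qed

context sparse_eigenvector
begin

text \<open>Extremality enters through \<open>rayleigh\<close>: no switch with \<open>q\<close>
  twins raises the form above \<open>r\<close>. A vertex outside \<open>L\<close> missing a
  neighbour in \<open>L\<close>, or two nonadjacent vertices of \<open>L\<close>, would make the
  gain in \<open>switch_inequality\<close> exceed the loss, which is kept below
  \<open>1 / 8\<close>.\<close>

lemma complete_core:
  fixes \<epsilon> :: real and q :: nat
  assumes L: "L \<subseteq> V" "card L = g" "\<And>l. l \<in> L \<Longrightarrow> 1 - \<epsilon> \<le> x l" "\<And>w. w \<in> V - L \<Longrightarrow> x w \<le> \<epsilon>"
    and VR: "real (card (V - {v \<in> V - L. L \<subseteq> nbr E v})) \<le> \<epsilon> * n"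
    and \<epsilon>: "0 < \<epsilon>" "(real t + real c + 1) * \<epsilon> \<le> 1 / 4" "16 * real q * (4 * real c + 1)\<^sup>2 * \<epsilon> \<le> 1"
    and n: "real q + 1 \<le> n / 2" and r_large: "real g + 1 \<le> r"
    and rayleigh: "\<And>B v y. B \<subseteq> V - L \<Longrightarrow> (\<And>b l. b \<in> B \<Longrightarrow> l \<in> L \<Longrightarrow> (b, l) \<in> E) \<Longrightarrow> card B = q \<Longrightarrow>
      v \<in> V - L \<Longrightarrow> v \<notin> B \<Longrightarrow> bil (switch V E L (insert v B)) y y \<le> r * (\<Sum>u\<in>V. (y u)\<^sup>2)"
    and l: "l \<in> L" "w \<in> V" "w \<noteq> l"
  shows "(l, w) \<in> E"
proof -
  define R where "R = {v \<in> V - L. L \<subseteq> nbr E v}"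
  define D where "D = 4 * c + 1"
  have fL: "finite L" by (rule finite_subset[OF L(1) V])
  have fR: "finite R" using V by (simp add: R_def)
  have "1 * \<epsilon> \<le> (real t + real c + 1) * \<epsilon>" using \<epsilon> by (intro mult_right_mono) auto
  then have \<epsilon>4: "\<epsilon> \<le> 1 / 4" using \<epsilon>(2) by linarith
  define \<sigma> where "\<sigma> = (\<Sum>l\<in>L. x l)"
  have "\<sigma> \<le> real (card L) * 1"
    unfolding \<sigma>_def using L(1) by (intro sum_const_bound_real x(2)) auto
  then have \<sigma>_le: "\<sigma> \<le> real g" by (simp add: L(2))
  \<comment> \<open>Twins of bounded degree keep the loss small; with \<open>D = 4 * c + 1\<close>
    at most a quarter of the vertices have too large a degree.\<close>
  define T where "T = {u \<in> V. D < card (nbr E u)}"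
  have fT: "finite T" using V by (simp add: T_def)
  have "D * card T \<le> (\<Sum>u\<in>T. card (nbr E u))"
    using sum_mono[of T "\<lambda>_. D" "\<lambda>u. card (nbr E u)"] by (simp add: T_def mult.commute)
  also have "\<dots> \<le> (\<Sum>u\<in>V. card (nbr E u))" using V by (intro sum_mono2) (auto simp: T_def)
  also have "\<dots> = (\<Sum>u\<in>V. card (nbr E u \<inter> V))" using nbr_V by (simp add: Int_absorb2)
  also have "\<dots> \<le> c * card V" by (rule sum_degree_le) simp
  finally have cT: "c * (4 * card T) + card T \<le> c * card V" by (simp add: D_def algebra_simps)
  have T4: "4 * card T \<le> card V"
  proof (cases "c = 0")
    case False
    have "c * (4 * card T) \<le> c * card V" using cT by linarith
    moreover have "0 < c" using False by simp
    ultimately show ?thesis by (simp only: nat_mult_le_cancel1)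
  qed (use cT in simp)
  \<comment> \<open>At most \<open>n / 4\<close> vertices lie outside \<open>R\<close>, at most
    \<open>n / 4\<close> have large degree, and \<open>v\<close> is one more, so at least
    \<open>n / 2 - 1 \<ge> q\<close> vertices remain.\<close>
  have choose_B: "\<exists>B. B \<subseteq> R - T - {v} \<and> card B = q" for v
  proof -
    have "card (V - (R - T - {v})) \<le> card (V - R) + (card T + 1)"
    proof -
      have "V - (R - T - {v}) \<subseteq> (V - R) \<union> (T \<union> {v})" by blast
      then have "card (V - (R - T - {v})) \<le> card ((V - R) \<union> (T \<union> {v}))"
        using V fT by (intro card_mono) auto
      also have "\<dots> \<le> card (V - R) + card (T \<union> {v})" by (rule card_Un_le)
      also have "card (T \<union> {v}) \<le> card T + card {v}" by (rule card_Un_le)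
      finally show ?thesis by simp
    qed
    moreover have "card (V - (R - T - {v})) = card V - card (R - T - {v})"
      using fR by (intro card_Diff_subset) (auto simp: R_def)
    ultimately have "card V \<le> card (R - T - {v}) + card (V - R) + card T + 1" by linarith
    then have "n \<le> real (card (R - T - {v})) + real (card (V - R)) + real (card T) + 1" by linarith
    moreover have "real (card (V - R)) \<le> 1 / 4 * n"
      using VR mult_right_mono[OF \<epsilon>4, of n] unfolding R_def by simp
    moreover have "4 * real (card T) \<le> n" using T4 by linarith
    ultimately have "real q \<le> real (card (R - T - {v}))" using n by linarith
    then have "q \<le> card (R - T - {v})" by simp
    then obtain B where "B \<subseteq> R - T - {v}" "card B = q" "finite B" by (rule obtain_subset_with_card_n)
    then show ?thesis by blast
  qed
  have key: "\<sigma>\<^sup>2 + r * bil A x x \<le> (r * x v)\<^sup>2 + 1 / 8"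
    if v: "v \<in> V - L" and A: "A \<subseteq> L \<times> L - E" "irrefl A" for v A
  proof -
    obtain B where B: "B \<subseteq> R - T - {v}" "card B = q" using choose_B[of v] by metis
    have BR: "b \<in> V - L \<and> L \<subseteq> nbr E b" if "b \<in> B" for b
      using subsetD[OF B(1) that] by (simp add: R_def)
    then have BV: "B \<subseteq> V - L" by (intro subsetI) simp
    have BL: "(b, l) \<in> E" if "b \<in> B" "l \<in> L" for b l
      using BR[OF that(1)] that(2) by (auto simp: subset_iff)
    have vB: "v \<notin> B" using B(1) by auto
    have "\<sigma>\<^sup>2 + r * bil A x x \<le> (r * x v)\<^sup>2 + r * (2 * (\<Sum>b\<in>B. x b * (\<Sum>w\<in>nbr E b - L. x w)))"
      unfolding \<sigma>_def
    proof (rule switch_inequality[OF V E L(1) BV v vB _ _ r(2) _ A])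
      show "bil (switch V E L (insert v B)) y y \<le> r * (\<Sum>u\<in>V. (y u)\<^sup>2)" for y
        by (rule rayleigh[OF BV _ B(2) v vB]) (rule BL)
    qed (fact x(1) eigen)+
    \<comment> \<open>The eigenvalue equation at \<open>b\<close> absorbs the factor
      \<open>r\<close>, since \<open>r * x b\<close> is at most the degree of \<open>b\<close>; the
      loss thus does not grow with \<open>n\<close>.\<close>
    also have "r * (2 * (\<Sum>b\<in>B. x b * (\<Sum>w\<in>nbr E b - L. x w)))
      = 2 * (\<Sum>b\<in>B. (r * x b) * (\<Sum>w\<in>nbr E b - L. x w))"
      by (simp add: sum_distrib_left algebra_simps)
    also have "(\<Sum>b\<in>B. (r * x b) * (\<Sum>w\<in>nbr E b - L. x w)) \<le> real (card B) * (real D * (real D * \<epsilon>))"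
    proof (rule sum_const_bound_real)
      fix b assume b: "b \<in> B"
      then have bV: "b \<in> V" "card (nbr E b) \<le> D" using B by (auto simp: R_def T_def)
      have "r * x b \<le> real (card (nbr E b))"
        unfolding eigen[OF bV(1), symmetric] by (rule sum_nbr_le_card[OF subset_refl])
      then have 1: "r * x b \<le> real D" using bV(2) by linarith
      have "(\<Sum>w\<in>nbr E b - L. x w) \<le> real (card (nbr E b - L)) * \<epsilon>"
        using E(1) by (intro sum_const_bound_real L(4)) auto
      also have "card (nbr E b - L) \<le> card (nbr E b)" using finite_nbr by (intro card_mono) auto
      then have "card (nbr E b - L) \<le> D" using bV(2) by simp
      then have "real (card (nbr E b - L)) * \<epsilon> \<le> real D * \<epsilon>" using \<epsilon> by (intro mult_right_mono) auto
      finally have 2: "(\<Sum>w\<in>nbr E b - L. x w) \<le> real D * \<epsilon>" .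
      have "0 \<le> (\<Sum>w\<in>nbr E b - L. x w)" by (intro sum_nonneg) (auto intro: x_nbr)
      then show "(r * x b) * (\<Sum>w\<in>nbr E b - L. x w) \<le> real D * (real D * \<epsilon>)"
        using 1 2 by (intro mult_mono) auto
    qed
    also have "2 * (real (card B) * (real D * (real D * \<epsilon>))) = (16 * real q * (4 * real c + 1)\<^sup>2 * \<epsilon>) / 8"
      by (simp add: B(2) D_def power2_eq_square add.commute)
    also have "\<dots> \<le> 1 / 8" using \<epsilon>(3) by (intro divide_right_mono) auto
    finally show ?thesis by simp
  qed
  have outer: "(\<Sum>u\<in>nbr E v - L. x u) \<le> real m * \<epsilon>" if "card (nbr E v - L) \<le> m" for v m
  proof -
    have "(\<Sum>u\<in>nbr E v - L. x u) \<le> real (card (nbr E v - L)) * \<epsilon>"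
      using E(1) by (intro sum_const_bound_real L(4)) auto
    also have "\<dots> \<le> real m * \<epsilon>" using that \<epsilon> by (intro mult_right_mono) auto
    finally show ?thesis .
  qed
  have rxv: "r * x v = (\<Sum>u\<in>nbr E v \<inter> L. x u) + (\<Sum>u\<in>nbr E v - L. x u)" if "v \<in> V" for v
    unfolding eigen[OF that, symmetric] using finite_nbr by (rule sum.Int_Diff)
  \<comment> \<open>Sparseness yields \<open>v\<close> in \<open>Z\<close> with at most
    \<open>c\<close> neighbours in \<open>Z\<close>, hence at most \<open>t + c\<close> outside
    \<open>L\<close>. Missing a vertex of \<open>L\<close> costs it at least
    \<open>1 - \<epsilon>\<close>, so \<open>r * x v \<le> \<sigma> - 3 / 4\<close>, which is too
    little for \<open>key\<close>.\<close>
  have full: "V - L \<subseteq> R"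
  proof (rule ccontr)
    define Z where "Z = V - L - R"
    assume "\<not> V - L \<subseteq> R"
    then have "Z \<noteq> {}" by (auto simp: Z_def)
    moreover have "finite Z" "Z \<subseteq> V" using V by (auto simp: Z_def)
    ultimately obtain v where v: "v \<in> Z" "card (nbr E v \<inter> Z) \<le> c"
      using low_degree_vertex[of Z E c] sparse[of Z] by blast
    have vV: "v \<in> V" "v \<in> V - L" using v by (auto simp: Z_def)
    have "\<not> L \<subseteq> nbr E v" using v(1) unfolding Z_def R_def by blast
    then obtain m where m: "m \<in> L" "m \<notin> nbr E v" by blast
    have "nbr E v - L = (nbr E v \<inter> R) \<union> (nbr E v \<inter> Z)" using E(1) by (auto simp: Z_def R_def)
    then have "card (nbr E v - L) \<le> card (nbr E v \<inter> R) + card (nbr E v \<inter> Z)" by (metis card_Un_le)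
    also have "\<dots> \<le> t + c" using card_common_nbr[OF L(1,2) vV(2)] v(2) unfolding R_def by linarith
    finally have "(\<Sum>u\<in>nbr E v - L. x u) \<le> real (t + c) * \<epsilon>" by (rule outer)
    moreover have "(\<Sum>u\<in>nbr E v \<inter> L. x u) \<le> (\<Sum>u\<in>L - {m}. x u)"
      using fL m x(1) L(1) by (intro sum_mono2) auto
    moreover have "(\<Sum>u\<in>L - {m}. x u) = \<sigma> - x m" unfolding \<sigma>_def using fL m by (simp add: sum_diff1)
    moreover have "(real t + real c + 1) * \<epsilon> = real (t + c) * \<epsilon> + \<epsilon>" by (simp add: algebra_simps)
    ultimately have up: "r * x v \<le> \<sigma> - 3 / 4" using rxv[OF vV(1)] L(3)[OF m(1)] \<epsilon>(2) by linarith
    have pos: "0 \<le> r * x v" using r x(1) vV by simp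
    have "\<sigma>\<^sup>2 + r * bil {} x x \<le> (r * x v)\<^sup>2 + 1 / 8"
      by (rule key[OF vV(2)]) (auto simp: irrefl_def)
    also have "(r * x v)\<^sup>2 \<le> (\<sigma> - 3 / 4)\<^sup>2" using up pos by (rule power_mono)
    finally have "\<sigma>\<^sup>2 \<le> (\<sigma> - 3 / 4)\<^sup>2 + 1 / 8" by (simp add: bil_def)
    then show False using up pos by (simp add: power2_eq_square algebra_simps)
  qed
  show ?thesis
  proof (cases "w \<in> L")
    case False
    then have "w \<in> R" using full l(2) by blast
    then have "L \<subseteq> nbr E w" by (simp add: R_def)
    then have "(w, l) \<in> E" using l(1) by (auto simp: subset_iff)
    then show ?thesis using E(2) by (auto dest: symD)
  next
    case True
    show ?thesis
    proof (rule ccontr)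
      assume nE: "(l, w) \<notin> E"
      \<comment> \<open>If \<open>V = L\<close>, there are no common neighbours outside
        \<open>L\<close>, and \<open>VR\<close> would bound \<open>n\<close> by
        \<open>n / 4\<close>.\<close>
      have "card L < card V"
      proof (rule ccontr)
        assume "\<not> ?thesis"
        then have "V = L" using L(1) V by (metis card_seteq not_less)
        then have "real (card V) \<le> \<epsilon> * n" using VR by simp
        also have "\<dots> \<le> 1 / 4 * n" using \<epsilon>4 by (intro mult_right_mono) auto
        finally show False using n by simp
      qed
      then have "\<not> V \<subseteq> L" using card_mono[OF fL, of V] by auto
      then obtain v where v: "v \<in> V - L" by blast
      have vV: "v \<in> V" using v by simp
      have "R \<inter> L = {}" by (auto simp: R_def)
      then have "nbr E v - L = nbr E v \<inter> R" using full nbr_V[of v] by blast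
      then have "card (nbr E v - L) \<le> t" using card_common_nbr[OF L(1,2) v] by (simp add: R_def)
      then have "(\<Sum>u\<in>nbr E v - L. x u) \<le> real t * \<epsilon>" by (rule outer)
      also have "\<dots> \<le> (real t + real c + 1) * \<epsilon>" using \<epsilon> by (intro mult_right_mono) auto
      finally have "(\<Sum>u\<in>nbr E v - L. x u) \<le> 1 / 4" using \<epsilon>(2) by linarith
      moreover have "(\<Sum>u\<in>nbr E v \<inter> L. x u) \<le> \<sigma>"
        unfolding \<sigma>_def using fL x(1) L(1) by (intro sum_mono2) auto
      ultimately have up: "r * x v \<le> \<sigma> + 1 / 4" using rxv[OF vV] by linarith
      have pos: "0 \<le> r * x v" using r x(1) vV by simp
      \<comment> \<open>A single arc suffices for \<open>A\<close>: it contributes at least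
        \<open>9 / 16 * r\<close>, more than the slack \<open>g / 2 + 3 / 16\<close> because
        \<open>g + 1 \<le> r\<close>.\<close>
      have "\<sigma>\<^sup>2 + r * bil {(l, w)} x x \<le> (r * x v)\<^sup>2 + 1 / 8"
        using l True nE by (intro key[OF v]) (auto simp: irrefl_def)
      also have "(r * x v)\<^sup>2 \<le> (\<sigma> + 1 / 4)\<^sup>2" using up pos by (rule power_mono)
      also have "(\<sigma> + 1 / 4)\<^sup>2 = \<sigma>\<^sup>2 + \<sigma> / 2 + 1 / 16" by (simp add: power2_eq_square algebra_simps)
      finally have "r * (x l * x w) \<le> real g / 2 + 3 / 16" using \<sigma>_le by (simp add: bil_def)
      moreover have "3 / 4 * (3 / 4) \<le> x l * x w"
        using L(3)[OF l(1)] L(3)[OF True] \<epsilon>4 by (intro mult_mono) auto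
      then have "r * (3 / 4 * (3 / 4)) \<le> r * (x l * x w)" using r by (intro mult_left_mono) auto
      ultimately show False using r_large by simp
    qed
  qed
qed

end

section \<open>Extremal graphs contain a spanning book\<close>

lemma finite_independent_sets: "pair_graph H \<Longrightarrow> finite {S. independent_set H S}"
  by (rule finite_subset[of _ "Pow (pverts H)"]) (auto simp: independent_set_def pair_graph_iff)

text \<open>The complement of a vertex cover is independent. Together with
  \<open>minimum_vertex_cover\<close> this identifies the vertex cover number as
  \<open>graph_gamma H + 1\<close>.\<close>

lemma graph_gamma_less_card_cover:
  assumes "pair_graph H" "vertex_cover C (parcs H)"
  shows "graph_gamma H < int (card C)"
proof -
  have "independent_set H (pverts H - C)"
    using assms(2) by (auto simp: independent_set_def vertex_cover_def)
  then have "card (pverts H - C) \<le> independence_number H"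
    unfolding independence_number_def using finite_independent_sets[OF assms(1)]
    by (intro Max_ge) auto
  moreover have "card (pverts H) - card C \<le> card (pverts H - C)"
    using assms(2) by (intro diff_card_le_card_Diff) (simp add: vertex_cover_def)
  ultimately show ?thesis by (simp add: graph_gamma_def)
qed

lemma minimum_vertex_cover:
  assumes "pair_graph H"
  obtains C where "vertex_cover C (parcs H)" "C \<subseteq> pverts H" "int (card C) = graph_gamma H + 1"
proof -
  interpret pair_graph H by fact
  have "independent_set H {}" by (simp add: independent_set_def)
  then have "independence_number H \<in> card ` {S. independent_set H S}"
    unfolding independence_number_def using finite_independent_sets[OF assms]
    by (intro Max_in) auto
  then obtain S where S: "independent_set H S" "card S = independence_number H" by auto
  have SV: "S \<subseteq> pverts H" using S(1) by (simp add: independent_set_def)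
  then have "finite S" using pair_finite_verts by (rule finite_subset)
  then have "card (pverts H - S) = card (pverts H) - card S" "card S \<le> card (pverts H)"
    using SV pair_finite_verts by (simp_all add: card_Diff_subset card_mono)
  moreover have "vertex_cover (pverts H - S) (parcs H)"
    using S(1) pair_finite_verts in_arcsD1 in_arcsD2
    unfolding independent_set_def vertex_cover_def by blast
  ultimately show thesis using that[of "pverts H - S"] S(2) by (auto simp: graph_gamma_def)
qed

section \<open>The generalized book as competitor and as spanning subgraph\<close>

lemma generalized_book_simps [simp]:
  "pverts (generalized_book s t) = {..<s + t}"
  "(u, v) \<in> parcs (generalized_book s t) \<longleftrightarrow> u < s + t \<and> v < s + t \<and> u \<noteq> v \<and> (u < s \<or> v < s)"
  by (simp_all add: generalized_book_def)

lemma pair_graph_generalized_book: "pair_graph (generalized_book s t)"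
  unfolding pair_graph_iff by (auto simp: sym_def irrefl_def)

text \<open>The test vector is a Perron vector of the complete bipartite graph with parts of sizes
  \<open>s\<close> and \<open>t\<close>; the edges inside the clique only add to the row
  sums.\<close>

lemma spectral_radius_generalized_book:
  assumes "0 < s" "0 < t"
  shows "sqrt (real s * real t) \<le> graph_spectral_radius (generalized_book s t)"
proof -
  let ?B = "generalized_book s t"
  let ?V = "{..<s + t}" and ?E = "parcs ?B" and ?r = "graph_spectral_radius ?B"
  have E: "?E \<subseteq> ?V \<times> ?V" by auto
  define y where "y v = (if v < s then sqrt (real t) else sqrt (real s))" for v
  have y_pos: "0 < y v" for v using assms by (simp add: y_def)
  have row: "sqrt (real s * real t) * y v \<le> (\<Sum>w\<in>nbr ?E v. y w)" if v: "v < s + t" for v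
  proof -
    have fin: "finite (nbr ?E v)" by (rule finite_subset[of _ ?V]) auto
    show ?thesis
    proof (cases "v < s")
      case True
      have "sqrt (real s * real t) * y v = real t * sqrt (real s)"
        using True by (simp add: y_def real_sqrt_mult)
      also have "\<dots> = (\<Sum>w\<in>{s..<s + t}. y w)" by (simp add: y_def)
      also have "\<dots> \<le> (\<Sum>w\<in>nbr ?E v. y w)"
        using True fin y_pos by (intro sum_mono2) (auto intro: less_imp_le)
      finally show ?thesis .
    next
      case False
      have "sqrt (real s * real t) * y v = real s * sqrt (real t)"
        using False by (simp add: y_def real_sqrt_mult)
      also have "\<dots> = (\<Sum>w\<in>{..<s}. y w)" by (simp add: y_def)
      also have "\<dots> \<le> (\<Sum>w\<in>nbr ?E v. y w)"
        using False v fin y_pos by (intro sum_mono2) (auto intro: less_imp_le)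
      finally show ?thesis .
    qed
  qed
  have "sqrt (real s * real t) * (\<Sum>v\<in>?V. (y v)\<^sup>2) = (\<Sum>v\<in>?V. y v * (sqrt (real s * real t) * y v))"
    by (simp add: sum_distrib_left power2_eq_square algebra_simps)
  also have "\<dots> \<le> (\<Sum>v\<in>?V. y v * (\<Sum>w\<in>nbr ?E v. y w))"
    using row y_pos by (intro sum_mono mult_left_mono) (auto intro: less_imp_le)
  also have "\<dots> = bil ?E y y" by (simp add: bil_eq_sum_nbr[OF _ E])
  also have "\<dots> \<le> ?r * (\<Sum>v\<in>?V. (y v)\<^sup>2)"
    using spectral_radius_eigenvector[OF pair_graph_generalized_book[of s t]] assms
    by (metis generalized_book_simps(1) add_gr_0 empty_iff lessThan_iff)
  finally have "sqrt (real s * real t) * (\<Sum>v\<in>?V. (y v)\<^sup>2) \<le> ?r * (\<Sum>v\<in>?V. (y v)\<^sup>2)" .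
  moreover have "0 < (\<Sum>v\<in>?V. (y v)\<^sup>2)"
    using assms by (intro sum_pos zero_less_power y_pos) auto
  ultimately show ?thesis by simp
qed

text \<open>The clique of the book is a vertex cover of size \<open>s\<close>, and a contained
  subdivision would give \<open>H\<close> a cover of at most this size.\<close>

lemma subdivision_free_generalized_book:
  assumes "\<And>H. H \<in> \<H> \<Longrightarrow> pair_graph H" "\<And>H. H \<in> \<H> \<Longrightarrow> int s \<le> graph_gamma H"
  shows "subdivision_free \<H> (generalized_book s t)"
  unfolding subdivision_free_def
proof
  fix H assume H: "H \<in> \<H>"
  show "\<not> contains_subdivision (generalized_book s t) H"
  proof
    assume "contains_subdivision (generalized_book s t) H"
    then have "topological_minor H {..<s + t} (parcs (generalized_book s t))"
      using contains_subdivision_iff[OF pair_graph_generalized_book assms(1)[OF H]] by simp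
    moreover have "vertex_cover {..<s} (parcs (generalized_book s t))"
      by (auto simp: vertex_cover_def)
    ultimately obtain C where "card C \<le> s" "vertex_cover C (parcs H)"
      using vertex_cover_topological_minor[OF _ assms(1)[OF H]] by force
    then show False using graph_gamma_less_card_cover[OF assms(1)[OF H]] assms(2)[OF H] by force
  qed
qed

lemma spanning_generalized_book:
  assumes G: "pair_graph G" and L: "L \<subseteq> pverts G" "card L = g"
    and full: "\<And>l w. l \<in> L \<Longrightarrow> w \<in> pverts G \<Longrightarrow> w \<noteq> l \<Longrightarrow> (l, w) \<in> parcs G"
  shows "\<exists>B :: nat pair_pre_digraph. spanning (with_proj B) (with_proj G) \<and>
    digraph_iso (with_proj B) (with_proj (generalized_book g (card (pverts G) - g)))"
proof -
  interpret G: pair_graph G by fact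
  let ?V = "pverts G" and ?n = "card (pverts G)"
  have fL: "finite L" by (rule finite_subset[OF L(1) G.pair_finite_verts])
  have gn: "g \<le> ?n" using L card_mono[OF G.pair_finite_verts L(1)] by simp
  obtain h1 where h1: "bij_betw h1 L {..<g}"
    using finite_same_card_bij[OF fL, of "{..<g}"] L by auto
  have "card (?V - L) = card {g..<?n}" using L fL by (simp add: card_Diff_subset)
  then obtain h2 where h2: "bij_betw h2 (?V - L) {g..<?n}"
    using finite_same_card_bij[of "?V - L" "{g..<?n}"] G.pair_finite_verts by auto
  \<comment> \<open>\<open>h\<close> sends \<open>L\<close> onto the vertices below
    \<open>g\<close>, which form the clique of the book, and all other vertices onto its independent
    part.\<close>
  define h where "h v = (if v \<in> L then h1 v else h2 v)" for v
  have hL: "bij_betw h L {..<g}" using h1 by (subst bij_betw_cong[of _ _ h1]) (auto simp: h_def)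
  have hV: "bij_betw h (?V - L) {g..<?n}" using h2 by (subst bij_betw_cong[of _ _ h2]) (auto simp: h_def)
  have "bij_betw h (L \<union> (?V - L)) ({..<g} \<union> {g..<?n})"
    using hL hV by (rule bij_betw_combine) auto
  moreover have "L \<union> (?V - L) = ?V" "{..<g} \<union> {g..<?n} = {..<?n}" using L gn by auto
  ultimately have h: "bij_betw h ?V {..<?n}" by simp
  have h_less: "h v < g \<longleftrightarrow> v \<in> L" if "v \<in> ?V" for v
  proof (cases "v \<in> L")
    case True
    then show ?thesis using hL by (auto simp: bij_betw_def)
  next
    case False
    then have "h v \<in> {g..<?n}" using hV that by (auto simp: bij_betw_def)
    then show ?thesis using False by simp
  qed
  define B where "B = \<lparr>pverts = ?V, parcs = {(u, w). u \<in> ?V \<and> w \<in> ?V \<and> u \<noteq> w \<and> (u \<in> L \<or> w \<in> L)}\<rparr>"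
  have BG: "parcs B \<subseteq> parcs G"
    using full G.arcs_symmetric by (auto simp: B_def)
  have wfB: "wf_digraph (with_proj B)" by unfold_locales (auto simp: B_def)
  have "spanning (with_proj B) (with_proj G)"
    unfolding spanning_def subgraph_def using BG wfB G.wf_digraph_axioms
    by (auto simp: B_def intro: compatibleI_with_proj)
  moreover have "digraph_iso (with_proj B) (with_proj (generalized_book g (?n - g)))"
    unfolding digraph_iso_def
  proof (intro exI conjI)
    define f where "f = \<lparr>iso_verts = h, iso_arcs = map_prod h h, iso_head = snd, iso_tail = fst\<rparr>"
    have inj: "inj_on h ?V" using h by (simp add: bij_betw_def)
    have "inj_on (map_prod h h) (parcs B)"
      by (rule inj_on_subset[OF map_prod_inj_on[OF inj inj]]) (auto simp: B_def)
    then show "pre_digraph.digraph_isomorphism (with_proj B) f"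
      using inj wfB by (auto simp: pre_digraph.digraph_isomorphism_def f_def B_def)
    have "map_prod h h ` parcs B = parcs (generalized_book g (?n - g))"
    proof (intro subset_antisym subsetI)
      fix p assume "p \<in> map_prod h h ` parcs B"
      then obtain u w where uw: "p = (h u, h w)" "u \<in> ?V" "w \<in> ?V" "u \<noteq> w" "u \<in> L \<or> w \<in> L"
        by (auto simp: B_def)
      then have "h u < ?n" "h w < ?n" "h u \<noteq> h w"
        using h inj by (auto simp: bij_betw_def inj_on_def)
      then show "p \<in> parcs (generalized_book g (?n - g))" using uw h_less gn by auto
    next
      fix p assume p: "p \<in> parcs (generalized_book g (?n - g))"
      obtain a b where ab: "p = (a, b)" by (cases p)
      have ab': "a < ?n" "b < ?n" "a \<noteq> b" "a < g \<or> b < g" using p gn by (auto simp: ab)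
      then have "a \<in> h ` ?V" "b \<in> h ` ?V" using h by (auto simp: bij_betw_def)
      then obtain u w where uw: "u \<in> ?V" "a = h u" "w \<in> ?V" "b = h w" by auto
      then have "(u, w) \<in> parcs B" using ab' h_less by (auto simp: B_def)
      then show "p \<in> map_prod h h ` parcs B" using uw ab by (auto simp: image_iff intro!: bexI[of _ "(u, w)"])
    qed
    then show "with_proj (generalized_book g (?n - g)) = app_iso f (with_proj B)"
      using h gn by (simp add: app_iso_def f_def with_proj_def B_def bij_betw_def)
  qed
  ultimately show ?thesis by blast
qed

text \<open>The constants are fixed before the host graph; this uniformity is what allows one
  threshold \<open>n0\<close> for all extremal graphs.\<close>

lemma sparse_of_free:
  assumes H: "pair_graph H" "vertex_cover C (parcs H)" "C \<subseteq> pverts H" "card C = Suc g"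
  obtains c K t :: nat where "\<And>V E. finite V \<Longrightarrow> sym E \<Longrightarrow> irrefl E \<Longrightarrow> \<not> topological_minor H V E \<Longrightarrow>
    (\<forall>A\<subseteq>V. card (E \<inter> A \<times> A) \<le> c * card A) \<and>
    (\<forall>L\<subseteq>V. card {w \<in> V - L. g < card (nbr E w \<inter> L)} \<le> K * card L) \<and>
    (\<forall>A T. A \<subseteq> V \<longrightarrow> T \<subseteq> V \<longrightarrow> A \<inter> T = {} \<longrightarrow> card A = Suc g \<longrightarrow>
      (\<forall>a\<in>A. \<forall>b\<in>T. (a, b) \<in> E) \<longrightarrow> card T < t)"
proof -
  obtain c where c: "\<And>V E. finite V \<Longrightarrow> V \<noteq> {} \<Longrightarrow> sym E \<Longrightarrow> irrefl E \<Longrightarrow>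
      c * card V \<le> card (E \<inter> V \<times> V) \<Longrightarrow> topological_minor H V E"
    using topological_minor_of_dense[OF H(1)] by blast
  define t where "t = card (pverts H) + card C * card C"
  show thesis
  proof (rule that[of c "c + t * 2 ^ c" t], intro conjI allI impI)
    fix V :: "nat set" and E :: "(nat \<times> nat) set"
    assume V: "finite V" and E: "sym E" "irrefl E" and free: "\<not> topological_minor H V E"
    {
      fix A assume A: "A \<subseteq> V"
      show "card (E \<inter> A \<times> A) \<le> c * card A"
      proof (rule ccontr)
        assume neg: "\<not> ?thesis"
        then have "A \<noteq> {}" by auto
        with neg have "topological_minor H A E"
          using finite_subset[OF A V] E by (intro c) auto
        then show False using free topological_minor_mono[OF _ A subset_refl] by blast
      qed
    }
    {
      fix L assume L: "L \<subseteq> V"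
      show "card {w \<in> V - L. g < card (nbr E w \<inter> L)} \<le> (c + t * 2 ^ c) * card L"
        unfolding t_def
      proof (rule card_vertices_with_many_neighbours[OF H(1-3) _ c V L _ E(1) _ free])
        show "C \<noteq> {}" using H(4) by auto
      qed (auto simp: H(4))
    }
    {
      fix A T assume A: "A \<subseteq> V" "T \<subseteq> V" "A \<inter> T = {}" "card A = Suc g" "\<forall>a\<in>A. \<forall>b\<in>T. (a, b) \<in> E"
      show "card T < t"
      proof (rule ccontr)
        assume "\<not> ?thesis"
        then have "topological_minor H V E"
          using A V H(4) by (intro topological_minor_complete_bipartite[OF H(1) E(1) H(2,3), of A T])
            (auto simp: t_def intro: finite_subset)
        then show False using free by contradiction
      qed
    }
  qed
qed

text \<open>The order of choice is \<open>\<epsilon>\<close>, then \<open>\<theta>\<close> from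
  \<open>\<epsilon>\<close>, then \<open>e\<close> from \<open>\<theta>\<close>, and
  \<open>n0\<close> last.\<close>

lemma constants_exist:
  fixes c K t g q :: nat
  assumes "1 \<le> g"
  obtains \<epsilon> \<theta> e :: real and n0 :: nat where
    "0 < \<epsilon>" "(real t + real c + 1) * \<epsilon> \<le> 1 / 4" "16 * real q * (4 * real c + 1)\<^sup>2 * \<epsilon> \<le> 1"
    "8 * real g * (real g + real t + real c) * \<theta> \<le> \<epsilon>" "\<theta> < 1" "0 < e" "e * (real c + 1) \<le> \<theta> / 4"
    "\<And>n r. n0 \<le> n \<Longrightarrow> 0 \<le> r \<Longrightarrow> real g * (real n - real g) \<le> r\<^sup>2 \<Longrightarrow>
      2 * real g \<le> real n \<and> (real g)\<^sup>2 \<le> \<theta> / 4 * real n \<and> real q + 1 \<le> real n / 2 \<and>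
      real g + 1 \<le> r \<and> 2 * (real g + real t) \<le> \<epsilon> * r \<and>
      (1 + real K) * (real c + 1) * real c \<le> e\<^sup>2 * r"
proof -
  define N where "N = 4 * (real t + real c + 1) + 16 * real q * (4 * real c + 1)\<^sup>2"
  define \<epsilon> where "\<epsilon> = 1 / N"
  define a where "a = 8 * real g * (real g + real t + real c)"
  define \<theta> where "\<theta> = \<epsilon> / a"
  define e where "e = \<theta> / 4 / (real c + 1)"
  have q0: "0 \<le> real q * (4 * real c + 1)\<^sup>2" by simp
  have N4: "4 \<le> N" "4 * (real t + real c + 1) \<le> N" "16 * real q * (4 * real c + 1)\<^sup>2 \<le> N"
    using q0 by (simp_all add: N_def)
  have \<epsilon>: "0 < \<epsilon>" "\<epsilon> < 1" using N4 by (auto simp: \<epsilon>_def divide_less_eq)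
  have "1 * 1 \<le> real g * (real g + real t + real c)"
    using assms by (intro mult_mono) auto
  then have a: "8 \<le> a" by (simp add: a_def)
  have \<theta>: "0 < \<theta>" "\<theta> < 1" "a * \<theta> = \<epsilon>"
    using \<epsilon> a by (auto simp: \<theta>_def divide_less_eq)
  have c1: "0 < real c + 1" by simp
  have e: "0 < e" "e * (real c + 1) = \<theta> / 4"
    unfolding e_def using \<theta>(1) c1 nonzero_eq_divide_eq[of "real c + 1" "\<theta> / 4 / (real c + 1)" "\<theta> / 4"]
    by simp_all
  define M1 where "M1 = (1 + real K) * (real c + 1) * real c / e\<^sup>2"
  define M2 where "M2 = 2 * (real g + real t) / \<epsilon>"
  \<comment> \<open>\<open>M\<close> dominates all lower bounds required of \<open>r\<close>; they
    hold for large \<open>n\<close> because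
    \<open>r\<^sup>2 \<ge> g * (n - g) \<ge> n / 2 \<ge> M\<^sup>2\<close>.\<close>
  define M where "M = M1 + M2 + real g + 1"
  have M12: "0 \<le> M1" "0 \<le> M2" using e \<epsilon> by (auto simp: M1_def M2_def)
  define n0 where "n0 = nat \<lceil>2 * real g + 4 * (real g)\<^sup>2 / \<theta> + 2 * real q + 2 + 2 * M\<^sup>2\<rceil>"
  show thesis
  proof (rule that[of \<epsilon> \<theta> e n0])
    show "0 < \<epsilon>" "\<theta> < 1" "0 < e" by fact+
    show "(real t + real c + 1) * \<epsilon> \<le> 1 / 4" "16 * real q * (4 * real c + 1)\<^sup>2 * \<epsilon> \<le> 1"
      using N4 by (simp_all add: \<epsilon>_def divide_le_eq)
    show "8 * real g * (real g + real t + real c) * \<theta> \<le> \<epsilon>" using \<theta>(3) by (simp add: a_def)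
    show "e * (real c + 1) \<le> \<theta> / 4" using e(2) by simp
    fix n :: nat and r :: real
    assume n: "n0 \<le> n" and r: "0 \<le> r" "real g * (real n - real g) \<le> r\<^sup>2"
    have "2 * real g + 4 * (real g)\<^sup>2 / \<theta> + 2 * real q + 2 + 2 * M\<^sup>2 \<le> real n0"
      unfolding n0_def by (rule real_nat_ceiling_ge)
    also have "\<dots> \<le> real n" using n by simp
    finally have n1: "2 * real g + 4 * (real g)\<^sup>2 / \<theta> + 2 * real q + 2 + 2 * M\<^sup>2 \<le> real n" .
    have nn: "0 \<le> 4 * (real g)\<^sup>2 / \<theta>" "0 \<le> M\<^sup>2" using \<theta> by simp_all
    have n2: "2 * real g \<le> real n" "4 * (real g)\<^sup>2 / \<theta> \<le> real n" "real q + 1 \<le> real n / 2" "M\<^sup>2 \<le> real n / 2"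
      using n1 nn by linarith+
    note n2(4)
    also have "real n / 2 \<le> 1 * (real n - real g)" using n2(1) by simp
    also have "\<dots> \<le> real g * (real n - real g)" using assms n2 by (intro mult_right_mono) auto
    also note r(2)
    finally have "M\<^sup>2 \<le> r\<^sup>2" .
    then have "M \<le> r" using r(1) by (rule power2_le_imp_le)
    then have r3: "M1 \<le> r" "M2 \<le> r" "real g + 1 \<le> r" using M12 unfolding M_def by linarith+
    have "(real g)\<^sup>2 \<le> \<theta> / 4 * real n" using n2(2) \<theta>(1) by (simp add: divide_le_eq algebra_simps)
    moreover have "2 * (real g + real t) \<le> \<epsilon> * r"
      using r3(2) \<epsilon>(1) by (simp add: M2_def divide_le_eq algebra_simps)
    moreover have "(1 + real K) * (real c + 1) * real c \<le> e\<^sup>2 * r"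
      using r3(1) e(1) by (simp add: M1_def divide_le_eq mult.commute)
    ultimately show "2 * real g \<le> real n \<and> (real g)\<^sup>2 \<le> \<theta> / 4 * real n \<and> real q + 1 \<le> real n / 2 \<and>
      real g + 1 \<le> r \<and> 2 * (real g + real t) \<le> \<epsilon> * r \<and>
      (1 + real K) * (real c + 1) * real c \<le> e\<^sup>2 * r"
      using n2 r3 by simp
  qed
qed

theorem theorem1p3:
  fixes \<H> :: "nat pair_pre_digraph set"
  assumes graphs: "\<And>H. H \<in> \<H> \<Longrightarrow> pair_graph H"
    and fin: "finite \<H>"
    and nonempty: "\<H> \<noteq> {}"
    and gamma: "family_gamma \<H> \<ge> 1"
  shows "\<exists>n0 :: nat. \<forall>n \<ge> n0. \<forall>G \<in> SPEX_sub n \<H>.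
    \<exists>B :: nat pair_pre_digraph. spanning (with_proj B) (with_proj G) \<and>
      digraph_iso (with_proj B)
        (with_proj (generalized_book (nat (family_gamma \<H>)) (n - nat (family_gamma \<H>))))"
proof -
  define g where "g = nat (family_gamma \<H>)"
  have g: "1 \<le> g" "int g = family_gamma \<H>" using gamma by (simp_all add: g_def)
  have g_le: "int g \<le> graph_gamma H" if "H \<in> \<H>" for H
    unfolding g(2) family_gamma_def using fin that by (intro Min_le) auto
  have "family_gamma \<H> \<in> graph_gamma ` \<H>"
    unfolding family_gamma_def using fin nonempty by (intro Min_in) auto
  \<comment> \<open>A member attaining the minimum supplies the structural constants; the whole
    family enters when competitors are shown to be admissible.\<close>
  then obtain H where H: "H \<in> \<H>" "graph_gamma H = int g" using g by auto
  obtain C where C: "vertex_cover C (parcs H)" "C \<subseteq> pverts H" "int (card C) = graph_gamma H + 1"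
    by (rule minimum_vertex_cover[OF graphs[OF H(1)]])
  have "card C = Suc g" using C(3) H(2) by simp
  from sparse_of_free[OF graphs[OF H(1)] C(1,2) this] obtain c K t where
    sparse: "\<And>V E. finite V \<Longrightarrow> sym E \<Longrightarrow> irrefl E \<Longrightarrow> \<not> topological_minor H V E \<Longrightarrow>
    (\<forall>A\<subseteq>V. card (E \<inter> A \<times> A) \<le> c * card A) \<and>
    (\<forall>L\<subseteq>V. card {w \<in> V - L. g < card (nbr E w \<inter> L)} \<le> K * card L) \<and>
    (\<forall>A T. A \<subseteq> V \<longrightarrow> T \<subseteq> V \<longrightarrow> A \<inter> T = {} \<longrightarrow> card A = Suc g \<longrightarrow>
      (\<forall>a\<in>A. \<forall>b\<in>T. (a, b) \<in> E) \<longrightarrow> card T < t)" by blast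
  define m where "m = Max ((\<lambda>H. card (pverts H)) ` \<H>)"
  have m: "card (pverts H) \<le> m" if "H \<in> \<H>" for H
    unfolding m_def using fin that by (intro Max_ge) auto
  \<comment> \<open>This meets the size condition of \<open>topological_minor_switch\<close> for
    every member at once, as \<open>card L = g\<close> and all orders are at most
    \<open>m\<close>.\<close>
  define q where "q = m + g * (m + 2) + g * g"
  obtain \<epsilon> \<theta> e n0 where
    \<epsilon>: "0 < \<epsilon>" "(real t + real c + 1) * \<epsilon> \<le> 1 / 4" "16 * real q * (4 * real c + 1)\<^sup>2 * \<epsilon> \<le> 1"
    and \<theta>: "8 * real g * (real g + real t + real c) * \<theta> \<le> \<epsilon>" "\<theta> < 1"
    and e: "0 < e" "e * (real c + 1) \<le> \<theta> / 4"
    and large: "\<And>n r. n0 \<le> n \<Longrightarrow> 0 \<le> r \<Longrightarrow> real g * (real n - real g) \<le> r\<^sup>2 \<Longrightarrow>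
      2 * real g \<le> real n \<and> (real g)\<^sup>2 \<le> \<theta> / 4 * real n \<and> real q + 1 \<le> real n / 2 \<and>
      real g + 1 \<le> r \<and> 2 * (real g + real t) \<le> \<epsilon> * r \<and>
      (1 + real K) * (real c + 1) * real c \<le> e\<^sup>2 * r"
    by (rule constants_exist[OF g(1), of t c q K]) (rule that)
  show ?thesis
  \<comment> \<open>The summand \<open>g + 1\<close> keeps the independent part of the competing
    book nonempty.\<close>
  proof (intro exI[of _ "n0 + g + 1"] allI impI ballI)
    fix n G assume n: "n0 + g + 1 \<le> n" and G: "G \<in> SPEX_sub n \<H>"
    let ?V = "pverts G" and ?E = "parcs G" and ?r = "graph_spectral_radius G"
    have pg: "pair_graph G" and cV: "card ?V = n" and free: "subdivision_free \<H> G"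
      and ext: "\<And>G'. pair_graph G' \<Longrightarrow> card (pverts G') = n \<Longrightarrow> subdivision_free \<H> G' \<Longrightarrow>
        graph_spectral_radius G' \<le> ?r"
      using G by (auto simp: SPEX_sub_def subdivision_free_graphs_def)
    interpret pair_graph G by fact
    have E: "?E \<subseteq> ?V \<times> ?V" "sym ?E" "irrefl ?E" using pg by (simp_all add: pair_graph_iff)
    have nonempty: "?V \<noteq> {}" using cV n by auto
    have free': "\<not> topological_minor H' ?V ?E" if "H' \<in> \<H>" for H'
      using free that contains_subdivision_iff[OF pg graphs[OF that]] by (simp add: subdivision_free_def)
    have "graph_spectral_radius (generalized_book g (n - g)) \<le> ?r"
      using n by (intro ext pair_graph_generalized_book subdivision_free_generalized_book graphs g_le) auto
    moreover have "sqrt (real g * real (n - g)) \<le> graph_spectral_radius (generalized_book g (n - g))"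
      using n g by (intro spectral_radius_generalized_book) auto
    ultimately have r_ge: "sqrt (real g * real (n - g)) \<le> ?r" by simp
    have "0 < sqrt (real g * real (n - g))" using n g by simp
    then have r_pos: "0 < ?r" using r_ge by linarith
    have "real g * real (n - g) \<le> ?r\<^sup>2" using r_ge by (rule sqrt_le_D)
    then have r2: "real g * (real n - real g) \<le> ?r\<^sup>2" using n by (simp add: of_nat_diff)
    obtain x where x: "\<And>v. v \<in> ?V \<Longrightarrow> 0 \<le> x v" "\<And>v. v \<in> ?V \<Longrightarrow> x v \<le> 1" "\<exists>v\<in>?V. x v = 1"
      "\<And>v. v \<in> ?V \<Longrightarrow> (\<Sum>w\<in>nbr ?E v. x w) = ?r * x v"
      by (rule spectral_radius_eigenvector[OF pg nonempty]) (rule that)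
    note sp = sparse[OF pair_finite_verts E(2,3) free'[OF H(1)]]
    interpret sparse_eigenvector ?V ?E x ?r c K t g
      using sp pair_finite_verts E x r2 r_pos g by unfold_locales (auto simp: cV)
    note lg = large[of n ?r, OF _ less_imp_le[OF r_pos] r2]
    obtain L where L: "L \<subseteq> ?V" "card L = g" "\<And>l. l \<in> L \<Longrightarrow> 1 - \<epsilon> \<le> x l"
      "\<And>w. w \<in> ?V - L \<Longrightarrow> x w \<le> \<epsilon>"
      "real (card (?V - {v \<in> ?V - L. L \<subseteq> nbr ?E v})) \<le> \<epsilon> * real (card ?V)"
      by (rule core_structure[OF e \<theta>(2) _ _ _ _ \<epsilon>(1) \<theta>(1)]) (use lg n cV that in auto)
    \<comment> \<open>The switched graph is an admissible competitor, so its spectral radius is at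
      most that of \<open>G\<close>.\<close>
    have rayleigh: "bil (switch ?V ?E L (insert v B)) y y \<le> ?r * (\<Sum>u\<in>?V. (y u)\<^sup>2)"
      if B: "B \<subseteq> ?V - L" "\<And>b l. b \<in> B \<Longrightarrow> l \<in> L \<Longrightarrow> (b, l) \<in> ?E" "card B = q"
        and v: "v \<in> ?V - L" "v \<notin> B" for B v y
    proof -
      define G' where "G' = \<lparr>pverts = ?V, parcs = switch ?V ?E L (insert v B)\<rparr>"
      have pg': "pair_graph G'"
        unfolding pair_graph_iff using pair_finite_verts E by (auto simp: G'_def switch_def sym_def irrefl_def)
      have "subdivision_free \<H> G'"
        unfolding subdivision_free_def
      proof
        fix H' assume H': "H' \<in> \<H>"
        have "card (pverts H') + card L * (card (pverts H') + 2) + card L * card L \<le> card B"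
          unfolding B(3) q_def L(2) using m[OF H'] by (intro add_mono mult_mono) auto
        then have "topological_minor H' ?V (switch ?V ?E L (insert v B)) \<Longrightarrow> topological_minor H' ?V ?E"
          using topological_minor_switch[OF graphs[OF H'] E(2) pair_finite_verts L(1) B(1,2)] v by blast
        then show "\<not> contains_subdivision G' H'"
          using free'[OF H'] contains_subdivision_iff[OF pg' graphs[OF H']] by (auto simp: G'_def)
      qed
      then have "graph_spectral_radius G' \<le> ?r" using pg' cV by (intro ext) (auto simp: G'_def)
      moreover have "bil (parcs G') y y \<le> graph_spectral_radius G' * (\<Sum>u\<in>pverts G'. (y u)\<^sup>2)"
        by (rule spectral_radius_eigenvector[OF pg']) (use nonempty in \<open>auto simp: G'_def\<close>)
      moreover have "0 \<le> (\<Sum>u\<in>?V. (y u)\<^sup>2)" by (intro sum_nonneg) simp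
      ultimately show ?thesis
        by (simp add: G'_def) (meson mult_right_mono order_trans)
    qed
    have "(l, w) \<in> ?E" if "l \<in> L" "w \<in> ?V" "w \<noteq> l" for l w
      by (rule complete_core[OF L \<epsilon> _ _ rayleigh that]) (use lg n cV in auto)
    then have "\<exists>B :: nat pair_pre_digraph. spanning (with_proj B) (with_proj G) \<and>
      digraph_iso (with_proj B) (with_proj (generalized_book g (card ?V - g)))"
      by (intro spanning_generalized_book[OF pg L(1,2)])
    then show "\<exists>B :: nat pair_pre_digraph. spanning (with_proj B) (with_proj G) \<and>
      digraph_iso (with_proj B)
        (with_proj (generalized_book (nat (family_gamma \<H>)) (n - nat (family_gamma \<H>))))"
      unfolding cV g_def .
  qed
qed

end
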